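(* Let $A$ be an $n\times n$ matrix drawn from the GOE with Laplacian matrix $\mathcal{L}_A$, and let $a_n:=\sqrt{2\log n}$. Then, for any $x>0$, $$\lim_{n\to\infty}\mathbb{P}\left(a_n\left(\lambda_1(\mathcal{L}_A)-\lambda_2(\mathcal{L}_A)\right)>x\right)=e^{-x}.$$
   Context: An $n\times n$ real symmetric random matrix $A$ is drawn from the Gaussian Orthogonal Ensemble (GOE) if its entries $A_{ij}$, $1\le i\le j\le n$, are independent Gaussian random variables, $A_{ij}$ having mean zero and variance $\frac{1+\delta_{ij}}{n}$ ($\delta_{ij}$ the Kronecker delta). For a real symmetric $n\times n$ matrix $A$, its Laplacian matrix is $\mathcal{L}_A := D_A-A$, where $D_A$ is the diagonal matrix with $(D_A)_{ii}=\sum_{j=1}^n A_{ij}$. For an $n\times n$ real symmetric matrix $M$, $\lambda_n(M)\le\cdots\le\lambda_1(M)$ denote its ordered eigenvalues. *)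

theory Defs
  imports "HOL-Probability.Probability" "Jordan_Normal_Form.Char_Poly"
begin

text \<open>
  Matrices are those of \<^theory>\<open>Jordan_Normal_Form.Matrix\<close>, so that the dimension can be a
  term; their rows and columns are indexed by \<open>0, \<dots>, n - 1\<close>.
\<close>

text \<open>
  A measure space \<open>M\<close> together with a map \<open>A\<close> into matrices is a GOE random matrix of size \<open>n\<close>.
  The second parameter of \<^const>\<open>normal_density\<close> is the standard deviation.
\<close>

definition is_GOE :: "nat \<Rightarrow> 'a measure \<Rightarrow> ('a \<Rightarrow> real mat) \<Rightarrow> bool" where
  "is_GOE n M A \<longleftrightarrow>
     prob_space M \<and>
     (\<forall>\<omega>\<in>space M. A \<omega> \<in> carrier_mat n n \<and> transpose_mat (A \<omega>) = A \<omega>) \<and>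
     prob_space.indep_vars M (\<lambda>_. borel) (\<lambda>(i, j) \<omega>. A \<omega> $$ (i, j)) {(i, j). i \<le> j \<and> j < n} \<and>
     (\<forall>i j. i \<le> j \<and> j < n \<longrightarrow>
        distributed M lborel (\<lambda>\<omega>. A \<omega> $$ (i, j))
          (normal_density 0 (sqrt ((1 + (if i = j then 1 else 0)) / real n))))"

definition degree_mat :: "real mat \<Rightarrow> real mat" where
  "degree_mat A = mat_diag (dim_row A) (\<lambda>i. \<Sum>j<dim_col A. A $$ (i, j))"

definition laplacian :: "real mat \<Rightarrow> real mat" where
  "laplacian A = degree_mat A - A"

text \<open>
  \<open>ordered_eigenvalue k M\<close> is the \<open>k\<close>-th largest eigenvalue \<open>\<lambda>\<^sub>k(M)\<close>, counted from \<open>k = 1\<close> and with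
  multiplicity. The list contains the real roots of the characteristic polynomial only; for a real
  symmetric \<open>n \<times> n\<close> matrix these are all the roots, and \<open>k\<close> is meaningful for \<open>1 \<le> k \<le> n\<close>.
\<close>

definition ordered_eigenvalue :: "nat \<Rightarrow> real mat \<Rightarrow> real" where
  "ordered_eigenvalue k M = rev (sorted_list_of_multiset (proots (char_poly M))) ! (k - 1)"

end

theory Submission
  imports Defs "HOL-Combinatorics.List_Permutation" "HOL-Real_Asymp.Real_Asymp"
begin

text \<open>
  The Laplacian is \<open>D - A\<close> with \<open>D\<close> the diagonal matrix of the row sums \<open>d\<^sub>i\<close>. With high probability \<open>A\<close>
  has bounded norm, and only the few coordinates \<open>S\<close> on which \<open>d\<^sub>i\<close> is close to the maximum \<open>a\<^sub>n\<close> matter.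
  Eliminating the other coordinates (a Schur complement, written variationally) adds
  \<open>B (\<lambda> - L)\<^sup>-\<^sup>1 B\<^sup>T = (1 / a\<^sub>n) I + o(1 / a\<^sub>n)\<close> to the diagonal, where \<open>B\<close> is the block of \<open>A\<close> between \<open>S\<close> and
  its complement, because \<open>A\<^sup>2\<close> is entrywise close to \<open>I\<close> and the blocks of \<open>A\<close> on sparse sets of
  coordinates have small norm. All top eigenvalues are thus shifted by the same amount up to \<open>o(1 / a\<^sub>n)\<close>,
  so the eigenvalue gap is the gap of the two largest row sums. After removing a common shift the
  row sums are independent standard normal variables \<open>Y\<^sub>i\<close>, and comparing the density of the largest
  one at \<open>y + h\<close> and \<open>y\<close> gives, for \<open>h = x / a\<^sub>n\<close>, the gap probability
  \<open>E exp (- h max Y - h\<^sup>2 / 2) \<longlonglongrightarrow> exp (- x)\<close>, since \<open>max Y / a\<^sub>n \<longlonglongrightarrow> 1\<close>.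
\<close>

section \<open>Spectral decomposition and extremal eigenvalues\<close>

text \<open>The eigenvalue gap has size 1 / a_n, so the comparison with the row sums needs an error
  o(1 / a_n), whereas \<open>A\<close> has norm of order one: Weyl's inequality is useless and the
  second-order term must be known precisely. Two obstacles follow. The row sums are functions of
  \<open>A\<close>, so \<open>S\<close> depends on the very blocks that it selects; the sparse
  bounds are therefore proved for all small sets of coordinates at once, through a net. And the
  diagonal of L off \<open>S\<close> is not uniformly small against \<lambda>: row sums beyond a
  constant K occur, but on few coordinates only, where the sparse bound makes up for their size. For
  fixed parameters the error is not yet o(1 / a_n): multiplied by a_n it tends to a limit that
  depends on a tolerance \<epsilon> alone and vanishes with \<epsilon>. Parameters are chosen in the
  order \<epsilon>, sparsity \<eta>, K, and n last. With at most n^(1/8) indices in \<open>S\<close>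
  and entries below n^(-1/4), crude entrywise estimates inside \<open>S\<close> are good
  enough.\<close>

lemma real_symmetric_eigenvalue_exists:
  fixes A :: "real mat"
  assumes A: "A \<in> carrier_mat n n" and sym: "transpose_mat A = A" and n: "n > 0"
  obtains e where "eigenvalue A e"
proof -
  let ?C = "map_mat complex_of_real A"
  have C: "?C \<in> carrier_mat n n" using A by auto
  have Aij: "A $$ (i,j) = A $$ (j,i)" if "i < n" "j < n" for i j
    using sym A that by (metis carrier_matD index_transpose_mat(1))
  obtain as where as: "char_poly ?C = (\<Prod>a\<leftarrow>as. [:- a, 1:])" "length as = n"
    using char_poly_factorized[OF C] by blast
  then obtain z where "z \<in> set as" using n by (cases as) auto
  hence "poly (char_poly ?C) z = 0" unfolding as by (auto simp: poly_prod_list prod_list_zero_iff)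
  hence "eigenvalue ?C z" using eigenvalue_root_char_poly[OF C] by auto
  then obtain v where v: "v \<in> carrier_vec n" "v \<noteq> 0\<^sub>v n" and ev: "?C *\<^sub>v v = z \<cdot>\<^sub>v v"
    unfolding eigenvalue_def eigenvector_def using C by auto
  have ev': "(\<Sum>j<n. A $$ (i,j) * v $ j) = z * v $ i" if "i < n" for i
  proof -
    have "(?C *\<^sub>v v) $ i = (\<Sum>j<n. A $$ (i,j) * v $ j)"
      using that A v by (auto simp: scalar_prod_def lessThan_atLeast0 intro!: sum.cong)
    thus ?thesis using ev that v by auto
  qed
  define N where "N = (\<Sum>i<n. (cmod (v $ i))\<^sup>2)"
  have "\<exists>i<n. v $ i \<noteq> 0" using v by (metis eq_vecI carrier_vecD index_zero_vec)
  then obtain i where i: "i < n" "v $ i \<noteq> 0" by blast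
  have "0 < (cmod (v $ i))\<^sup>2" using i by simp
  also have "\<dots> \<le> N" unfolding N_def using i by (intro member_le_sum) auto
  finally have N: "N > 0" .
  \<comment> \<open>\<open>z * N\<close> is the Hermitian form of \<open>A\<close> at
    \<open>v\<close>. Symmetry of the real matrix makes the form equal to its conjugate, which
    forces \<open>z\<close> to be real.\<close>
  have q: "(\<Sum>i<n. cnj (v $ i) * (\<Sum>j<n. A $$ (i,j) * v $ j)) = z * N"
  proof -
    have "(\<Sum>i<n. cnj (v $ i) * (\<Sum>j<n. A $$ (i,j) * v $ j)) = (\<Sum>i<n. z * (cmod (v $ i))\<^sup>2)"
    proof (intro sum.cong refl, goal_cases)
      case (1 i)
      hence "(\<Sum>j<n. A $$ (i,j) * v $ j) = z * v $ i" by (intro ev') simp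
      thus ?case by (simp add: complex_norm_square mult_ac del: of_real_power)
    qed
    thus ?thesis by (simp add: N_def sum_distrib_left)
  qed
  have "cnj (z * N) = (\<Sum>i<n. \<Sum>j<n. v $ i * (A $$ (i,j) * cnj (v $ j)))"
    by (simp flip: q add: sum_distrib_left)
  also have "\<dots> = (\<Sum>j<n. \<Sum>i<n. v $ i * (A $$ (i,j) * cnj (v $ j)))" by (rule sum.swap)
  also have "\<dots> = z * N"
    by (simp flip: q add: sum_distrib_left) (intro sum.cong refl, use Aij in \<open>auto\<close>)
  finally have "cnj z = z" using N by auto
  then obtain e where e: "z = complex_of_real e" by (metis Reals_cnj_iff Reals_cases)
  have "of_real (poly (char_poly A) e) = poly (char_poly ?C) z"
    unfolding e by (simp add: of_real_hom.char_poly_hom[OF A] of_real_hom.poly_map_poly)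
  hence "poly (char_poly A) e = 0" using \<open>poly (char_poly ?C) z = 0\<close> by simp
  thus ?thesis using that eigenvalue_root_char_poly[OF A] by auto
qed

text \<open>\<open>W\<close> is the Householder reflection in the direction \<open>v - e\<^sub>0\<close>.\<close>

lemma reflection_to_first_unit_vec:
  fixes v :: "nat \<Rightarrow> real"
  assumes n: "n > 0" and v: "(\<Sum>i<n. (v i)\<^sup>2) = 1"
  obtains W where "W \<in> carrier_mat n n" "transpose_mat W = W" "W * W = 1\<^sub>m n" "\<And>i. i < n \<Longrightarrow> W $$ (i,0) = v i"
proof -
  define e where "e i = (if i = 0 then 1 else 0 :: real)" for i :: nat
  define w where "w i = v i - e i" for i
  \<comment> \<open>The reflection factor 2 / |w|^2, because |w|^2 = 2 - 2 * v 0. For v 0 = 1 the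
    vector is already the first unit vector, \<open>w\<close> vanishes below \<open>n\<close>, and
    \<open>c = 0\<close> makes \<open>W\<close> the identity.\<close>
  define c where "c = (if v 0 = 1 then 0 else 1 / (1 - v 0))"
  define W where "W = mat n n (\<lambda>(i,j). (if i = j then 1 else 0) - c * w i * w j)"
  have ve: "(\<Sum>i<n. f i * e i) = f 0" for f
    using n by (simp add: e_def sum.delta if_distrib[of "\<lambda>x. _ * x"] cong: if_cong)
  have "(\<Sum>i<n. (w i)\<^sup>2) = (\<Sum>i<n. (v i)\<^sup>2 - 2 * (v i * e i) + e i * e i)"
    unfolding w_def by (intro sum.cong) (auto simp: power2_eq_square algebra_simps)
  also have "\<dots> = 2 - 2 * v 0"
    using v ve[of v] ve[of e] by (simp add: sum.distrib sum_subtractf flip: sum_distrib_left) (simp add: e_def)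
  finally have ww: "(\<Sum>i<n. (w i)\<^sup>2) = 2 - 2 * v 0" .
  have w0: "v 0 = 1 \<Longrightarrow> i < n \<Longrightarrow> w i = 0" for i
    using ww by (simp add: sum_nonneg_eq_0_iff)
  have cc: "c * c * (\<Sum>k<n. (w k)\<^sup>2) = 2 * c"
  proof (cases "v 0 = 1")
    case False
    hence "c * (1 - v 0) = 1" by (simp add: c_def)
    moreover have "c * c * (2 - 2 * v 0) = 2 * c * (c * (1 - v 0))" by (simp add: algebra_simps)
    ultimately show ?thesis by (simp add: ww)
  qed (simp add: c_def)
  show ?thesis
  proof (rule that[of W])
    show "W \<in> carrier_mat n n" "transpose_mat W = W"
      unfolding W_def by (auto intro!: eq_matI)
    show "W * W = 1\<^sub>m n"
    proof (rule eq_matI, goal_cases)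
      case (1 i j)
      hence ij: "i < n" "j < n" by auto
      have "(W * W) $$ (i,j) = (\<Sum>k<n. ((if i = k then 1 else 0) - c * w i * w k) * ((if k = j then 1 else 0) - c * w k * w j))"
        using ij by (simp add: W_def scalar_prod_def lessThan_atLeast0)
      also have "\<dots> = (\<Sum>k<n. (if i = k then (if k = j then 1 else 0) else 0) - (if i = k then c * w k * w j else 0)
           - (if k = j then c * w i * w k else 0) + w i * w j * (c * c * (w k)\<^sup>2))"
        by (intro sum.cong) (auto simp: algebra_simps power2_eq_square)
      also have "\<dots> = (if i = j then 1 else 0) - c * w i * w j - c * w i * w j + w i * w j * (c * c * (\<Sum>k<n. (w k)\<^sup>2))"
        using ij by (simp add: sum.distrib sum_subtractf sum_distrib_left sum.delta)
      also have "\<dots> = (if i = j then 1 else 0)" unfolding cc by simp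
      finally show ?case using ij by simp
    qed (auto simp: W_def)
    show "W $$ (i,0) = v i" if "i < n" for i
    proof (cases "v 0 = 1")
      case True
      thus ?thesis using that n w0[OF True that] by (auto simp: W_def w_def e_def)
    next
      case False
      hence "c * w 0 = -1" by (simp add: c_def w_def e_def field_simps)
      hence *: "c * w i * w 0 = - w i" by (metis mult.commute mult.left_commute mult_minus1_right)
      show ?thesis using that n by (simp add: W_def *) (auto simp: w_def e_def)
    qed
  qed
qed

text \<open>Deflation: a reflection \<open>W\<close> with a unit eigenvector as its first column
  makes the first column of \<open>W * A * W\<close> a multiple of the first unit vector. Symmetry
  clears the first row as well, and the induction hypothesis applies to the remaining block.\<close>

lemma real_symmetric_diagonalization:
  fixes A :: "real mat"
  assumes "A \<in> carrier_mat n n" and "transpose_mat A = A"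
  shows "\<exists>U D. U \<in> carrier_mat n n \<and> D \<in> carrier_mat n n \<and> transpose_mat U * U = 1\<^sub>m n \<and>
      diagonal_mat D \<and> A = U * D * transpose_mat U"
  using assms
proof (induction n arbitrary: A)
  case 0
  show ?case by (intro exI[of _ "1\<^sub>m 0"]) (use 0 in \<open>auto intro!: eq_matI simp: diagonal_mat_def\<close>)
next
  case (Suc n)
  let ?n = "Suc n"
  note A = Suc.prems(1)
  obtain e where "eigenvalue A e" using real_symmetric_eigenvalue_exists[OF Suc.prems] by auto
  then obtain v where v: "v \<in> carrier_vec ?n" "v \<noteq> 0\<^sub>v ?n" "A *\<^sub>v v = e \<cdot>\<^sub>v v"
    unfolding eigenvalue_def eigenvector_def using A by auto
  define N where "N = (\<Sum>i<?n. (v $ i)\<^sup>2)"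
  have "\<exists>i<?n. v $ i \<noteq> 0" using v by (metis eq_vecI carrier_vecD index_zero_vec)
  then obtain i where i: "i < ?n" "v $ i \<noteq> 0" by blast
  have "0 < (v $ i)\<^sup>2" using i by simp
  also have "\<dots> \<le> N" unfolding N_def using i by (intro member_le_sum) auto
  finally have N: "N > 0" .
  have "(\<Sum>i<?n. (v $ i / sqrt N)\<^sup>2) = 1"
    using N by (simp add: power_divide N_def[symmetric] flip: sum_divide_distrib del: sum.lessThan_Suc)
  then obtain W where W: "W \<in> carrier_mat ?n ?n" "transpose_mat W = W" "W * W = 1\<^sub>m ?n"
      "\<And>i. i < ?n \<Longrightarrow> W $$ (i,0) = v $ i / sqrt N"
    by (rule reflection_to_first_unit_vec[rotated]) auto
  define B where "B = W * A * W"
  have B: "B \<in> carrier_mat ?n ?n" unfolding B_def using A W by auto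
  have Bsym: "transpose_mat B = B"
    unfolding B_def using A W Suc.prems(2)
    by (simp add: transpose_mult[of _ ?n ?n _ ?n] assoc_mult_mat[of _ ?n ?n _ ?n _ ?n])
  have colW: "col W 0 = (1 / sqrt N) \<cdot>\<^sub>v v"
    using W v by (intro eq_vecI) auto
  have Wc: "col W 0 \<in> carrier_vec ?n" using W(1) by (metis carrier_matD(1) col_dim)
  have "col B 0 = W *\<^sub>v (A *\<^sub>v col W 0)"
  proof -
    have "col B 0 = (W * A) *\<^sub>v col W 0"
      unfolding B_def using A W by (intro col_mult2[of _ ?n ?n _ ?n]) auto
    also have "\<dots> = W *\<^sub>v (A *\<^sub>v col W 0)"
      using A W(1) Wc by (rule_tac assoc_mult_mat_vec)
    finally show ?thesis .
  qed
  also have "A *\<^sub>v col W 0 = e \<cdot>\<^sub>v col W 0"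
    unfolding colW mult_mat_vec[OF A v(1)] v(3) by (simp add: smult_smult_assoc mult.commute)
  also have "W *\<^sub>v (e \<cdot>\<^sub>v col W 0) = e \<cdot>\<^sub>v (W *\<^sub>v col W 0)"
    by (rule mult_mat_vec[OF W(1) Wc])
  also have "W *\<^sub>v col W 0 = col (W * W) 0"
    using W(1) by (subst col_mult2[of _ ?n ?n _ ?n]) auto
  also have "col (W * W) 0 = unit_vec ?n 0" unfolding W(3) by (intro eq_vecI) auto
  finally have colB: "col B 0 = e \<cdot>\<^sub>v unit_vec ?n 0" .
  have B0: "B $$ (i,0) = (if i = 0 then e else 0)" if "i < ?n" for i
    using arg_cong[OF colB, of "\<lambda>x. x $ i"] that B by (auto simp: unit_vec_def)
  have Bs: "B $$ (i,j) = B $$ (j,i)" if "i < ?n" "j < ?n" for i j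
    using Bsym B that by (metis carrier_matD index_transpose_mat(1))
  define B' where "B' = mat n n (\<lambda>(i,j). B $$ (Suc i, Suc j))"
  have B': "B' \<in> carrier_mat n n" by (simp add: B'_def)
  have "transpose_mat B' = B'" unfolding B'_def by (intro eq_matI) (auto simp: Bs)
  from Suc.IH[OF B' this] obtain U D where U: "U \<in> carrier_mat n n" "D \<in> carrier_mat n n"
      "transpose_mat U * U = 1\<^sub>m n" "diagonal_mat D" "B' = U * D * transpose_mat U" by blast
  define blk where "blk x Y = four_block_mat (mat 1 1 (\<lambda>_. x)) (0\<^sub>m 1 n) (0\<^sub>m n 1) Y" for x :: real and Y
  have blk_carrier [simp]: "blk x Y \<in> carrier_mat ?n ?n" if "Y \<in> carrier_mat n n" for x Y
    unfolding blk_def using four_block_carrier_mat[of "mat 1 1 (\<lambda>_. x)" 1 1 Y n n] that by simp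
  have blk_mult: "blk x X * blk y Y = blk (x * y) (X * Y)"
    if "X \<in> carrier_mat n n" "Y \<in> carrier_mat n n" for x y X Y
    unfolding blk_def using that
    by (subst mult_four_block_mat[of _ 1 1 _ n _ n _ _ 1 _ n])
       (auto intro!: arg_cong4[where f=four_block_mat] eq_matI simp: scalar_prod_def)
  have blk_T: "transpose_mat (blk x X) = blk x (transpose_mat X)" if "X \<in> carrier_mat n n" for x X
    unfolding blk_def using that by (subst transpose_four_block_mat[of _ 1 1 _ n _ n]) (auto intro!: arg_cong4[where f=four_block_mat] eq_matI)
  have blk_1: "blk 1 (1\<^sub>m n) = 1\<^sub>m ?n"
    unfolding blk_def by (auto intro!: eq_matI)
  have Beq: "B = blk e B'"
  proof (rule eq_matI, goal_cases)
    case (1 i j)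
    hence "i < ?n" "j < ?n" using B' by (auto simp: blk_def)
    thus ?case using B0[of i] B0[of j] Bs[of i j]
      by (auto simp: blk_def B'_def)
  qed (use B B' in \<open>auto simp: blk_def\<close>)
  let ?V = "W * blk 1 U" and ?E = "blk e D"
  have WWX: "W * (W * X) = X" if "X \<in> carrier_mat ?n ?n" for X
    using W that by (simp flip: assoc_mult_mat[of _ ?n ?n _ ?n _ ?n])
  have "transpose_mat ?V * ?V = blk 1 (transpose_mat U) * blk 1 U"
    using W U by (simp add: transpose_mult[of _ ?n ?n _ ?n] assoc_mult_mat[of _ ?n ?n _ ?n _ ?n] blk_T WWX del: W(3))
  also have "\<dots> = 1\<^sub>m ?n"
    using U by (simp add: blk_mult blk_1)
  finally have 1: "transpose_mat ?V * ?V = 1\<^sub>m ?n" .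
  have "A = W * B * W"
    using A W unfolding B_def by (simp add: assoc_mult_mat[of _ ?n ?n _ ?n _ ?n] WWX)
  also have "B = blk 1 U * ?E * blk 1 (transpose_mat U)"
    using U unfolding Beq by (simp add: blk_mult)
  also have "W * \<dots> * W = ?V * ?E * transpose_mat ?V"
    using W U by (simp add: mult_carrier_mat[of _ ?n ?n _ ?n] transpose_mult[of _ ?n ?n _ ?n] assoc_mult_mat[of _ ?n ?n _ ?n _ ?n] blk_T)
  finally have 2: "A = ?V * ?E * transpose_mat ?V" .
  have 3: "diagonal_mat ?E"
    unfolding diagonal_mat_def
  proof (intro allI impI, goal_cases)
    case (1 i j)
    thus ?case using U(2,4) by (auto simp: blk_def diagonal_mat_def)
  qed
  show ?case
    using 1 2 3 W(1) U by (intro exI[of _ ?V] exI[of _ ?E]) auto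
qed

lemma proots_prod_linear: "proots (\<Prod>a\<leftarrow>as. [:- a, 1:]) = mset (as :: 'a :: idom list)"
proof (induction as)
  case (Cons a as)
  have "(\<Prod>a\<leftarrow>as. [:- a, 1:]) \<noteq> 0" by (auto simp: prod_list_zero_iff)
  thus ?case using Cons proots_linear_factor[of a] by (simp add: proots_mult del: mult_pCons_left)
qed simp

text \<open>Orthonormality and completeness of the eigenvectors are the two products of
  \<open>U\<close> with its transpose. \<open>ordered_eigenvalue\<close> reads a sorted list of
  roots of the characteristic polynomial, so the columns of \<open>U\<close> are permuted by the
  bijection \<open>f\<close> that sorts the diagonal of \<open>D\<close>.\<close>

lemma real_symmetric_spectral:
  fixes A :: "real mat"
  assumes A: "A \<in> carrier_mat n n" and sym: "transpose_mat A = A"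
  obtains u :: "nat \<Rightarrow> nat \<Rightarrow> real" and \<mu> :: "nat \<Rightarrow> real" where
    "\<And>k l. k < n \<Longrightarrow> l < n \<Longrightarrow> (\<Sum>i<n. u k i * u l i) = (if k = l then 1 else 0)"
    "\<And>i j. i < n \<Longrightarrow> j < n \<Longrightarrow> (\<Sum>k<n. u k i * u k j) = (if i = j then 1 else 0)"
    "\<And>i j. i < n \<Longrightarrow> j < n \<Longrightarrow> A $$ (i,j) = (\<Sum>k<n. \<mu> k * u k i * u k j)"
    "\<And>k l. k \<le> l \<Longrightarrow> l < n \<Longrightarrow> \<mu> l \<le> \<mu> k"
    "\<And>k. k < n \<Longrightarrow> ordered_eigenvalue (Suc k) A = \<mu> k"
proof -
  obtain U D where U: "U \<in> carrier_mat n n" and D: "D \<in> carrier_mat n n" and UU: "transpose_mat U * U = 1\<^sub>m n"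
      and dD: "diagonal_mat D" and AUD: "A = U * D * transpose_mat U"
    using real_symmetric_diagonalization[OF assms] by blast
  have UU': "U * transpose_mat U = 1\<^sub>m n" using mat_mult_left_right_inverse[OF _ U UU] U by auto
  have "similar_mat A D"
    unfolding similar_mat_def similar_mat_wit_def
    by (intro exI[of _ U] exI[of _ "transpose_mat U"]) (use U D A UU UU' AUD in \<open>auto simp: Let_def\<close>)
  hence "char_poly A = char_poly D" by (rule char_poly_similar)
  also have "\<dots> = (\<Prod>a\<leftarrow>diag_mat D. [:- a, 1:])"
    using D dD by (intro char_poly_upper_triangular[OF D]) (auto simp: diagonal_mat_def)
  finally have pr: "proots (char_poly A) = mset (diag_mat D)" by (simp add: proots_prod_linear)
  define es where "es = diag_mat D"
  define ms where "ms = rev (sorted_list_of_multiset (mset es))"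
  have len: "length es = n" "length ms = n"
  proof -
    show *: "length es = n" using D by (simp add: es_def diag_mat_def)
    have "mset ms = mset es" by (simp add: ms_def)
    thus "length ms = n" using * mset_eq_length by metis
  qed
  have "mset ms = mset es" by (simp add: ms_def)
  then obtain f where f: "bij_betw f {..<n} {..<n}" "\<And>i. i < n \<Longrightarrow> ms ! i = es ! f i"
    using permutation_Ex_bij[of ms es] len by auto
  have fn: "f k < n" if "k < n" for k using f(1) that by (auto simp: bij_betw_def)
  define u where "u k i = U $$ (i, f k)" for k i
  have reidx: "(\<Sum>k<n. g (f k)) = (\<Sum>k<n. g k)" for g :: "nat \<Rightarrow> real"
    using sum.reindex_bij_betw[OF f(1), of g] .
  have srt: "sorted (rev ms)" by (simp add: ms_def)
  show ?thesis
  proof (rule that[of u "\<lambda>k. ms ! k"])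
    fix k l assume kl: "k < n" "l < n"
    have "(\<Sum>i<n. u k i * u l i) = (transpose_mat U * U) $$ (f k, f l)"
      using kl fn U by (simp add: u_def scalar_prod_def lessThan_atLeast0)
    also have "\<dots> = (if k = l then 1 else 0)"
      using kl fn f(1) by (auto simp: UU bij_betw_def inj_on_def)
    finally show "(\<Sum>i<n. u k i * u l i) = (if k = l then 1 else 0)" .
    have "(\<Sum>i<n. u i k * u i l) = (\<Sum>i<n. U $$ (k, i) * U $$ (l, i))"
      unfolding u_def by (rule reidx)
    also have "\<dots> = (U * transpose_mat U) $$ (k, l)"
      using kl U by (simp add: scalar_prod_def lessThan_atLeast0)
    finally show "(\<Sum>i<n. u i k * u i l) = (if k = l then 1 else 0)" using kl by (simp add: UU')
    have "A $$ (k,l) = (\<Sum>j<n. (\<Sum>i<n. U $$ (k,i) * D $$ (i,j)) * U $$ (l,j))"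
    proof -
      have mm: "(X * Y) $$ (i,j) = (\<Sum>m<n. X $$ (i,m) * Y $$ (m,j))"
        if "i < n" "j < n" "X \<in> carrier_mat n n" "Y \<in> carrier_mat n n" for X Y :: "real mat" and i j
        using that by (simp add: scalar_prod_def lessThan_atLeast0)
      have "A $$ (k,l) = (\<Sum>j<n. (U * D) $$ (k,j) * transpose_mat U $$ (j,l))"
        unfolding AUD using kl U D by (intro mm) auto
      also have "\<dots> = (\<Sum>j<n. (\<Sum>i<n. U $$ (k,i) * D $$ (i,j)) * U $$ (l,j))"
        using kl U D by (intro sum.cong refl) (simp add: mm del: index_mult_mat)
      finally show ?thesis .
    qed
    also have "\<dots> = (\<Sum>j<n. es ! j * U $$ (k,j) * U $$ (l,j))"
    proof (intro sum.cong refl, goal_cases)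
      case (1 j)
      have "(\<Sum>i<n. U $$ (k,i) * D $$ (i,j)) = (\<Sum>i<n. if i = j then U $$ (k,j) * D $$ (j,j) else 0)"
        using 1 D dD by (intro sum.cong) (auto simp: diagonal_mat_def)
      also have "\<dots> = U $$ (k,j) * es ! j" using 1 D by (simp add: es_def diag_mat_def)
      finally show ?case by simp
    qed
    also have "\<dots> = (\<Sum>i<n. es ! f i * U $$ (k,f i) * U $$ (l,f i))" by (rule reidx[symmetric])
    also have "\<dots> = (\<Sum>i<n. ms ! i * u i k * u i l)"
      unfolding u_def by (intro sum.cong) (auto simp: f)
    finally show "A $$ (k,l) = (\<Sum>i<n. ms ! i * u i k * u i l)" .
  next
    fix k l assume "k \<le> l" "l < n"
    thus "ms ! l \<le> ms ! k" using srt len by (auto simp: sorted_rev_iff_nth_mono)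
  next
    fix k assume "k < n"
    show "ordered_eigenvalue (Suc k) A = ms ! k"
      by (simp add: ordered_eigenvalue_def pr ms_def es_def)
  qed
qed

section \<open>Rayleigh quotients and the two largest eigenvalues\<close>

definition quad_form :: "nat \<Rightarrow> (nat \<Rightarrow> nat \<Rightarrow> real) \<Rightarrow> (nat \<Rightarrow> real) \<Rightarrow> (nat \<Rightarrow> real) \<Rightarrow> real" where
  "quad_form n a x y = (\<Sum>i<n. \<Sum>j<n. a i j * x i * y j)"

definition sq_norm :: "nat \<Rightarrow> (nat \<Rightarrow> real) \<Rightarrow> real" where
  "sq_norm n x = (\<Sum>i<n. (x i)\<^sup>2)"

lemma sq_norm_nonneg [simp]: "sq_norm n x \<ge> 0"
  by (simp add: sq_norm_def sum_nonneg)

text \<open>The form in which the spectral theorem is used: Parseval and the diagonalized form, for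
  arbitrary functions \<open>x\<close> whose values from \<open>n\<close> on are ignored. Vectors as
  functions allow supports to be changed without dimension bookkeeping.\<close>

definition eigenbasis :: "nat \<Rightarrow> real mat \<Rightarrow> (nat \<Rightarrow> nat \<Rightarrow> real) \<Rightarrow> (nat \<Rightarrow> real) \<Rightarrow> bool" where
  "eigenbasis n A u \<mu> \<longleftrightarrow>
     (\<forall>k<n. \<forall>l<n. (\<Sum>i<n. u k i * u l i) = (if k = l then 1 else 0)) \<and>
     (\<forall>x. sq_norm n x = (\<Sum>k<n. (\<Sum>i<n. u k i * x i)\<^sup>2)) \<and>
     (\<forall>x. quad_form n (\<lambda>i j. A $$ (i,j)) x x = (\<Sum>k<n. \<mu> k * (\<Sum>i<n. u k i * x i)\<^sup>2)) \<and>
     (\<forall>l<n. \<forall>k\<le>l. \<mu> l \<le> \<mu> k) \<and>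
     (\<forall>k<n. ordered_eigenvalue (Suc k) A = \<mu> k)"

lemma eigenbasisD:
  assumes "eigenbasis n A u \<mu>"
  shows "\<And>k l. k < n \<Longrightarrow> l < n \<Longrightarrow> (\<Sum>i<n. u k i * u l i) = (if k = l then 1 else 0)"
    and "\<And>x. sq_norm n x = (\<Sum>k<n. (\<Sum>i<n. u k i * x i)\<^sup>2)"
    and "\<And>x. quad_form n (\<lambda>i j. A $$ (i,j)) x x = (\<Sum>k<n. \<mu> k * (\<Sum>i<n. u k i * x i)\<^sup>2)"
    and "\<And>k l. k \<le> l \<Longrightarrow> l < n \<Longrightarrow> \<mu> l \<le> \<mu> k"
    and "\<And>k. k < n \<Longrightarrow> ordered_eigenvalue (Suc k) A = \<mu> k"
  using assms unfolding eigenbasis_def by blast+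

lemma eigenbasis_exists:
  fixes A :: "real mat"
  assumes "A \<in> carrier_mat n n" and "transpose_mat A = A"
  shows "\<exists>u \<mu>. eigenbasis n A u \<mu>"
proof (rule real_symmetric_spectral[OF assms], goal_cases)
  case (1 u \<mu>)
  note u = 1
  have ex: "(\<Sum>k<n. c k * (\<Sum>i<n. u k i * x i)\<^sup>2) = (\<Sum>i<n. \<Sum>j<n. (\<Sum>k<n. c k * u k i * u k j) * x i * x j)"
    for c x :: "nat \<Rightarrow> real"
  proof -
    have "(\<Sum>k<n. c k * (\<Sum>i<n. u k i * x i)\<^sup>2) = (\<Sum>k<n. \<Sum>i<n. \<Sum>j<n. c k * u k i * u k j * x i * x j)"
      by (simp add: power2_eq_square sum_product sum_distrib_left mult_ac)
    also have "\<dots> = (\<Sum>i<n. \<Sum>k<n. \<Sum>j<n. c k * u k i * u k j * x i * x j)" by (rule sum.swap)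
    also have "\<dots> = (\<Sum>i<n. \<Sum>j<n. \<Sum>k<n. c k * u k i * u k j * x i * x j)"
      by (intro sum.cong refl sum.swap)
    finally show ?thesis by (simp add: sum_distrib_right)
  qed
  {
    fix x :: "nat \<Rightarrow> real"
    have "(\<Sum>k<n. (\<Sum>i<n. u k i * x i)\<^sup>2) = (\<Sum>i<n. \<Sum>j<n. (\<Sum>k<n. u k i * u k j) * x i * x j)"
      using ex[of "\<lambda>_. 1" x] by simp
    also have "\<dots> = (\<Sum>i<n. \<Sum>j<n. if i = j then x i * x i else 0)"
      by (intro sum.cong refl) (use u(2) in \<open>auto\<close>)
    also have "\<dots> = sq_norm n x" by (simp add: sq_norm_def power2_eq_square)
    finally have 2: "sq_norm n x = (\<Sum>k<n. (\<Sum>i<n. u k i * x i)\<^sup>2)" by simp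
    have 3: "quad_form n (\<lambda>i j. A $$ (i,j)) x x = (\<Sum>k<n. \<mu> k * (\<Sum>i<n. u k i * x i)\<^sup>2)"
      unfolding ex quad_form_def by (intro sum.cong refl) (use u(3) in \<open>auto\<close>)
    note 2 3
  }
  note 23 = this
  show ?case
    unfolding eigenbasis_def using u(1,4,5) 23 by (intro exI[of _ u] exI[of _ \<mu>]) simp
qed

context
  fixes A :: "real mat" and n :: nat
  assumes A: "A \<in> carrier_mat n n" "transpose_mat A = A"
begin

lemma first_eigenvalue_attained:
  assumes "n \<ge> 1"
  obtains f where "sq_norm n f = 1" "quad_form n (\<lambda>i j. A $$ (i,j)) f f = ordered_eigenvalue 1 A"
proof -
  obtain u \<mu> where "eigenbasis n A u \<mu>" using eigenbasis_exists[OF A] by blast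
  note u = eigenbasisD[OF this]
  have "(\<Sum>k<n. c k * (\<Sum>i<n. u k i * u 0 i)\<^sup>2) = (\<Sum>k<n. if k = 0 then c k else 0)" for c :: "nat \<Rightarrow> real"
    by (intro sum.cong refl) (use u(1) assms in \<open>auto\<close>)
  hence "(\<Sum>k<n. c k * (\<Sum>i<n. u k i * u 0 i)\<^sup>2) = c 0" for c :: "nat \<Rightarrow> real" using assms by simp
  from this[of "\<lambda>_. 1"] this[of \<mu>] show ?thesis
    using assms u(5)[of 0] by (intro that[of "u 0"]) (simp_all add: u(2,3))
qed

lemma first_eigenvalue_ge:
  assumes n: "n \<ge> 1" and x: "sq_norm n x > 0" "quad_form n (\<lambda>i j. A $$ (i,j)) x x \<ge> l * sq_norm n x"
  shows "ordered_eigenvalue 1 A \<ge> l"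
proof -
  obtain u \<mu> where "eigenbasis n A u \<mu>" using eigenbasis_exists[OF A] by blast
  note u = eigenbasisD[OF this]
  have "l * sq_norm n x \<le> (\<Sum>k<n. \<mu> 0 * (\<Sum>i<n. u k i * x i)\<^sup>2)"
    using x(2) unfolding u(3) by (rule order_trans) (intro sum_mono mult_right_mono u(4), auto)
  also have "\<dots> = \<mu> 0 * sq_norm n x" by (simp add: u(2) sum_distrib_left)
  finally show ?thesis using x(1) u(5)[of 0] n by simp
qed

lemma first_eigenvalue_le:
  assumes n: "n \<ge> 1" and x: "\<And>x. quad_form n (\<lambda>i j. A $$ (i,j)) x x \<le> l * sq_norm n x"
  shows "ordered_eigenvalue 1 A \<le> l"
proof -
  obtain f where "sq_norm n f = 1" "quad_form n (\<lambda>i j. A $$ (i,j)) f f = ordered_eigenvalue 1 A"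
    using first_eigenvalue_attained n by blast
  thus ?thesis using x[of f] by simp
qed

text \<open>The span of the first two eigenvectors; the lower bound holds because
  \<open>\<mu> 1 \<le> \<mu> 0\<close>. It serves both in the min-max upper bound and as a trial
  plane for a perturbed matrix.\<close>

lemma second_eigenvalue_plane:
  assumes "n \<ge> 2"
  obtains f g where "\<And>a b. sq_norm n (\<lambda>i. a * f i + b * g i) = a\<^sup>2 + b\<^sup>2"
    "\<And>a b. quad_form n (\<lambda>i j. A $$ (i,j)) (\<lambda>i. a * f i + b * g i) (\<lambda>i. a * f i + b * g i) \<ge> ordered_eigenvalue 2 A * (a\<^sup>2 + b\<^sup>2)"
proof -
  obtain u \<mu> where "eigenbasis n A u \<mu>" using eigenbasis_exists[OF A] by blast
  note u = eigenbasisD[OF this]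
  have *: "(\<Sum>k<n. c k * (\<Sum>i<n. u k i * (a * u 0 i + b * u 1 i))\<^sup>2) = c 0 * a\<^sup>2 + c 1 * b\<^sup>2" for c a b
  proof -
    have "(\<Sum>k<n. c k * (\<Sum>i<n. u k i * (a * u 0 i + b * u 1 i))\<^sup>2)
        = (\<Sum>k<n. c k * (a * (\<Sum>i<n. u k i * u 0 i) + b * (\<Sum>i<n. u k i * u 1 i))\<^sup>2)"
      by (simp add: sum.distrib sum_distrib_left algebra_simps)
    also have "\<dots> = (\<Sum>k<n. (if k = 0 then c 0 * a\<^sup>2 else 0) + (if k = 1 then c 1 * b\<^sup>2 else 0))"
      by (intro sum.cong refl) (use u(1) assms in \<open>auto\<close>)
    also have "\<dots> = c 0 * a\<^sup>2 + c 1 * b\<^sup>2" using assms by (simp add: sum.distrib)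
    finally show ?thesis .
  qed
  show ?thesis
  proof (rule that[of "u 0" "u 1"])
    fix a b
    show "sq_norm n (\<lambda>i. a * u 0 i + b * u 1 i) = a\<^sup>2 + b\<^sup>2"
      unfolding u(2) using *[of "\<lambda>_. 1" a b] by simp
    have "\<mu> 1 * a\<^sup>2 \<le> \<mu> 0 * a\<^sup>2" using u(4)[of 0 1] assms by (intro mult_right_mono) auto
    thus "quad_form n (\<lambda>i j. A $$ (i,j)) (\<lambda>i. a * u 0 i + b * u 1 i) (\<lambda>i. a * u 0 i + b * u 1 i) \<ge> ordered_eigenvalue 2 A * (a\<^sup>2 + b\<^sup>2)"
      unfolding u(3) * using u(5)[of 1] assms by (simp add: numeral_2_eq_2 algebra_simps)
  qed
qed

text \<open>Every plane contains a nonzero vector orthogonal to the top eigenvector, and there the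
  form is at most \<open>\<mu> 1\<close> times the squared norm. The assumption \<open>ind\<close>
  makes \<open>f\<close> and \<open>g\<close> span a genuine plane on the first \<open>n\<close>
  coordinates.\<close>

lemma second_eigenvalue_ge:
  assumes n: "n \<ge> 2"
    and ind: "\<And>a b. sq_norm n (\<lambda>i. a * f i + b * g i) = 0 \<Longrightarrow> a = 0 \<and> b = 0"
    and q: "\<And>a b. quad_form n (\<lambda>i j. A $$ (i,j)) (\<lambda>i. a * f i + b * g i) (\<lambda>i. a * f i + b * g i) \<ge> l * sq_norm n (\<lambda>i. a * f i + b * g i)"
  shows "ordered_eigenvalue 2 A \<ge> l"
proof -
  obtain u \<mu> where "eigenbasis n A u \<mu>" using eigenbasis_exists[OF A] by blast
  note u = eigenbasisD[OF this]
  define F where "F = (\<Sum>i<n. u 0 i * f i)"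
  define G where "G = (\<Sum>i<n. u 0 i * g i)"
  \<comment> \<open>A nontrivial solution of \<open>a * F + b * G = 0\<close>, also when
    \<open>F\<close> and \<open>G\<close> both vanish.\<close>
  define a where "a = (if F = 0 then 1 else G)"
  define b where "b = (if F = 0 then 0 else - F)"
  have ab: "\<not> (a = 0 \<and> b = 0)" and ab0: "a * F + b * G = 0" by (auto simp: a_def b_def)
  define x where "x = (\<lambda>i. a * f i + b * g i)"
  have x: "sq_norm n x > 0" using ind[of a b] ab sq_norm_nonneg[of n x] unfolding x_def by linarith
  have "(\<Sum>i<n. u 0 i * x i) = a * F + b * G"
    by (simp add: x_def F_def G_def sum.distrib sum_distrib_left algebra_simps)
  hence x0: "(\<Sum>i<n. u 0 i * x i) = 0" using ab0 by simp
  have "l * sq_norm n x \<le> (\<Sum>k<n. \<mu> k * (\<Sum>i<n. u k i * x i)\<^sup>2)"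
    using q[of a b] by (simp add: x_def u(3))
  also have "\<dots> \<le> (\<Sum>k<n. \<mu> 1 * (\<Sum>i<n. u k i * x i)\<^sup>2)"
  proof (rule sum_mono, goal_cases)
    case (1 k)
    thus ?case using x0 u(4)[of 1 k] by (cases "k = 0") (auto intro!: mult_right_mono)
  qed
  also have "\<dots> = \<mu> 1 * sq_norm n x" by (simp add: u(2) sum_distrib_left)
  finally show ?thesis using x u(5)[of 1] n by (simp add: numeral_2_eq_2)
qed

text \<open>The plane of the top two eigenvectors meets every hyperplane. Coordinate hyperplanes are
  enough here: the one to remove later belongs to the largest row sum.\<close>

lemma second_eigenvalue_le:
  assumes n: "n \<ge> 2" and q: "\<And>x. x m = 0 \<Longrightarrow> quad_form n (\<lambda>i j. A $$ (i,j)) x x \<le> l * sq_norm n x"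
  shows "ordered_eigenvalue 2 A \<le> l"
proof -
  obtain f g where fg: "\<And>a b. sq_norm n (\<lambda>i. a * f i + b * g i) = a\<^sup>2 + b\<^sup>2"
    "\<And>a b. quad_form n (\<lambda>i j. A $$ (i,j)) (\<lambda>i. a * f i + b * g i) (\<lambda>i. a * f i + b * g i) \<ge> ordered_eigenvalue 2 A * (a\<^sup>2 + b\<^sup>2)"
    using second_eigenvalue_plane[OF n] by blast
  define a where "a = (if f m = 0 then 1 else g m)"
  define b where "b = (if f m = 0 then 0 else - f m)"
  have "a \<noteq> 0 \<or> b \<noteq> 0" and ab0: "a * f m + b * g m = 0" by (auto simp: a_def b_def)
  hence pos: "a\<^sup>2 + b\<^sup>2 > 0" by (simp add: sum_power2_gt_zero_iff)
  have "ordered_eigenvalue 2 A * (a\<^sup>2 + b\<^sup>2) \<le> l * (a\<^sup>2 + b\<^sup>2)"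
    using fg(2)[of a b] q[of "\<lambda>i. a * f i + b * g i"] ab0 unfolding fg(1) by linarith
  thus ?thesis using pos by simp
qed

end

lemma quad_form_diff_le:
  "quad_form n a x x \<le> quad_form n b x x + (\<Sum>i<n. \<Sum>j<n. \<bar>a i j - b i j\<bar>) * sq_norm n x"
proof -
  have xy: "\<bar>x i * x j\<bar> \<le> sq_norm n x" if "i < n" "j < n" for i j
  proof -
    have "\<bar>x k\<bar> \<le> sqrt (sq_norm n x)" if "k < n" for k
    proof -
      have "(x k)\<^sup>2 \<le> sq_norm n x" unfolding sq_norm_def using that by (intro member_le_sum) auto
      hence "sqrt ((x k)\<^sup>2) \<le> sqrt (sq_norm n x)" by (rule real_sqrt_le_mono)
      thus ?thesis by simp
    qed
    hence "\<bar>x i\<bar> * \<bar>x j\<bar> \<le> sqrt (sq_norm n x) * sqrt (sq_norm n x)" using that by (intro mult_mono) auto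
    thus ?thesis by (simp add: abs_mult)
  qed
  have "quad_form n a x x - quad_form n b x x = (\<Sum>i<n. \<Sum>j<n. (a i j - b i j) * (x i * x j))"
    by (simp add: quad_form_def sum_subtractf algebra_simps)
  also have "\<dots> \<le> (\<Sum>i<n. \<Sum>j<n. \<bar>a i j - b i j\<bar> * sq_norm n x)"
  proof (intro sum_mono, goal_cases)
    case (1 i j)
    have "(a i j - b i j) * (x i * x j) \<le> \<bar>a i j - b i j\<bar> * \<bar>x i * x j\<bar>" by (metis abs_ge_self abs_mult)
    also have "\<dots> \<le> \<bar>a i j - b i j\<bar> * sq_norm n x" using xy 1 by (intro mult_left_mono) auto
    finally show ?case .
  qed
  finally show ?thesis by (simp add: sum_distrib_right)
qed

text \<open>A Weyl inequality with the crude entrywise l1 distance, meant for continuity in the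
  entries and thereby for measurability.\<close>

lemma ordered_eigenvalue_perturbation:
  fixes A B :: "real mat"
  assumes n: "n \<ge> 2" and k: "k \<in> {1,2}"
    and A: "A \<in> carrier_mat n n" "transpose_mat A = A" and B: "B \<in> carrier_mat n n" "transpose_mat B = B"
  shows "ordered_eigenvalue k A \<le> ordered_eigenvalue k B + (\<Sum>i<n. \<Sum>j<n. \<bar>A $$ (i,j) - B $$ (i,j)\<bar>)"
proof -
  define e where "e = (\<Sum>i<n. \<Sum>j<n. \<bar>A $$ (i,j) - B $$ (i,j)\<bar>)"
  have AB: "quad_form n (\<lambda>i j. A $$ (i,j)) x x \<le> quad_form n (\<lambda>i j. B $$ (i,j)) x x + e * sq_norm n x" for x
    unfolding e_def by (rule quad_form_diff_le)
  show ?thesis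
  proof (cases "k = 1")
    case True
    obtain f where f: "sq_norm n f = 1" "quad_form n (\<lambda>i j. A $$ (i,j)) f f = ordered_eigenvalue 1 A"
      using first_eigenvalue_attained[OF A] n by auto
    have "ordered_eigenvalue 1 A - e \<le> ordered_eigenvalue 1 B"
      by (rule first_eigenvalue_ge[OF B, of f]) (use f AB[of f] n in auto)
    thus ?thesis using True by (simp add: e_def)
  next
    case False
    obtain f g where fg: "\<And>a b. sq_norm n (\<lambda>i. a * f i + b * g i) = a\<^sup>2 + b\<^sup>2"
      "\<And>a b. quad_form n (\<lambda>i j. A $$ (i,j)) (\<lambda>i. a * f i + b * g i) (\<lambda>i. a * f i + b * g i) \<ge> ordered_eigenvalue 2 A * (a\<^sup>2 + b\<^sup>2)"
      using second_eigenvalue_plane[OF A n] by blast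
    have "ordered_eigenvalue 2 A - e \<le> ordered_eigenvalue 2 B"
    proof (rule second_eigenvalue_ge[OF B n, of f g])
      fix a b
      show "sq_norm n (\<lambda>i. a * f i + b * g i) = 0 \<Longrightarrow> a = 0 \<and> b = 0" by (simp add: fg(1))
      show "quad_form n (\<lambda>i j. B $$ (i,j)) (\<lambda>i. a * f i + b * g i) (\<lambda>i. a * f i + b * g i) \<ge> (ordered_eigenvalue 2 A - e) * sq_norm n (\<lambda>i. a * f i + b * g i)"
        using AB[of "\<lambda>i. a * f i + b * g i"] fg(2)[of a b] unfolding fg(1) by (simp add: algebra_simps)
    qed
    thus ?thesis using False k by (simp add: e_def)
  qed
qed

text \<open>The final sandwich applies monotonicity and subadditivity of the measure to events about
  eigenvalues, which therefore have to be measurable. Lipschitz dependence on the entries gives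
  this.\<close>

lemma borel_measurable_ordered_eigenvalue:
  assumes n: "n \<ge> 2" and k: "k \<in> {1,2}"
    and B: "\<And>\<omega>. \<omega> \<in> space M \<Longrightarrow> B \<omega> \<in> carrier_mat n n \<and> transpose_mat (B \<omega>) = B \<omega>"
    and meas: "\<And>i j. i < n \<Longrightarrow> j < n \<Longrightarrow> (\<lambda>\<omega>. B \<omega> $$ (i,j)) \<in> borel_measurable M"
  shows "(\<lambda>\<omega>. ordered_eigenvalue k (B \<omega>)) \<in> borel_measurable M"
proof -
  \<comment> \<open>Symmetrizing makes \<open>F\<close> a continuous function on all families of
    entries, including those that come from no symmetric matrix.\<close>
  define S where "S a = mat n n (\<lambda>(i,j). (a (i,j) + a (j,i)) / 2)" for a :: "nat \<times> nat \<Rightarrow> real"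
  have S: "S a \<in> carrier_mat n n" "transpose_mat (S a) = S a" for a
    by (auto simp: S_def add.commute intro!: eq_matI)
  define F where "F a = ordered_eigenvalue k (S a)" for a
  define D where "D a b = (\<Sum>i<n. \<Sum>j<n. \<bar>S a $$ (i,j) - S b $$ (i,j)\<bar>)" for a b
  have D: "\<bar>F a - F b\<bar> \<le> D a b" for a b
  proof -
    have "F a \<le> F b + D a b" "F b \<le> F a + D b a"
      unfolding F_def D_def by (intro ordered_eigenvalue_perturbation n k S)+
    moreover have "D b a = D a b" by (simp add: D_def abs_minus_commute)
    ultimately show ?thesis by linarith
  qed
  have "continuous_on UNIV F"
    unfolding continuous_on_def
  proof
    fix b :: "nat \<times> nat \<Rightarrow> real"
    have coord: "((\<lambda>a. a p) \<longlongrightarrow> b p) (at b within UNIV)" for p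
      using continuous_on_product_coordinates[of p] by (auto simp: continuous_on_def)
    have Deq: "D a b = (\<Sum>i<n. \<Sum>j<n. \<bar>(a (i,j) + a (j,i)) / 2 - (b (i,j) + b (j,i)) / 2\<bar>)" for a
      by (simp add: D_def S_def)
    have "((\<lambda>a. D a b) \<longlongrightarrow> (\<Sum>i<n. \<Sum>j<n. \<bar>(b (i,j) + b (j,i)) / 2 - (b (i,j) + b (j,i)) / 2\<bar>)) (at b within UNIV)"
      unfolding Deq by (intro tendsto_sum tendsto_rabs tendsto_diff tendsto_divide tendsto_add coord tendsto_const) auto
    hence "((\<lambda>a. D a b) \<longlongrightarrow> 0) (at b within UNIV)" by simp
    hence "((\<lambda>a. F a - F b) \<longlongrightarrow> 0) (at b within UNIV)"
      by (rule Lim_null_comparison[rotated]) (use D in auto)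
    thus "(F \<longlongrightarrow> F b) (at b within UNIV)" by (simp add: LIM_zero_iff)
  qed
  hence F: "F \<in> borel_measurable borel" by (rule borel_measurable_continuous_onI)
  define R where "R \<omega> p = (if fst p < n \<and> snd p < n then B \<omega> $$ p else 0)" for \<omega> p
  have "R \<in> borel_measurable M"
  proof (rule measurable_coordinatewise_then_product)
    fix p show "(\<lambda>\<omega>. R \<omega> p) \<in> borel_measurable M"
      using meas[of "fst p" "snd p"] by (cases "fst p < n \<and> snd p < n") (auto simp: R_def)
  qed
  hence "(\<lambda>\<omega>. F (R \<omega>)) \<in> borel_measurable M" using F by (rule measurable_compose)
  moreover have "F (R \<omega>) = ordered_eigenvalue k (B \<omega>)" if "\<omega> \<in> space M" for \<omega>
  proof -
    have Bs: "B \<omega> $$ (i,j) = B \<omega> $$ (j,i)" if "i < n" "j < n" for i j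
      using B[OF \<open>\<omega> \<in> space M\<close>] that by (metis carrier_matD index_transpose_mat(1))
    have "S (R \<omega>) = B \<omega>"
      using B[OF that] by (intro eq_matI) (auto simp: S_def R_def Bs)
    thus ?thesis by (simp add: F_def)
  qed
  ultimately show ?thesis by (subst measurable_cong[where g="\<lambda>\<omega>. F (R \<omega>)"]) auto
qed

section \<open>Independence from characteristic functions\<close>

context prob_space
begin

text \<open>Under the probability measure with density \<open>W / expectation W\<close>, the
  variable \<open>X\<close> has by \<open>ch\<close> its original characteristic function, hence its
  original law. Nonnegativity of \<open>W\<close> is what makes this a measure.\<close>

lemma weighted_distr_unique:
  fixes W X Y :: "'a \<Rightarrow> real"
  assumes [measurable]: "W \<in> borel_measurable M" "X \<in> borel_measurable M"
    and W: "\<And>\<omega>. 0 \<le> W \<omega>" "\<And>\<omega>. W \<omega> \<le> c"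
    and ch: "\<And>t. (CLINT \<omega>|M. of_real (W \<omega>) * iexp (t * X \<omega>)) = of_real (expectation W) * char (distr M borel X) t"
    and B: "B \<in> sets borel"
  shows "expectation (\<lambda>\<omega>. W \<omega> * indicator B (X \<omega>)) = expectation W * prob (X -` B \<inter> space M)"
proof -
  have intW: "integrable M W"
    by (rule integrable_const_bound[of _ c]) (use W in \<open>auto\<close>)
  have W0: "expectation W \<ge> 0" using W by simp
  show ?thesis
  proof (cases "expectation W = 0")
    \<comment> \<open>A total weight of zero cannot be normalized, but then \<open>W\<close>
      vanishes almost everywhere.\<close>
    case True
    hence "AE \<omega> in M. W \<omega> = 0" using integral_nonneg_eq_0_iff_AE[OF intW] W by auto
    hence "expectation (\<lambda>\<omega>. W \<omega> * indicator B (X \<omega>)) = expectation (\<lambda>_. 0)"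
      using B by (intro integral_cong_AE) auto
    thus ?thesis using True by simp
  next
    case False
    define w where "w = expectation W"
    have w: "w > 0" using False W0 by (simp add: w_def)
    define D where "D = density M (\<lambda>\<omega>. ennreal (W \<omega> / w))"
    have spD: "space D = space M" and setsD [simp, measurable_cong]: "sets D = sets M" by (auto simp: D_def)
    have "emeasure D (space D) = (\<integral>\<^sup>+ \<omega>. ennreal (W \<omega> / w) \<partial>M)"
      by (simp add: D_def emeasure_density cong: nn_integral_cong)
    also have "\<dots> = ennreal (expectation (\<lambda>\<omega>. W \<omega> / w))"
      using intW W w by (intro nn_integral_eq_integral) auto
    also have "\<dots> = 1" using w by (simp add: w_def)
    finally interpret D: prob_space D by (intro prob_spaceI) simp
    have XD [measurable]: "X \<in> borel_measurable D" using assms(2) by (simp add: D_def)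
    have intD: "integral\<^sup>L D f = integral\<^sup>L M (\<lambda>\<omega>. (W \<omega> / w) *\<^sub>R f \<omega>)" if "f \<in> borel_measurable M"
      for f :: "'a \<Rightarrow> 'b :: {banach, second_countable_topology}"
      unfolding D_def using that W w by (intro integral_density) auto
    have "distr D borel X = distr M borel X"
    proof (rule Levy_uniqueness)
      show "real_distribution (distr D borel X)" by (rule D.real_distribution_distr) simp
      show "real_distribution (distr M borel X)" by (rule real_distribution_distr) simp
      show "char (distr D borel X) = char (distr M borel X)"
      proof
        fix t
        have "char (distr D borel X) t = (CLINT \<omega>|M. (W \<omega> / w) *\<^sub>R iexp (t * X \<omega>))"
          by (simp add: char_def integral_distr intD)
        also have "\<dots> = (CLINT \<omega>|M. (1 / of_real w) * (of_real (W \<omega>) * iexp (t * X \<omega>)))"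
          by (intro Bochner_Integration.integral_cong) (auto simp: scaleR_conv_of_real)
        also have "\<dots> = char (distr M borel X) t"
          using ch[of t] w by (simp add: w_def)
        finally show "char (distr D borel X) t = char (distr M borel X) t" .
      qed
    qed
    hence "measure (distr D borel X) B = measure (distr M borel X) B" by simp
    hence "D.prob (X -` B \<inter> space M) = prob (X -` B \<inter> space M)"
      using B by (simp add: measure_distr spD)
    moreover have "D.prob (X -` B \<inter> space M) = integral\<^sup>L D (\<lambda>\<omega>. indicator B (X \<omega>))"
    proof -
      have "integral\<^sup>L D (\<lambda>\<omega>. indicator B (X \<omega>)) = integral\<^sup>L D (indicator (X -` B \<inter> space M) :: _ \<Rightarrow> real)"
        by (intro Bochner_Integration.integral_cong) (auto simp: spD indicator_def)
      thus ?thesis by (simp add: spD)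
    qed
    moreover have "\<dots> = expectation (\<lambda>\<omega>. W \<omega> * indicator B (X \<omega>)) / w"
      using B by (subst intD) auto
    ultimately show ?thesis using w by (simp add: w_def field_simps)
  qed
qed

text \<open>The induction replaces the factors \<open>exp (\<i> t\<^sub>i X\<^sub>i)\<close> by indicators one at a time;
  the positive weights \<open>1 + cos\<close> and \<open>1 + sin\<close> make the one-dimensional uniqueness theorem applicable.\<close>

lemma indep_vars_if_char_factorizes:
  fixes X :: "'i \<Rightarrow> 'a \<Rightarrow> real"
  assumes fin: "finite I" and rv: "\<And>i. i \<in> I \<Longrightarrow> X i \<in> borel_measurable M"
    and ch: "\<And>t. (CLINT \<omega>|M. iexp (\<Sum>i\<in>I. t i * X i \<omega>)) = (\<Prod>i\<in>I. char (distr M borel (X i)) (t i))"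
  shows "indep_vars (\<lambda>_. borel) X I"
proof -
  define E where "E J B \<omega> = (\<Prod>i\<in>J. indicator (B i) (X i \<omega>) :: real)" for J B \<omega>
  define p where "p J B = (\<Prod>i\<in>J. prob (X i -` B i \<inter> space M))" for J B
  have Emeas: "E J B \<in> borel_measurable M" if "J \<subseteq> I" "\<And>i. B i \<in> sets borel" for J B
    unfolding E_def using that rv by (intro borel_measurable_prod) (auto intro!: borel_measurable_indicator' measurable_compose[OF rv])
  have E01: "0 \<le> E J B \<omega>" "E J B \<omega> \<le> 1" for J B \<omega>
    unfolding E_def by (auto intro!: prod_nonneg prod_le_1)
  have thmeas: "(\<lambda>\<omega>. \<Sum>i\<in>K. t i * X i \<omega>) \<in> borel_measurable M" if "K \<subseteq> I" for K t
    using that rv by (intro borel_measurable_sum borel_measurable_times) auto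
  \<comment> \<open>Indices in \<open>J\<close> already carry indicators, the others still carry
    exponentials. The frequencies \<open>t\<close> stay arbitrary because the step rescales
    them.\<close>
  have main: "(CLINT \<omega>|M. of_real (E J B \<omega>) * iexp (\<Sum>i\<in>I-J. t i * X i \<omega>))
      = of_real (p J B) * (\<Prod>i\<in>I-J. char (distr M borel (X i)) (t i))"
    if "J \<subseteq> I" "\<And>i. B i \<in> sets borel" for J B t
    using finite_subset[OF that(1) fin] that
  proof (induction J arbitrary: t rule: finite_induct)
    case empty
    show ?case using ch[of t] by (simp add: E_def p_def)
  next
    case (insert j J)
    hence j: "j \<in> I" "j \<notin> J" and J: "J \<subseteq> I" by auto
    note B = insert.prems(2)
    define K where "K = I - insert j J"
    have IJ: "I - J = insert j K" "j \<notin> K" "finite K" "K \<subseteq> I" using j fin by (auto simp: K_def)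
    have [measurable]: "X j \<in> borel_measurable M" using rv j by auto
    have [measurable]: "E J B \<in> borel_measurable M" using Emeas J B by auto
    define \<theta> where "\<theta> \<omega> = (\<Sum>i\<in>K. t i * X i \<omega>)" for \<omega>
    have [measurable]: "\<theta> \<in> borel_measurable M" unfolding \<theta>_def using IJ by (intro thmeas) auto
    define \<phi> where "\<phi> = char (distr M borel (X j))"
    \<comment> \<open>Used at \<open>s\<close> = 0, 1 and -1: the constant, the exponential and its
      conjugate, out of which the positive weight is built.\<close>
    define P where "P s = of_real (p J B) * (\<Prod>i\<in>K. char (distr M borel (X i)) (s * t i))" for s
    have bd: "integrable M (\<lambda>\<omega>. of_real (E J B \<omega>) * (iexp (s * \<theta> \<omega>) * iexp (r * X j \<omega>)))" for s r
      by (intro integrable_const_bound[of _ 1] AE_I2) (use E01 in \<open>auto simp: norm_mult\<close>)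
    have IH: "(CLINT \<omega>|M. of_real (E J B \<omega>) * (iexp (s * \<theta> \<omega>) * iexp (r * X j \<omega>))) = P s * \<phi> r" for s r
    proof -
      have "(CLINT \<omega>|M. of_real (E J B \<omega>) * (iexp (s * \<theta> \<omega>) * iexp (r * X j \<omega>)))
        = (CLINT \<omega>|M. of_real (E J B \<omega>) * iexp (\<Sum>i\<in>I-J. (if i = j then r else s * t i) * X i \<omega>))"
      proof (intro Bochner_Integration.integral_cong refl arg_cong2[where f="(*)"])
        fix \<omega>
        have "(\<Sum>i\<in>I-J. (if i = j then r else s * t i) * X i \<omega>) = r * X j \<omega> + (\<Sum>i\<in>K. (if i = j then r else s * t i) * X i \<omega>)"
          using IJ by simp
        also have "(\<Sum>i\<in>K. (if i = j then r else s * t i) * X i \<omega>) = s * \<theta> \<omega>"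
          unfolding \<theta>_def sum_distrib_left using IJ by (intro sum.cong) auto
        finally show "iexp (s * \<theta> \<omega>) * iexp (r * X j \<omega>) = iexp (\<Sum>i\<in>I-J. (if i = j then r else s * t i) * X i \<omega>)"
          by (simp add: exp_add distrib_left)
      qed
      also have "\<dots> = of_real (p J B) * (\<Prod>i\<in>I-J. char (distr M borel (X i)) (if i = j then r else s * t i))"
        using insert.IH J B by auto
      also have "(\<Prod>i\<in>I-J. char (distr M borel (X i)) (if i = j then r else s * t i)) = \<phi> r * (\<Prod>i\<in>K. char (distr M borel (X i)) (s * t i))"
        unfolding IJ(1) using IJ by (auto simp: \<phi>_def intro!: arg_cong2[where f="(*)"] prod.cong)
      finally show ?thesis by (simp add: P_def mult_ac)
    qed
    have \<phi>0: "\<phi> 0 = 1"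
      unfolding \<phi>_def by (intro real_distribution.char_zero real_distribution_distr) simp
    define pj where "pj = prob (X j -` B j \<inter> space M)"
    have weight: "(CLINT \<omega>|M. of_real (E J B \<omega> * (1 + Re (z * iexp (\<theta> \<omega>)))) * indicator (B j) (X j \<omega>))
        = pj * (CLINT \<omega>|M. of_real (E J B \<omega> * (1 + Re (z * iexp (\<theta> \<omega>)))))" if z: "cmod z = 1" for z
    proof -
      define W where "W \<omega> = E J B \<omega> * (1 + Re (z * iexp (\<theta> \<omega>)))" for \<omega>
      have re: "\<bar>Re (z * iexp (\<theta> \<omega>))\<bar> \<le> 1" for \<omega>
        using abs_Re_le_cmod[of "z * iexp (\<theta> \<omega>)"] z by (simp add: norm_mult)
      have W0: "0 \<le> W \<omega>" "W \<omega> \<le> 2" for \<omega>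
        unfolding W_def using E01[of J B \<omega>] re[of \<omega>] mult_mono[of "E J B \<omega>" 1 "1 + Re (z * iexp (\<theta> \<omega>))" 2]
        by (auto simp: abs_le_iff intro!: mult_nonneg_nonneg)
      have Wc: "complex_of_real (W \<omega>) * iexp (r * X j \<omega>) =
         of_real (E J B \<omega>) * (iexp (0 * \<theta> \<omega>) * iexp (r * X j \<omega>))
         + ((z / 2) * (of_real (E J B \<omega>) * (iexp (1 * \<theta> \<omega>) * iexp (r * X j \<omega>)))
         + (cnj z / 2) * (of_real (E J B \<omega>) * (iexp (-1 * \<theta> \<omega>) * iexp (r * X j \<omega>))))" for \<omega> r
      proof -
        have "complex_of_real (Re (z * iexp (\<theta> \<omega>))) = (z * iexp (\<theta> \<omega>) + cnj z * iexp (- \<theta> \<omega>)) / 2"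
          by (simp add: complex_eq_iff exp_eq_polar cis.sel flip: cis_conv_exp)
        thus ?thesis unfolding W_def of_real_mult of_real_add of_real_1
          by (simp only:) (simp add: field_simps)
      qed
      have Wint: "(CLINT \<omega>|M. of_real (W \<omega>) * iexp (r * X j \<omega>)) = (P 0 + z / 2 * P 1 + cnj z / 2 * P (-1)) * \<phi> r" for r
      proof -
        define F where "F s \<omega> = complex_of_real (E J B \<omega>) * (iexp (s * \<theta> \<omega>) * iexp (r * X j \<omega>))" for s \<omega>
        have F: "integrable M (F s)" "integral\<^sup>L M (F s) = P s * \<phi> r" for s
          unfolding F_def using bd IH by auto
        show ?thesis unfolding Wc F_def[symmetric] by (simp add: F algebra_simps)
      qed
      have W_m [measurable]: "W \<in> borel_measurable M" unfolding W_def by measurable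
      have EW: "of_real (expectation W) = P 0 + z / 2 * P 1 + cnj z / 2 * P (-1)"
        using Wint[of 0] by (simp add: \<phi>0)
      have "expectation (\<lambda>\<omega>. W \<omega> * indicator (B j) (X j \<omega>)) = expectation W * pj"
        unfolding pj_def
        by (rule weighted_distr_unique[where c=2]) (use W0 B Wint EW in \<open>auto simp: \<phi>_def\<close>)
      moreover have "(CLINT \<omega>|M. of_real (W \<omega>) * indicator (B j) (X j \<omega>))
          = of_real (expectation (\<lambda>\<omega>. W \<omega> * indicator (B j) (X j \<omega>)))"
        by (subst integral_complex_of_real[symmetric]) (intro Bochner_Integration.integral_cong, auto simp: indicator_def)
      moreover have "(CLINT \<omega>|M. of_real (W \<omega>)) = complex_of_real (expectation W)"
        by (rule integral_complex_of_real)
      ultimately show ?thesis unfolding W_def[symmetric] by (simp add: mult.commute)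
    qed
    \<comment> \<open>The defect of the desired factorization as a linear functional of
      \<open>f\<close>. It vanishes on the positive weights \<open>1 + R z\<close>, and linearity
      carries this over to the complex exponential.\<close>
    define Q where "Q f = (CLINT \<omega>|M. of_real (E J B \<omega>) * f \<omega> * indicator (B j) (X j \<omega>)) - pj * (CLINT \<omega>|M. of_real (E J B \<omega>) * f \<omega>)"
      for f :: "'a \<Rightarrow> complex"
    have sb: "integrable M (\<lambda>\<omega>. of_real (E J B \<omega>) * f \<omega>)" "integrable M (\<lambda>\<omega>. of_real (E J B \<omega>) * f \<omega> * indicator (B j) (X j \<omega>))"
      if "f \<in> borel_measurable M" "\<And>\<omega>. cmod (f \<omega>) \<le> 2" for f
    proof -
      have "cmod (of_real (E J B \<omega>) * f \<omega>) \<le> 2" for \<omega>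
        using mult_mono[of "E J B \<omega>" 1 "cmod (f \<omega>)" 2] E01[of J B \<omega>] that(2)[of \<omega>] by (simp add: norm_mult)
      thus "integrable M (\<lambda>\<omega>. of_real (E J B \<omega>) * f \<omega>)" "integrable M (\<lambda>\<omega>. of_real (E J B \<omega>) * f \<omega> * indicator (B j) (X j \<omega>))"
        using that(1) B by (auto intro!: integrable_const_bound[of _ 2] AE_I2 simp: norm_mult indicator_def)
    qed
    have Qadd: "Q (\<lambda>\<omega>. f \<omega> + g \<omega>) = Q f + Q g"
      if "f \<in> borel_measurable M" "\<And>\<omega>. cmod (f \<omega>) \<le> 2" "g \<in> borel_measurable M" "\<And>\<omega>. cmod (g \<omega>) \<le> 2" for f g
      unfolding Q_def using sb that by (simp add: distrib_left distrib_right algebra_simps)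
    have Qmult: "Q (\<lambda>\<omega>. c * f \<omega>) = c * Q f" for f c
    proof -
      have "Q (\<lambda>\<omega>. c * f \<omega>) = (CLINT \<omega>|M. c * (of_real (E J B \<omega>) * f \<omega> * indicator (B j) (X j \<omega>))) - pj * (CLINT \<omega>|M. c * (of_real (E J B \<omega>) * f \<omega>))"
        unfolding Q_def by (simp add: mult_ac)
      thus ?thesis by (simp add: Q_def algebra_simps)
    qed
    define R where "R z \<omega> = complex_of_real (Re (z * iexp (\<theta> \<omega>)))" for z \<omega>
    have Rm [measurable]: "R z \<in> borel_measurable M" for z unfolding R_def by measurable
    have Rb: "cmod (R z \<omega>) \<le> 1" if "cmod z = 1" for z \<omega>
      unfolding R_def norm_of_real using abs_Re_le_cmod[of "z * iexp (\<theta> \<omega>)"] that by (simp add: norm_mult)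
    have Rb2: "cmod (R z \<omega>) \<le> 2" if "cmod z = 1" for z \<omega> using Rb[OF that, of \<omega>] by simp
    have Qw: "Q (\<lambda>\<omega>. 1 + R z \<omega>) = 0" if "cmod z = 1" for z
      using weight[OF that] by (simp add: Q_def R_def)
    have Q1R: "Q (\<lambda>_. 1) + Q (R z) = 0" if "cmod z = 1" for z
    proof -
      have "cmod (R z \<omega>) \<le> 2" for \<omega> using Rb[OF that, of \<omega>] by simp
      thus ?thesis using Qw[OF that] by (subst (asm) Qadd) auto
    qed
    have Rneg: "R (-1) = (\<lambda>\<omega>. (-1) * R 1 \<omega>)" by (auto simp: R_def)
    \<comment> \<open>Taking \<open>z\<close> = 1 and \<open>z\<close> = -1 separates the constant
      from the cosine.\<close>
    have "Q (\<lambda>_. 1) + Q (R 1) = 0" "Q (\<lambda>_. 1) - Q (R 1) = 0"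
      using Q1R[of 1] Q1R[of "-1"] Qmult[of "-1" "R 1"] unfolding Rneg by auto
    moreover have "2 * Q (\<lambda>_. 1) = (Q (\<lambda>_. 1) + Q (R 1)) + (Q (\<lambda>_. 1) - Q (R 1))" by (simp add: algebra_simps)
    ultimately have Q1: "Q (\<lambda>_. 1) = 0" by simp
    have QR: "Q (R z) = 0" if "cmod z = 1" for z using Q1R[OF that] Q1 by simp
    \<comment> \<open>\<open>R 1\<close> is the cosine of \<open>\<theta>\<close> and
      \<open>R (-\<i>)\<close> its sine.\<close>
    have "Q (\<lambda>\<omega>. R 1 \<omega> + \<i> * R (-\<i>) \<omega>) = 0"
      by (subst Qadd) (use Rb2[of 1] Rb2[of "-\<i>"] QR[of 1] QR[of "-\<i>"] in \<open>auto simp: Qmult norm_mult\<close>)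
    also have "(\<lambda>\<omega>. R 1 \<omega> + \<i> * R (-\<i>) \<omega>) = (\<lambda>\<omega>. iexp (\<theta> \<omega>))"
      by (auto simp: R_def complex_eq_iff)
    finally have "(CLINT \<omega>|M. of_real (E J B \<omega>) * iexp (\<theta> \<omega>) * indicator (B j) (X j \<omega>)) = pj * (CLINT \<omega>|M. of_real (E J B \<omega>) * iexp (\<theta> \<omega>))"
      by (simp add: Q_def)
    also have "(CLINT \<omega>|M. of_real (E J B \<omega>) * iexp (\<theta> \<omega>)) = P 1"
      using IH[of 1 0] by (simp add: \<phi>0)
    also have "(\<lambda>\<omega>. of_real (E J B \<omega>) * iexp (\<theta> \<omega>) * indicator (B j) (X j \<omega>)) = (\<lambda>\<omega>. of_real (E (insert j J) B \<omega>) * iexp (\<Sum>i\<in>I-insert j J. t i * X i \<omega>))"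
      using insert.hyps by (auto simp: E_def \<theta>_def K_def mult_ac indicator_def)
    finally show ?case using insert.hyps by (simp add: P_def p_def pj_def K_def mult_ac)
  qed
  have "prob (\<Inter>i\<in>I. X i -` B i \<inter> space M) = (\<Prod>i\<in>I. prob (X i -` B i \<inter> space M))"
    if B: "\<And>i. B i \<in> sets borel" and ne: "I \<noteq> {}" for B
  proof -
    have "complex_of_real (expectation (E I B)) = of_real (p I B)"
      using main[of I B] B by (simp flip: integral_complex_of_real)
    hence "expectation (E I B) = p I B" by simp
    moreover have "expectation (E I B) = expectation (indicator (\<Inter>i\<in>I. X i -` B i \<inter> space M))"
    proof (intro Bochner_Integration.integral_cong refl)
      fix \<omega> assume "\<omega> \<in> space M"
      thus "E I B \<omega> = indicator (\<Inter>i\<in>I. X i -` B i \<inter> space M) \<omega>"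
        unfolding E_def using fin by (auto simp: indicator_def prod_zero_iff)
    qed
    moreover have "(\<Inter>i\<in>I. X i -` B i \<inter> space M) \<subseteq> space M" using ne by auto
    ultimately show ?thesis by (simp add: p_def Int_absorb2 Int_absorb1)
  qed
  note full = this
  show ?thesis
    unfolding indep_vars_def2
  proof (intro conjI ballI indep_setsI)
    fix i assume "i \<in> I" thus "random_variable borel (X i)" using rv by auto
  next
    fix i assume "i \<in> I"
    show "{X i -` A \<inter> space M |A. A \<in> sets borel} \<subseteq> events"
      using rv[OF \<open>i \<in> I\<close>] by (auto intro: measurable_sets)
  next
    fix A J assume J: "J \<noteq> {}" "J \<subseteq> I" "finite J" and A: "\<forall>j\<in>J. A j \<in> {X j -` A \<inter> space M |A. A \<in> sets borel}"
    then obtain B where B: "\<And>j. j \<in> J \<Longrightarrow> A j = X j -` B j \<inter> space M" "\<And>j. j \<in> J \<Longrightarrow> B j \<in> sets borel"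
      by simp metis
    \<comment> \<open>Taking the whole line outside \<open>J\<close> turns the identity for the full
      index set into the one for each subfamily.\<close>
    define B' where "B' j = (if j \<in> J then B j else UNIV)" for j
    have "prob (\<Inter>i\<in>I. X i -` B' i \<inter> space M) = (\<Prod>i\<in>I. prob (X i -` B' i \<inter> space M))"
      by (rule full) (use B J in \<open>auto simp: B'_def\<close>)
    also have "(\<Inter>i\<in>I. X i -` B' i \<inter> space M) = (\<Inter>j\<in>J. A j)"
      using J B by (auto simp: B'_def split: if_splits)
    also have "(\<Prod>i\<in>I. prob (X i -` B' i \<inter> space M)) = (\<Prod>j\<in>J. prob (A j))"
      using J B fin by (intro prod.mono_neutral_cong_right) (auto simp: B'_def prob_space)
    finally show "prob (\<Inter>j\<in>J. A j) = (\<Prod>j\<in>J. prob (A j))" .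
  qed
qed

end

section \<open>The standard normal distribution\<close>

definition std_normal :: "real measure" where
  "std_normal = density lborel (\<lambda>y. ennreal (std_normal_density y))"

lemma sets_std_normal [simp, measurable_cong]: "sets std_normal = sets borel"
  and space_std_normal [simp]: "space std_normal = UNIV"
  by (auto simp: std_normal_def)

interpretation std_normal: prob_space std_normal
  unfolding std_normal_def by (rule prob_space_normal_density) simp

text \<open>The exponents of the two sides differ by t * (y - t). The density centred at
  \<open>t\<close> has total mass one, so integration yields the Gaussian tail bound with constant
  one.\<close>

lemma std_normal_density_le_shift:
  assumes "t \<le> y" "0 \<le> t"
  shows "std_normal_density y \<le> exp (- t\<^sup>2 / 2) * normal_density t 1 y"
proof -
  have "(y - t)\<^sup>2 + t\<^sup>2 \<le> y\<^sup>2" using assms by (simp add: power2_eq_square algebra_simps mult_left_mono)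
  hence "exp (- y\<^sup>2 / 2) \<le> exp (- t\<^sup>2 / 2) * exp (- (y - t)\<^sup>2 / 2)"
    by (simp flip: exp_add add: field_simps)
  thus ?thesis
    by (simp add: std_normal_density_def normal_density_def divide_right_mono)
qed

lemma emeasure_std_normal:
  "A \<in> sets borel \<Longrightarrow> emeasure std_normal A = (\<integral>\<^sup>+y. ennreal (std_normal_density y) * indicator A y \<partial>lborel)"
  unfolding std_normal_def by (simp add: emeasure_density)

lemma nn_integral_normal_density: "0 < \<sigma> \<Longrightarrow> (\<integral>\<^sup>+y. ennreal (normal_density m \<sigma> y) \<partial>lborel) = 1"
  by (subst nn_integral_eq_integral) (auto simp: integral_normal_density)

lemma std_normal_upper_tail_le:
  assumes "0 \<le> t"
  shows "measure std_normal {t..} \<le> exp (- t\<^sup>2 / 2)"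
proof -
  have "emeasure std_normal {t..} \<le> (\<integral>\<^sup>+y. ennreal (exp (- t\<^sup>2 / 2)) * ennreal (normal_density t 1 y) \<partial>lborel)"
    unfolding emeasure_std_normal[OF borel_closed[OF closed_atLeast]]
    by (intro nn_integral_mono) (use std_normal_density_le_shift[OF _ assms] in \<open>auto simp: indicator_def ennreal_mult[symmetric] intro!: ennreal_leI\<close>)
  also have "\<dots> = ennreal (exp (- t\<^sup>2 / 2))"
    by (simp add: nn_integral_cmult nn_integral_normal_density)
  finally show ?thesis by (simp add: std_normal.emeasure_eq_measure)
qed

lemma std_normal_density_antimono: "0 \<le> x \<Longrightarrow> x \<le> y \<Longrightarrow> std_normal_density y \<le> std_normal_density x"
  by (simp add: std_normal_density_def divide_right_mono power_mono)

text \<open>Only the interval from \<open>t\<close> to \<open>t + 1\<close> is counted. The loss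
  against the true tail is about exp (- t), harmless for levels that stay a fixed factor below the
  scale of the maximum.\<close>

lemma std_normal_upper_tail_ge:
  assumes "0 \<le> t"
  shows "std_normal_density (t + 1) \<le> measure std_normal {t..}"
proof -
  have "ennreal (std_normal_density (t + 1)) = (\<integral>\<^sup>+y. ennreal (std_normal_density (t + 1)) * indicator {t..t+1} y \<partial>lborel)"
    by (simp add: nn_integral_cmult_indicator)
  also have "\<dots> \<le> emeasure std_normal {t..}"
    unfolding emeasure_std_normal[OF borel_closed[OF closed_atLeast]]
    by (intro nn_integral_mono) (use assms in \<open>auto simp: indicator_def intro!: ennreal_leI std_normal_density_antimono\<close>)
  finally show ?thesis by (simp add: std_normal.emeasure_eq_measure)
qed

text \<open>The origin of the limit law: a shift by \<open>h\<close> tilts the density by exp (- h *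
  y - h^2 / 2). For \<open>h = x / a\<close> and \<open>y\<close> near a large \<open>a\<close> the
  tilt is close to exp (- x).\<close>

lemma emeasure_std_normal_shift:
  "emeasure std_normal {z + h<..} = (\<integral>\<^sup>+y. ennreal (std_normal_density y * exp (- h * y - h\<^sup>2 / 2)) * indicator {z<..} y \<partial>lborel)"
proof -
  have "emeasure std_normal {z + h<..} = (\<integral>\<^sup>+y. ennreal (std_normal_density (h + y)) * indicator {z + h<..} (h + y) \<partial>lborel)"
    unfolding emeasure_std_normal[OF borel_open[OF open_greaterThan]]
    by (subst nn_integral_real_affine[where c=1 and t=h]) auto
  also have "\<dots> = (\<integral>\<^sup>+y. ennreal (std_normal_density y * exp (- h * y - h\<^sup>2 / 2)) * indicator {z<..} y \<partial>lborel)"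
  proof (intro nn_integral_cong arg_cong2[where f="(*)"] arg_cong[where f=ennreal])
    fix y
    have "- (h + y)\<^sup>2 / 2 = - y\<^sup>2 / 2 + (- h * y - h\<^sup>2 / 2)" by (simp add: power2_eq_square field_simps)
    thus "std_normal_density (h + y) = std_normal_density y * exp (- h * y - h\<^sup>2 / 2)"
      unfolding std_normal_density_def by (simp only: exp_add mult.assoc)
  qed (auto simp: indicator_def)
  finally show ?thesis .
qed

lemma std_normal_tail_shift_le:
  assumes "0 \<le> h" "lo \<le> z"
  shows "measure std_normal {z + h<..} \<le> exp (- h * lo) * measure std_normal {z<..}"
proof -
  have "emeasure std_normal {z + h<..} \<le> (\<integral>\<^sup>+y. ennreal (exp (- h * lo)) * (ennreal (std_normal_density y) * indicator {z<..} y) \<partial>lborel)"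
    unfolding emeasure_std_normal_shift
  proof (intro nn_integral_mono)
    fix y
    show "ennreal (std_normal_density y * exp (- h * y - h\<^sup>2 / 2)) * indicator {z<..} y
        \<le> ennreal (exp (- h * lo)) * (ennreal (std_normal_density y) * indicator {z<..} y)"
    proof (cases "y > z")
      case True
      hence "h * lo \<le> h * y" using assms by (intro mult_left_mono) auto
      hence "- h * y - h\<^sup>2 / 2 \<le> - h * lo" using zero_le_power2[of h] by linarith
      hence "exp (- h * y - h\<^sup>2 / 2) \<le> exp (- h * lo)" by simp
      hence "std_normal_density y * exp (- h * y - h\<^sup>2 / 2) \<le> exp (- h * lo) * std_normal_density y"
        by (simp add: mult.commute mult_left_mono)
      thus ?thesis using True by (simp add: ennreal_mult[symmetric] ennreal_leI)
    qed simp
  qed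
  also have "\<dots> = ennreal (exp (- h * lo)) * emeasure std_normal {z<..}"
    by (simp add: nn_integral_cmult emeasure_std_normal)
  finally show ?thesis by (simp add: std_normal.emeasure_eq_measure ennreal_mult[symmetric])
qed

text \<open>Far above \<open>hi\<close> the tilt is arbitrarily small, so only the mass between
  \<open>z\<close> and \<open>hi\<close> is kept; the subtracted tail accounts for the rest. For
  \<open>z\<close> beyond \<open>hi\<close> the left side is nonpositive.\<close>

lemma std_normal_tail_shift_ge:
  assumes "0 \<le> h"
  shows "exp (- h * hi - h\<^sup>2 / 2) * (measure std_normal {z<..} - measure std_normal {hi<..}) \<le> measure std_normal {z + h<..}"
proof (cases "z < hi")
  case True
  define c where "c = exp (- h * hi - h\<^sup>2 / 2)"
  have "ennreal c * emeasure std_normal {z<..hi} = (\<integral>\<^sup>+y. ennreal c * (ennreal (std_normal_density y) * indicator {z<..hi} y) \<partial>lborel)"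
    by (simp add: nn_integral_cmult emeasure_std_normal)
  also have "\<dots> \<le> emeasure std_normal {z + h<..}"
    unfolding emeasure_std_normal_shift
  proof (intro nn_integral_mono)
    fix y
    show "ennreal c * (ennreal (std_normal_density y) * indicator {z<..hi} y)
       \<le> ennreal (std_normal_density y * exp (- h * y - h\<^sup>2 / 2)) * indicator {z<..} y"
    proof (cases "y \<in> {z<..hi}")
      case True
      hence "h * y \<le> h * hi" using assms by (intro mult_left_mono) auto
      hence "c \<le> exp (- h * y - h\<^sup>2 / 2)" by (simp add: c_def)
      hence "c * std_normal_density y \<le> std_normal_density y * exp (- h * y - h\<^sup>2 / 2)"
        by (subst mult.commute) (intro mult_left_mono, auto)
      thus ?thesis using True by (simp add: c_def ennreal_mult[symmetric] ennreal_leI)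
    qed simp
  qed
  finally have "c * measure std_normal {z<..hi} \<le> measure std_normal {z + h<..}"
    by (simp add: std_normal.emeasure_eq_measure ennreal_mult[symmetric] c_def)
  moreover have "measure std_normal {z<..} = measure std_normal {z<..hi} + measure std_normal {hi<..}"
    using True by (subst std_normal.finite_measure_Union[symmetric]) (auto intro!: arg_cong[where f="measure std_normal"])
  ultimately show ?thesis by (simp add: c_def)
next
  case False
  hence "measure std_normal {z<..} \<le> measure std_normal {hi<..}"
    by (intro std_normal.finite_measure_mono) auto
  hence "exp (- h * hi - h\<^sup>2 / 2) * (measure std_normal {z<..} - measure std_normal {hi<..}) \<le> 0"
    by (simp add: mult_nonneg_nonpos)
  also have "\<dots> \<le> measure std_normal {z + h<..}" by simp
  finally show ?thesis .
qed

lemma std_normal_atLeast_eq_greaterThan: "measure std_normal {z..} = measure std_normal {z<..}"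
proof -
  have "emeasure std_normal {z} = 0"
    by (subst emeasure_std_normal) (auto simp: nn_integral_indicator_singleton)
  hence "measure std_normal {z} = 0" by (simp add: measure_def)
  moreover have "measure std_normal ({z} \<union> {z<..}) = measure std_normal {z} + measure std_normal {z<..}"
    by (rule std_normal.finite_measure_Union) auto
  moreover have "{z} \<union> {z<..} = {z..}" by auto
  ultimately show ?thesis by simp
qed

lemma std_normal_lower_tail: "measure std_normal {..-t} = measure std_normal {t..}"
proof -
  have "emeasure std_normal {..-t} = (\<integral>\<^sup>+y. ennreal (std_normal_density (-y)) * indicator {..-t} (-y) \<partial>lborel)"
    unfolding emeasure_std_normal[OF borel_closed[OF closed_atMost]]
    by (subst nn_integral_real_affine[where c="-1" and t=0]) auto
  also have "\<dots> = emeasure std_normal {t..}"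
    unfolding emeasure_std_normal[OF borel_closed[OF closed_atLeast]]
    by (intro nn_integral_cong) (auto simp: indicator_def std_normal_density_def)
  finally show ?thesis by (simp add: measure_def)
qed

lemma std_normal_abs_tail:
  assumes "0 \<le> t"
  shows "measure std_normal {y. t \<le> \<bar>y\<bar>} \<le> 2 * exp (- t\<^sup>2 / 2)"
proof -
  have "{y. t \<le> \<bar>y\<bar>} = {t..} \<union> {..-t}" by (auto simp: abs_if)
  hence "measure std_normal {y. t \<le> \<bar>y\<bar>} \<le> measure std_normal {t..} + measure std_normal {..-t}"
    using measure_Un_le[of "{t..}" std_normal "{..-t}"] by simp
  thus ?thesis using std_normal_upper_tail_le[OF assms] std_normal_lower_tail[of t] by simp
qed

text \<open>Multiplying the density by exp (s * y^2) gives a multiple of the normal density with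
  standard deviation \<open>1 / r\<close>.\<close>

lemma std_normal_square_mgf:
  assumes "s < 1 / 2"
  shows "(\<integral>\<^sup>+y. ennreal (exp (s * y\<^sup>2)) \<partial>std_normal) = ennreal (1 / sqrt (1 - 2 * s))"
proof -
  define r where "r = sqrt (1 - 2 * s)"
  have r: "r > 0" "r\<^sup>2 = 1 - 2 * s" using assms by (auto simp: r_def)
  have "(\<integral>\<^sup>+y. ennreal (exp (s * y\<^sup>2)) \<partial>std_normal) = (\<integral>\<^sup>+y. ennreal (std_normal_density y) * ennreal (exp (s * y\<^sup>2)) \<partial>lborel)"
    unfolding std_normal_def by (subst nn_integral_density) auto
  also have "\<dots> = (\<integral>\<^sup>+y. ennreal (1 / r) * ennreal (normal_density 0 (1 / r) y) \<partial>lborel)"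
  proof (rule nn_integral_cong)
    fix y
    have "- y\<^sup>2 / 2 + s * y\<^sup>2 = - (y\<^sup>2 * r\<^sup>2) / 2" unfolding r(2) by (simp add: field_simps)
    hence e: "exp (- y\<^sup>2 / 2) * exp (s * y\<^sup>2) = exp (- (y\<^sup>2 * r\<^sup>2) / 2)" by (simp flip: exp_add)
    have "std_normal_density y * exp (s * y\<^sup>2) = 1 / sqrt (2 * pi) * (exp (- y\<^sup>2 / 2) * exp (s * y\<^sup>2))"
      by (simp add: std_normal_density_def)
    also have "\<dots> = 1 / r * normal_density 0 (1 / r) y"
      unfolding e using r(1) by (simp add: normal_density_def power_divide real_sqrt_divide)
    finally show "ennreal (std_normal_density y) * ennreal (exp (s * y\<^sup>2)) = ennreal (1 / r) * ennreal (normal_density 0 (1 / r) y)"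
      using r(1) by (simp add: ennreal_mult[symmetric])
  qed
  also have "\<dots> = ennreal (1 / r)" using r(1) by (simp add: nn_integral_cmult nn_integral_normal_density)
  finally show ?thesis by (simp add: r_def)
qed

text \<open>The logarithm of the left side is - s - ln (1 - 2 * s) / 2, in which the linear terms
  cancel. The range of \<open>s\<close> keeps 2 * s where the second-order bound on the logarithm
  applies.\<close>

lemma std_normal_centered_square_mgf:
  assumes "\<bar>s\<bar> \<le> 1 / 4"
  shows "(\<integral>\<^sup>+y. ennreal (exp (s * (y\<^sup>2 - 1))) \<partial>std_normal) \<le> ennreal (exp (4 * s\<^sup>2))"
proof -
  have s: "1 - 2 * s > 0" using assms by (auto simp: abs_le_iff)
  have "(\<integral>\<^sup>+y. ennreal (exp (s * (y\<^sup>2 - 1))) \<partial>std_normal) = (\<integral>\<^sup>+y. ennreal (exp (- s)) * ennreal (exp (s * y\<^sup>2)) \<partial>std_normal)"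
    by (intro nn_integral_cong) (simp add: ennreal_mult[symmetric] right_diff_distrib flip: exp_add)
  also have "\<dots> = ennreal (exp (- s) * (1 / sqrt (1 - 2 * s)))"
    using s by (subst nn_integral_cmult) (auto simp: std_normal_square_mgf ennreal_mult[symmetric])
  also have "exp (- s) * (1 / sqrt (1 - 2 * s)) \<le> exp (4 * s\<^sup>2)"
  proof -
    have "\<bar>ln (1 + (- 2 * s)) - (- 2 * s)\<bar> \<le> 2 * (- 2 * s)\<^sup>2"
      by (rule abs_ln_one_plus_x_minus_x_bound) (use assms in auto)
    hence "- s - ln (1 - 2 * s) / 2 \<le> 4 * s\<^sup>2" by (simp add: abs_le_iff power2_eq_square)
    hence "exp (- s - ln (1 - 2 * s) / 2) \<le> exp (4 * s\<^sup>2)" by simp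
    moreover have "sqrt (1 - 2 * s) = exp (ln (1 - 2 * s) / 2)"
      using s by (simp add: ln_sqrt[symmetric])
    ultimately show ?thesis using s unfolding exp_diff by (simp add: exp_minus field_simps)
  qed
  finally show ?thesis by (simp add: ennreal_leI)
qed

context prob_space
begin

text \<open>An exponential Markov bound with \<open>s\<close> left free; the sign \<open>c\<close>
  treats both tails at once. The moment generating function is taken in \<open>ennreal\<close>,
  where it exists without an integrability proof.\<close>

lemma chi_square_tail:
  fixes Y :: "'i \<Rightarrow> 'a \<Rightarrow> real" and s u c :: real
  assumes fin: "finite I" and ind: "indep_vars (\<lambda>_. borel) Y I"
    and Y: "\<And>i. i \<in> I \<Longrightarrow> distr M borel (Y i) = std_normal"
    and s: "0 \<le> s" "s \<le> 1 / 4" and c: "c \<in> {-1, 1}"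
  shows "prob {\<omega> \<in> space M. u \<le> c * (\<Sum>i\<in>I. (Y i \<omega>)\<^sup>2 - 1)} \<le> exp (4 * s\<^sup>2 * card I - s * u)"
proof -
  have rv: "Y i \<in> borel_measurable M" if "i \<in> I" for i using ind that by (auto simp: indep_vars_def)
  define Z where "Z i \<omega> = ennreal (exp (s * c * ((Y i \<omega>)\<^sup>2 - 1)))" for i \<omega>
  have Zrv: "(\<lambda>\<omega>. \<Prod>i\<in>I. Z i \<omega>) \<in> borel_measurable M"
  proof (rule borel_measurable_prod_ennreal)
    fix i assume "i \<in> I"
    note rv[OF this, measurable]
    show "(\<lambda>\<omega>. Z i \<omega>) \<in> borel_measurable M" unfolding Z_def by measurable
  qed
  have "(\<integral>\<^sup>+\<omega>. (\<Prod>i\<in>I. Z i \<omega>) \<partial>M) = (\<Prod>i\<in>I. \<integral>\<^sup>+\<omega>. Z i \<omega> \<partial>M)"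
  proof (rule indep_vars_nn_integral[OF fin])
    show "indep_vars (\<lambda>_. borel) Z I"
      unfolding Z_def by (rule indep_vars_compose2[OF ind]) auto
  qed auto
  also have "\<dots> \<le> (\<Prod>i\<in>I. ennreal (exp (4 * s\<^sup>2)))"
  proof (intro prod_mono_ennreal)
    fix i assume i: "i \<in> I"
    have "(\<integral>\<^sup>+\<omega>. Z i \<omega> \<partial>M) = (\<integral>\<^sup>+y. ennreal (exp (s * c * (y\<^sup>2 - 1))) \<partial>distr M borel (Y i))"
      unfolding Z_def using rv[OF i] by (subst nn_integral_distr) auto
    also have "\<dots> \<le> ennreal (exp (4 * (s * c)\<^sup>2))"
      unfolding Y[OF i] by (rule std_normal_centered_square_mgf) (use s c in auto)
    finally show "(\<integral>\<^sup>+\<omega>. Z i \<omega> \<partial>M) \<le> ennreal (exp (4 * s\<^sup>2))" using c by (auto simp: power_mult_distrib)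
  qed
  also have "\<dots> = ennreal (exp (4 * s\<^sup>2 * card I))"
    by (simp add: ennreal_power mult_ac flip: exp_of_nat_mult)
  finally have mgf: "(\<integral>\<^sup>+\<omega>. (\<Prod>i\<in>I. Z i \<omega>) \<partial>M) \<le> ennreal (exp (4 * s\<^sup>2 * card I))" .
  have Zprod: "(\<Prod>i\<in>I. Z i \<omega>) = ennreal (exp (s * (c * (\<Sum>i\<in>I. (Y i \<omega>)\<^sup>2 - 1))))" for \<omega>
    unfolding Z_def using fin by (simp add: prod_ennreal exp_sum[symmetric] sum_distrib_left mult_ac)
  have "emeasure M {\<omega> \<in> space M. u \<le> c * (\<Sum>i\<in>I. (Y i \<omega>)\<^sup>2 - 1)}
     \<le> emeasure M {\<omega> \<in> space M. 1 \<le> ennreal (exp (- s * u)) * (\<Prod>i\<in>I. Z i \<omega>)}"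
  proof (intro emeasure_mono subsetI)
    fix \<omega> assume "\<omega> \<in> {\<omega> \<in> space M. u \<le> c * (\<Sum>i\<in>I. (Y i \<omega>)\<^sup>2 - 1)}"
    hence "\<omega> \<in> space M" "s * u \<le> s * (c * (\<Sum>i\<in>I. (Y i \<omega>)\<^sup>2 - 1))" using s by (auto intro: mult_left_mono)
    thus "\<omega> \<in> {\<omega> \<in> space M. 1 \<le> ennreal (exp (- s * u)) * (\<Prod>i\<in>I. Z i \<omega>)}"
      unfolding Zprod by (simp add: ennreal_mult[symmetric] flip: exp_add)
  next
    show "{\<omega> \<in> space M. 1 \<le> ennreal (exp (- s * u)) * (\<Prod>i\<in>I. Z i \<omega>)} \<in> events"
      using Zrv by simp
  qed
  also have "\<dots> \<le> ennreal (exp (- s * u)) * (\<integral>\<^sup>+\<omega>. (\<Prod>i\<in>I. Z i \<omega>) * indicator (space M) \<omega> \<partial>M)"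
    by (rule nn_integral_Markov_inequality) (use Zrv in auto)
  also have "\<dots> \<le> ennreal (exp (- s * u)) * ennreal (exp (4 * s\<^sup>2 * card I))"
    using mgf by (intro mult_left_mono) (auto cong: nn_integral_cong)
  also have "\<dots> = ennreal (exp (4 * s\<^sup>2 * card I - s * u))"
    by (simp add: ennreal_mult[symmetric] flip: exp_add)
  finally show ?thesis by (simp add: emeasure_eq_measure)
qed

end

section \<open>Linear forms of a GOE matrix\<close>

definition lin_form :: "nat \<Rightarrow> (nat \<Rightarrow> nat \<Rightarrow> real) \<Rightarrow> real mat \<Rightarrow> real" where
  "lin_form n K A = (\<Sum>i<n. \<Sum>j<n. K i j * A $$ (i,j))"

abbreviation upper_indices :: "nat \<Rightarrow> (nat \<times> nat) set" where
  "upper_indices n \<equiv> {(i,j). i \<le> j \<and> j < n}"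

lemma finite_upper_indices [simp]: "finite (upper_indices n)"
  by (rule finite_subset[of _ "{..<n} \<times> {..<n}"]) auto

text \<open>Links the independent entries, on and above the diagonal, with linear and quadratic
  forms, which run over all index pairs.\<close>

lemma sum_symmetric_upper:
  fixes f :: "nat \<Rightarrow> nat \<Rightarrow> real"
  assumes sym: "\<And>i j. i < n \<Longrightarrow> j < n \<Longrightarrow> f i j = f j i"
  shows "(\<Sum>i<n. \<Sum>j<n. f i j) = (\<Sum>(i,j)\<in>upper_indices n. if i = j then f i j else 2 * f i j)"
proof -
  let ?U = "{(i,j). i < j \<and> j < n}" and ?L = "{(i,j). j < i \<and> i < n}" and ?D = "{(i,j). i = j \<and> j < n}"
  have fin: "finite ?U" "finite ?L" "finite ?D"
    by (rule finite_subset[of _ "{..<n} \<times> {..<n}"]; auto)+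
  have "(\<Sum>i<n. \<Sum>j<n. f i j) = (\<Sum>(i,j)\<in>{..<n} \<times> {..<n}. f i j)" by (simp add: sum.cartesian_product)
  also have "{..<n} \<times> {..<n} = ?D \<union> ?U \<union> ?L" by auto
  also have "(\<Sum>(i,j)\<in>?D \<union> ?U \<union> ?L. f i j) = (\<Sum>(i,j)\<in>?D. f i j) + (\<Sum>(i,j)\<in>?U. f i j) + (\<Sum>(i,j)\<in>?L. f i j)"
    using fin by (subst sum.union_disjoint, auto)+
  also have "(\<Sum>(i,j)\<in>?L. f i j) = (\<Sum>(i,j)\<in>?U. f i j)"
    by (rule sum.reindex_bij_witness[of _ prod.swap prod.swap]) (auto simp: sym)
  also have "(\<Sum>(i,j)\<in>?D. f i j) + (\<Sum>(i,j)\<in>?U. f i j) + (\<Sum>(i,j)\<in>?U. f i j)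
      = (\<Sum>(i,j)\<in>?D \<union> ?U. if i = j then f i j else 2 * f i j)"
  proof -
    have "(\<Sum>(i,j)\<in>?D \<union> ?U. if i = j then f i j else 2 * f i j)
       = (\<Sum>(i,j)\<in>?D. if i = j then f i j else 2 * f i j) + (\<Sum>(i,j)\<in>?U. if i = j then f i j else 2 * f i j)"
      using fin by (intro sum.union_disjoint) auto
    also have "(\<Sum>(i,j)\<in>?D. if i = j then f i j else 2 * f i j) = (\<Sum>(i,j)\<in>?D. f i j)"
      by (intro sum.cong) auto
    also have "(\<Sum>(i,j)\<in>?U. if i = j then f i j else 2 * f i j) = (\<Sum>(i,j)\<in>?U. 2 * f i j)"
      by (intro sum.cong) auto
    finally show ?thesis by (simp add: sum_distrib_left case_prod_unfold)
  qed
  also have "?D \<union> ?U = upper_indices n" by auto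
  finally show ?thesis .
qed

locale GOE =
  fixes n :: nat and M :: "'a measure" and A :: "'a \<Rightarrow> real mat"
  assumes n_pos: "n \<ge> 1" and GOE: "is_GOE n M A"

sublocale GOE \<subseteq> prob_space M
  using GOE by (simp add: is_GOE_def)

context GOE
begin

lemma A_carrier: "\<omega> \<in> space M \<Longrightarrow> A \<omega> \<in> carrier_mat n n"
  and A_transpose: "\<omega> \<in> space M \<Longrightarrow> transpose_mat (A \<omega>) = A \<omega>"
  using GOE by (auto simp: is_GOE_def)

lemma A_sym: "\<omega> \<in> space M \<Longrightarrow> i < n \<Longrightarrow> j < n \<Longrightarrow> A \<omega> $$ (i,j) = A \<omega> $$ (j,i)"
  using A_carrier A_transpose by (metis carrier_matD index_transpose_mat(1))

lemma A_indep: "indep_vars (\<lambda>_. borel) (\<lambda>p \<omega>. A \<omega> $$ p) (upper_indices n)"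
  using GOE by (simp add: is_GOE_def case_prod_unfold)

lemma A_distributed:
  "i \<le> j \<Longrightarrow> j < n \<Longrightarrow> distributed M lborel (\<lambda>\<omega>. A \<omega> $$ (i,j)) (normal_density 0 (sqrt ((if i = j then 2 else 1) / real n)))"
  using GOE unfolding is_GOE_def by (auto split: if_splits)

lemma A_measurable [measurable]:
  assumes "i < n" "j < n"
  shows "(\<lambda>\<omega>. A \<omega> $$ (i,j)) \<in> borel_measurable M"
proof (cases "i \<le> j")
  case True
  thus ?thesis using distributed_measurable[OF A_distributed[of i j]] assms by simp
next
  case False
  have "(\<lambda>\<omega>. A \<omega> $$ (j,i)) \<in> borel_measurable M"
    using distributed_measurable[OF A_distributed[of j i]] assms False by simp
  thus ?thesis by (rule measurable_cong[THEN iffD1, rotated]) (use A_sym assms in auto)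
qed

lemma lin_form_measurable [measurable]: "(\<lambda>\<omega>. lin_form n K (A \<omega>)) \<in> borel_measurable M"
  unfolding lin_form_def by (intro borel_measurable_sum borel_measurable_times borel_measurable_const A_measurable) auto

lemma A_char:
  assumes "i \<le> j" "j < n"
  shows "char (distr M borel (\<lambda>\<omega>. c * A \<omega> $$ (i,j))) 1 = exp (- (c\<^sup>2 * ((if i = j then 2 else 1) / real n) / 2))"
proof -
  define s where "s = sqrt ((if i = j then 2 else 1) / real n)"
  have s: "s > 0" "s\<^sup>2 = (if i = j then 2 else 1) / real n" using n_pos by (auto simp: s_def)
  have [measurable]: "(\<lambda>\<omega>. A \<omega> $$ (i,j)) \<in> borel_measurable M" using assms by simp
  have "distributed M lborel (\<lambda>\<omega>. (A \<omega> $$ (i,j) - 0) / s) std_normal_density"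
    using A_distributed[OF assms] normal_standard_normal_convert[OF s(1), of "\<lambda>\<omega>. A \<omega> $$ (i,j)" 0]
    by (simp add: s_def)
  hence "distr M lborel (\<lambda>\<omega>. A \<omega> $$ (i,j) / s) = std_normal_distribution"
    by (simp add: distributed_def)
  moreover have "distr M lborel (\<lambda>\<omega>. A \<omega> $$ (i,j) / s) = distr M borel (\<lambda>\<omega>. A \<omega> $$ (i,j) / s)"
    by (intro distr_cong) auto
  ultimately have d: "char (distr M borel (\<lambda>\<omega>. A \<omega> $$ (i,j) / s)) (c * s) = exp (- (c * s)\<^sup>2 / 2)"
    by (simp add: char_std_normal_distribution)
  have "char (distr M borel (\<lambda>\<omega>. c * A \<omega> $$ (i,j))) 1 = (CLINT \<omega>|M. iexp (c * A \<omega> $$ (i,j)))"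
    by (simp add: char_def integral_distr)
  also have "\<dots> = char (distr M borel (\<lambda>\<omega>. A \<omega> $$ (i,j) / s)) (c * s)"
    using s(1) by (simp add: char_def integral_distr)
  finally show ?thesis using s(2) by (simp add: d power_mult_distrib)
qed

text \<open>The doubled diagonal variance compensates the double counting off the diagonal, so for
  symmetric \<open>K\<close> the variance is 2 / n times the sum of squares of \<open>K\<close>. In
  other words the GOE is isotropic on the symmetric matrices.\<close>

lemma lin_form_char:
  assumes K: "\<And>i j. i < n \<Longrightarrow> j < n \<Longrightarrow> K i j = K j i"
  shows "(CLINT \<omega>|M. iexp (lin_form n K (A \<omega>))) = exp (- ((\<Sum>i<n. \<Sum>j<n. (K i j)\<^sup>2) / n))"
proof -
  define c where "c p = (case p of (i,j) \<Rightarrow> if i = j then K i j else 2 * K i j)" for p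
  have ind: "indep_vars (\<lambda>_. borel) (\<lambda>p \<omega>. c p * A \<omega> $$ p) (upper_indices n)"
    by (rule indep_vars_compose2[OF A_indep]) auto
  have lf: "lin_form n K (A \<omega>) = (\<Sum>p\<in>upper_indices n. c p * A \<omega> $$ p)" if "\<omega> \<in> space M" for \<omega>
    unfolding lin_form_def
    by (subst sum_symmetric_upper) (use A_sym[OF that] K in \<open>auto intro!: sum.cong simp: c_def\<close>)
  have m: "(\<lambda>\<omega>. \<Sum>p\<in>upper_indices n. c p * A \<omega> $$ p) \<in> borel_measurable M"
    by (intro borel_measurable_sum borel_measurable_times borel_measurable_const) auto
  have "(CLINT \<omega>|M. iexp (lin_form n K (A \<omega>))) = (CLINT \<omega>|M. iexp (\<Sum>p\<in>upper_indices n. c p * A \<omega> $$ p))"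
    by (intro Bochner_Integration.integral_cong refl) (simp add: lf)
  also have "\<dots> = char (distr M borel (\<lambda>\<omega>. \<Sum>p\<in>upper_indices n. c p * A \<omega> $$ p)) 1"
    unfolding char_def using m by (subst integral_distr) auto
  also have "\<dots> = (\<Prod>p\<in>upper_indices n. char (distr M borel (\<lambda>\<omega>. c p * A \<omega> $$ p)) 1)"
    by (rule char_distr_sum[OF ind])
  also have "\<dots> = (\<Prod>(i,j)\<in>upper_indices n. complex_of_real (exp (- ((if i = j then (K i j)\<^sup>2 else 2 * (K i j)\<^sup>2) / n))))"
  proof (intro prod.cong refl)
    fix p assume "p \<in> upper_indices n"
    thus "char (distr M borel (\<lambda>\<omega>. c p * A \<omega> $$ p)) 1 = (case p of (i,j) \<Rightarrow> complex_of_real (exp (- ((if i = j then (K i j)\<^sup>2 else 2 * (K i j)\<^sup>2) / n))))"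
      by (cases p) (auto simp: A_char c_def power_mult_distrib)
  qed
  also have "\<dots> = of_real (exp (\<Sum>(i,j)\<in>upper_indices n. - ((if i = j then (K i j)\<^sup>2 else 2 * (K i j)\<^sup>2) / n)))"
    by (subst exp_sum[OF finite_upper_indices]) (auto simp: case_prod_unfold)
  also have "(\<Sum>(i,j)\<in>upper_indices n. - ((if i = j then (K i j)\<^sup>2 else 2 * (K i j)\<^sup>2) / n)) = - ((\<Sum>i<n. \<Sum>j<n. (K i j)\<^sup>2) / n)"
    by (subst sum_symmetric_upper) (use K in \<open>auto simp: sum_negf sum_divide_distrib case_prod_unfold intro!: sum.cong\<close>)
  finally show ?thesis .
qed

text \<open>By isotropy, orthogonal coefficient matrices give independent variables: the cross terms
  in the joint characteristic function vanish. The squared norm n / 2 normalizes the variance to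
  one. Whitened row sums and image coordinates are both instances.\<close>

lemma orthogonal_lin_forms:
  fixes K :: "'k \<Rightarrow> nat \<Rightarrow> nat \<Rightarrow> real"
  assumes fin: "finite I"
    and sym: "\<And>k i j. k \<in> I \<Longrightarrow> i < n \<Longrightarrow> j < n \<Longrightarrow> K k i j = K k j i"
    and orth: "\<And>k l. k \<in> I \<Longrightarrow> l \<in> I \<Longrightarrow> (\<Sum>i<n. \<Sum>j<n. K k i j * K l i j) = (if k = l then n / 2 else 0)"
  shows "indep_vars (\<lambda>_. borel) (\<lambda>k \<omega>. lin_form n (K k) (A \<omega>)) I"
    and "\<And>k. k \<in> I \<Longrightarrow> distr M borel (\<lambda>\<omega>. lin_form n (K k) (A \<omega>)) = std_normal"
proof -
  have ch: "(CLINT \<omega>|M. iexp (\<Sum>k\<in>I. t k * lin_form n (K k) (A \<omega>))) = (\<Prod>k\<in>I. complex_of_real (exp (- (t k)\<^sup>2 / 2)))" for t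
  proof -
    define L where "L i j = (\<Sum>k\<in>I. t k * K k i j)" for i j
    have "(\<Sum>k\<in>I. t k * lin_form n (K k) (A \<omega>)) = lin_form n L (A \<omega>)" for \<omega>
    proof -
      have "(\<Sum>k\<in>I. t k * lin_form n (K k) (A \<omega>)) = (\<Sum>k\<in>I. \<Sum>i<n. \<Sum>j<n. t k * K k i j * A \<omega> $$ (i,j))"
        by (simp add: lin_form_def sum_distrib_left mult_ac)
      also have "\<dots> = (\<Sum>i<n. \<Sum>k\<in>I. \<Sum>j<n. t k * K k i j * A \<omega> $$ (i,j))" by (rule sum.swap)
      also have "\<dots> = (\<Sum>i<n. \<Sum>j<n. \<Sum>k\<in>I. t k * K k i j * A \<omega> $$ (i,j))" by (intro sum.cong refl sum.swap)
      finally show ?thesis by (simp add: lin_form_def L_def sum_distrib_right)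
    qed
    hence "(CLINT \<omega>|M. iexp (\<Sum>k\<in>I. t k * lin_form n (K k) (A \<omega>))) = exp (- ((\<Sum>i<n. \<Sum>j<n. (L i j)\<^sup>2) / n))"
      using lin_form_char[of L] sym by (simp add: L_def)
    also have "(\<Sum>i<n. \<Sum>j<n. (L i j)\<^sup>2) = (\<Sum>i<n. \<Sum>j<n. \<Sum>k\<in>I. \<Sum>l\<in>I. t k * t l * (K k i j * K l i j))"
      by (simp add: L_def power2_eq_square sum_product mult_ac)
    also have "\<dots> = (\<Sum>i<n. \<Sum>k\<in>I. \<Sum>j<n. \<Sum>l\<in>I. t k * t l * (K k i j * K l i j))" by (intro sum.cong refl sum.swap)
    also have "\<dots> = (\<Sum>k\<in>I. \<Sum>i<n. \<Sum>j<n. \<Sum>l\<in>I. t k * t l * (K k i j * K l i j))" by (rule sum.swap)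
    also have "\<dots> = (\<Sum>k\<in>I. \<Sum>i<n. \<Sum>l\<in>I. \<Sum>j<n. t k * t l * (K k i j * K l i j))" by (intro sum.cong refl sum.swap)
    also have "\<dots> = (\<Sum>k\<in>I. \<Sum>l\<in>I. \<Sum>i<n. \<Sum>j<n. t k * t l * (K k i j * K l i j))" by (intro sum.cong refl sum.swap)
    also have "\<dots> = (\<Sum>k\<in>I. \<Sum>l\<in>I. t k * t l * (\<Sum>i<n. \<Sum>j<n. K k i j * K l i j))" by (simp add: sum_distrib_left)
    also have "\<dots> = (\<Sum>k\<in>I. \<Sum>l\<in>I. if k = l then t k * t k * (n / 2) else 0)"
      by (intro sum.cong refl) (use orth in \<open>auto\<close>)
    also have "\<dots> = (\<Sum>k\<in>I. (t k)\<^sup>2 / 2) * n" using fin by (simp add: power2_eq_square sum_distrib_right)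
    also have "exp (- ((\<Sum>k\<in>I. (t k)\<^sup>2 / 2) * n / n)) = exp (\<Sum>k\<in>I. - (t k)\<^sup>2 / 2)"
      using n_pos by (simp add: sum_negf)
    finally show ?thesis using fin by (simp add: exp_sum)
  qed
  have d: "distr M borel (\<lambda>\<omega>. lin_form n (K k) (A \<omega>)) = std_normal" if k: "k \<in> I" for k
  proof (rule Levy_uniqueness)
    show "real_distribution (distr M borel (\<lambda>\<omega>. lin_form n (K k) (A \<omega>)))" by (rule real_distribution_distr) simp
    show "real_distribution std_normal" unfolding real_distribution_def real_distribution_axioms_def
      using std_normal.prob_space_axioms by simp
    show "char (distr M borel (\<lambda>\<omega>. lin_form n (K k) (A \<omega>))) = char std_normal"
    proof
      fix t
      have "char (distr M borel (\<lambda>\<omega>. lin_form n (K k) (A \<omega>))) t = (CLINT \<omega>|M. iexp (t * lin_form n (K k) (A \<omega>)))"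
        by (simp add: char_def integral_distr)
      also have "\<dots> = (CLINT \<omega>|M. iexp (\<Sum>l\<in>I. (if l = k then t else 0) * lin_form n (K l) (A \<omega>)))"
        using fin k by (simp add: if_distrib[of "\<lambda>x. x * _"] sum.delta cong: if_cong)
      also have "\<dots> = (\<Prod>l\<in>I. if l = k then complex_of_real (exp (- t\<^sup>2 / 2)) else 1)"
        unfolding ch by (intro prod.cong) auto
      also have "\<dots> = char std_normal t"
        using fin k by (simp add: prod.delta char_std_normal_distribution std_normal_def)
      finally show "char (distr M borel (\<lambda>\<omega>. lin_form n (K k) (A \<omega>))) t = char std_normal t" .
    qed
  qed
  show "indep_vars (\<lambda>_. borel) (\<lambda>k \<omega>. lin_form n (K k) (A \<omega>)) I"
  proof (rule indep_vars_if_char_factorizes[OF fin])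
    fix t
    show "(CLINT \<omega>|M. iexp (\<Sum>k\<in>I. t k * lin_form n (K k) (A \<omega>))) = (\<Prod>k\<in>I. char (distr M borel (\<lambda>\<omega>. lin_form n (K k) (A \<omega>))) (t k))"
      unfolding ch by (intro prod.cong refl) (simp add: d char_std_normal_distribution std_normal_def)
  qed simp
  show "\<And>k. k \<in> I \<Longrightarrow> distr M borel (\<lambda>\<omega>. lin_form n (K k) (A \<omega>)) = std_normal" by (rule d)
qed

lemma lin_form_tail:
  assumes sym: "\<And>i j. i < n \<Longrightarrow> j < n \<Longrightarrow> K i j = K j i"
    and V: "(\<Sum>i<n. \<Sum>j<n. (K i j)\<^sup>2) \<le> V" "V > 0" and u: "u > 0"
  shows "prob {\<omega> \<in> space M. u \<le> \<bar>lin_form n K (A \<omega>)\<bar>} \<le> 2 * exp (- (real n * u\<^sup>2 / (4 * V)))"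
proof (cases "(\<Sum>i<n. \<Sum>j<n. (K i j)\<^sup>2) = 0")
  \<comment> \<open>A form of variance zero cannot be normalized, but it vanishes
    identically.\<close>
  case True
  hence "(\<Sum>j<n. (K i j)\<^sup>2) = 0" if "i < n" for i
    using that by (subst (asm) sum_nonneg_eq_0_iff) (auto intro: sum_nonneg)
  hence "K i j = 0" if "i < n" "j < n" for i j
    using that by (subst (asm) sum_nonneg_eq_0_iff) auto
  hence "lin_form n K (A \<omega>) = 0" for \<omega> by (simp add: lin_form_def)
  hence "{\<omega> \<in> space M. u \<le> \<bar>lin_form n K (A \<omega>)\<bar>} = {}" using u by auto
  thus ?thesis by (simp only: measure_empty) simp
next
  case False
  define W where "W = (\<Sum>i<n. \<Sum>j<n. (K i j)\<^sup>2)"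
  have W: "W > 0" using False unfolding W_def by (simp add: sum_nonneg order.strict_iff_order)
  define s where "s = sqrt (2 * W / n)"
  have s: "s > 0" "s\<^sup>2 = 2 * W / n" using W n_pos by (auto simp: s_def)
  define Y where "Y \<omega> = lin_form n (\<lambda>i j. K i j / s) (A \<omega>)" for \<omega>
  have YK: "lin_form n K (A \<omega>) = s * Y \<omega>" for \<omega>
    using s(1) by (simp add: Y_def lin_form_def sum_distrib_left)
  have [measurable]: "Y \<in> borel_measurable M" unfolding Y_def by measurable
  have "distr M borel Y = std_normal"
    unfolding Y_def
  proof (rule orthogonal_lin_forms(2)[of "{()}" "\<lambda>_ i j. K i j / s"])
    have "(\<Sum>i<n. \<Sum>j<n. K i j / s * (K i j / s)) = W / s\<^sup>2"
      by (simp add: W_def power2_eq_square sum_divide_distrib)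
    thus "(\<Sum>i<n. \<Sum>j<n. K i j / s * (K i j / s)) = (if k = l then n / 2 else 0)" for k l :: unit
      using W n_pos by (simp add: s(2))
  qed (use sym in auto)
  hence "measure (distr M borel Y) {y. u / s \<le> \<bar>y\<bar>} \<le> 2 * exp (- (u / s)\<^sup>2 / 2)"
    using std_normal_abs_tail[of "u / s"] u s(1) by simp
  hence "prob {\<omega> \<in> space M. u / s \<le> \<bar>Y \<omega>\<bar>} \<le> 2 * exp (- (u / s)\<^sup>2 / 2)"
    by (simp add: measure_distr vimage_def Int_def conj_commute)
  also have "{\<omega> \<in> space M. u / s \<le> \<bar>Y \<omega>\<bar>} = {\<omega> \<in> space M. u \<le> \<bar>lin_form n K (A \<omega>)\<bar>}"
    using s(1) by (auto simp: YK abs_mult field_simps)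
  also have "2 * exp (- (u / s)\<^sup>2 / 2) \<le> 2 * exp (- (real n * u\<^sup>2 / (4 * V)))"
  proof -
    have "real n * u\<^sup>2 / (4 * V) \<le> real n * u\<^sup>2 / (4 * W)"
      using V W u n_pos by (intro divide_left_mono) (auto simp: W_def)
    also have "\<dots> = (u / s)\<^sup>2 / 2" using W n_pos by (simp add: power_divide s(2) field_simps)
    finally show ?thesis by simp
  qed
  finally show ?thesis .
qed

end

section \<open>The quadratic form on sparse vectors\<close>

lemma sum_exp_neg_square_le:
  assumes b: "b \<ge> (1::real)"
  shows "(\<Sum>z\<in>{- int m..int m}. exp (- b * (real_of_int z)\<^sup>2)) \<le> 1 + 4 * exp (- b)"
proof -
  \<comment> \<open>The factor 1 - (1/2)^m is the slack that lets the induction absorb the two new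
    terms.\<close>
  have "(\<Sum>z\<in>{- int m..int m}. exp (- b * (real_of_int z)\<^sup>2)) \<le> 1 + 4 * exp (- b) * (1 - (1/2) ^ m)"
  proof (induction m)
    case (Suc m)
    have eq: "{- int (Suc m)..int (Suc m)} = insert (int (Suc m)) (insert (- int (Suc m)) {- int m..int m})" by auto
    have e2: "exp (- b) \<le> 1 / 2"
    proof -
      have "exp (- b) \<le> exp (- 1)" using b by simp
      also have "\<dots> \<le> 1 / 2" using exp_ge_add_one_self[of "1::real"] by (simp add: exp_minus field_simps)
      finally show ?thesis .
    qed
    have "b * (1 + real m) \<le> b * (1 + real m)\<^sup>2"
      using b by (intro mult_left_mono) (auto simp: power2_eq_square)
    hence "exp (- b * (1 + real m)\<^sup>2) \<le> exp (- b) * exp (- b) ^ m"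
      by (simp flip: exp_of_nat_mult exp_add add: algebra_simps)
    also have "\<dots> \<le> exp (- b) * (1 / 2) ^ m"
      using e2 by (intro mult_left_mono power_mono) auto
    finally have "2 * exp (- b * (1 + real m)\<^sup>2) \<le> 4 * exp (- b) * ((1 / 2) ^ m - (1 / 2) ^ Suc m)"
      by simp
    moreover have "(- 1 - real m)\<^sup>2 = (1 + real m)\<^sup>2" by (simp add: power2_eq_square algebra_simps)
    ultimately show ?case using Suc unfolding eq by (simp add: algebra_simps)
  qed simp
  also have "\<dots> \<le> 1 + 4 * exp (- b) * 1" by (intro add_left_mono mult_left_mono) auto
  finally show ?thesis by simp
qed

text \<open>The box makes the set finite by construction, and extensionality outside the index set
  gives each lattice point a single representative.\<close>

definition lattice_ball :: "nat \<Rightarrow> real \<Rightarrow> (nat \<Rightarrow> int) set" where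
  "lattice_ball n R = {z \<in> {..<n} \<rightarrow>\<^sub>E {- \<lceil>R\<rceil>..\<lceil>R\<rceil>}. (\<Sum>i<n. (real_of_int (z i))\<^sup>2) \<le> R}"

lemma finite_lattice_ball: "finite (lattice_ball n R)"
  unfolding lattice_ball_def by (rule finite_subset[of _ "{..<n} \<rightarrow>\<^sub>E {- \<lceil>R\<rceil>..\<lceil>R\<rceil>}"]) (auto intro!: finite_PiE)

text \<open>Each point is given the weight exp (b * (R - |z|^2)), which is at least 1 and whose sum
  factorizes over the coordinates. For R a small multiple of n and large \<open>b\<close>, the
  logarithm of the count is a small multiple of n; this treats all sparse supports together, without
  a union over supports.\<close>

lemma card_lattice_ball_le:
  assumes b: "b \<ge> (1::real)" and R: "R > 0"
  shows "real (card (lattice_ball n R)) \<le> exp (b * R + 4 * real n * exp (- b))"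
proof -
  let ?B = "{..<n} \<rightarrow>\<^sub>E {- \<lceil>R\<rceil>..\<lceil>R\<rceil>}"
  define m where "m = nat \<lceil>R\<rceil>"
  have m: "\<lceil>R\<rceil> = int m" using R by (simp add: m_def)
  have fB: "finite ?B" by (intro finite_PiE) auto
  have "real (card (lattice_ball n R)) = (\<Sum>z\<in>lattice_ball n R. 1)" by simp
  also have "\<dots> \<le> (\<Sum>z\<in>lattice_ball n R. exp (b * R) * (\<Prod>i<n. exp (- b * (real_of_int (z i))\<^sup>2)))"
  proof (rule sum_mono)
    fix z assume "z \<in> lattice_ball n R"
    hence "b * (\<Sum>i<n. (real_of_int (z i))\<^sup>2) \<le> b * R" using b by (intro mult_left_mono) (auto simp: lattice_ball_def)
    hence "exp 0 \<le> exp (b * R + (\<Sum>i<n. - b * (real_of_int (z i))\<^sup>2))" by (simp add: sum_negf flip: sum_distrib_left)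
    thus "1 \<le> exp (b * R) * (\<Prod>i<n. exp (- b * (real_of_int (z i))\<^sup>2))"
      by (simp add: exp_add exp_sum)
  qed
  also have "\<dots> \<le> (\<Sum>z\<in>?B. exp (b * R) * (\<Prod>i<n. exp (- b * (real_of_int (z i))\<^sup>2)))"
  proof (rule sum_mono2[OF fB])
    show "lattice_ball n R \<subseteq> ?B" unfolding lattice_ball_def by blast
    show "0 \<le> exp (b * R) * (\<Prod>i<n. exp (- b * (real_of_int (z i))\<^sup>2))" for z
      by (intro mult_nonneg_nonneg prod_nonneg) auto
  qed
  also have "\<dots> = exp (b * R) * (\<Prod>i<n. \<Sum>z\<in>{- \<lceil>R\<rceil>..\<lceil>R\<rceil>}. exp (- b * (real_of_int z)\<^sup>2))"
    by (subst prod_sum_PiE) (simp_all only: finite_lessThan finite_atLeastAtMost_int sum_distrib_left)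
  also have "\<dots> \<le> exp (b * R) * (\<Prod>i<n. exp (4 * exp (- b)))"
  proof (intro mult_left_mono prod_mono conjI sum_nonneg)
    have "(\<Sum>z\<in>{- \<lceil>R\<rceil>..\<lceil>R\<rceil>}. exp (- b * (real_of_int z)\<^sup>2)) \<le> 1 + 4 * exp (- b)"
      unfolding m by (rule sum_exp_neg_square_le[OF b])
    also have "\<dots> \<le> exp (4 * exp (- b))" by (rule exp_ge_add_one_self)
    finally show "(\<Sum>z\<in>{- \<lceil>R\<rceil>..\<lceil>R\<rceil>}. exp (- b * (real_of_int z)\<^sup>2)) \<le> exp (4 * exp (- b))" .
  qed auto
  also have "\<dots> = exp (b * R + 4 * real n * exp (- b))"
    by (simp add: exp_add mult_ac flip: exp_of_nat_mult)
  finally show ?thesis .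
qed

lemma quad_form_scale: "quad_form n a (\<lambda>i. c * x i) (\<lambda>i. c * x i) = c\<^sup>2 * quad_form n a x x"
  by (simp add: quad_form_def sum_distrib_left power2_eq_square mult_ac)

lemma sq_norm_scale: "sq_norm n (\<lambda>i. c * x i) = c\<^sup>2 * sq_norm n x"
  by (simp add: sq_norm_def sum_distrib_left power_mult_distrib)

lemma sq_norm_sum_le:
  assumes "t > 0"
  shows "sq_norm n (\<lambda>i. x i + y i) \<le> (1 + t) * sq_norm n x + (1 + 1 / t) * sq_norm n y"
proof -
  have "(x i + y i)\<^sup>2 \<le> (1 + t) * (x i)\<^sup>2 + (1 + 1 / t) * (y i)\<^sup>2" for i
  proof -
    have "0 \<le> (sqrt t * x i - y i / sqrt t)\<^sup>2" by simp
    also have "\<dots> = t * (x i)\<^sup>2 + (y i)\<^sup>2 / t - 2 * x i * y i"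
      using assms by (simp add: power2_diff power_mult_distrib power_divide)
    finally show ?thesis by (simp add: power2_sum algebra_simps)
  qed
  thus ?thesis unfolding sq_norm_def
    by (simp add: sum_distrib_left flip: sum.distrib) (intro sum_mono, auto)
qed

lemma quad_form_polarize:
  assumes sym: "\<And>i j. i < n \<Longrightarrow> j < n \<Longrightarrow> a i j = a j i"
  shows "quad_form n a (\<lambda>i. x i + y i) (\<lambda>i. x i + y i) - quad_form n a (\<lambda>i. x i - y i) (\<lambda>i. x i - y i) = 4 * quad_form n a x y"
    and "quad_form n a x x - quad_form n a y y = quad_form n a (\<lambda>i. x i - y i) (\<lambda>i. x i + y i)"
proof -
  have s: "quad_form n a y x = quad_form n a x y"
    unfolding quad_form_def by (subst sum.swap) (intro sum.cong refl, use sym in \<open>auto\<close>)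
  show "quad_form n a (\<lambda>i. x i + y i) (\<lambda>i. x i + y i) - quad_form n a (\<lambda>i. x i - y i) (\<lambda>i. x i - y i) = 4 * quad_form n a x y"
    using s by (simp add: quad_form_def algebra_simps sum.distrib sum_subtractf)
  show "quad_form n a x x - quad_form n a y y = quad_form n a (\<lambda>i. x i - y i) (\<lambda>i. x i + y i)"
    using s by (simp add: quad_form_def algebra_simps sum.distrib sum_subtractf)
qed

text \<open>Polarization applied to \<open>t * e\<close> and \<open>f / t\<close>: the scaling
  leaves the bilinear value alone and balances a short \<open>e\<close> against a long
  \<open>f\<close>.\<close>

lemma bilinear_bound:
  assumes sym: "\<And>i j. i < n \<Longrightarrow> j < n \<Longrightarrow> a i j = a j i" and t: "t > 0"
    and s: "\<And>v. (\<And>i. i \<notin> J \<Longrightarrow> v i = 0) \<Longrightarrow> \<bar>quad_form n a v v\<bar> \<le> s * sq_norm n v"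
    and supp: "\<And>i. i \<notin> J \<Longrightarrow> e i = 0" "\<And>i. i \<notin> J \<Longrightarrow> f i = 0"
  shows "\<bar>quad_form n a e f\<bar> \<le> s / 2 * (t\<^sup>2 * sq_norm n e + sq_norm n f / t\<^sup>2)"
proof -
  let ?e = "\<lambda>i. t * e i" and ?f = "\<lambda>i. f i / t"
  have "quad_form n a e f = quad_form n a ?e ?f" using t by (simp add: quad_form_def mult_ac)
  hence "\<bar>4 * quad_form n a e f\<bar> \<le> \<bar>quad_form n a (\<lambda>i. ?e i + ?f i) (\<lambda>i. ?e i + ?f i)\<bar> + \<bar>quad_form n a (\<lambda>i. ?e i - ?f i) (\<lambda>i. ?e i - ?f i)\<bar>"
    using quad_form_polarize(1)[of n a ?e ?f, OF sym] by linarith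
  also have "\<dots> \<le> s * sq_norm n (\<lambda>i. ?e i + ?f i) + s * sq_norm n (\<lambda>i. ?e i - ?f i)"
    using supp by (intro add_mono s) auto
  also have "\<dots> = s * (2 * sq_norm n ?e + 2 * sq_norm n ?f)"
    by (simp add: sq_norm_def power2_sum power2_diff sum.distrib sum_subtractf algebra_simps flip: sum_distrib_left)
  also have "\<dots> = 2 * s * (t\<^sup>2 * sq_norm n e + sq_norm n f / t\<^sup>2)"
    using sq_norm_scale[of n "1/t" f] by (simp add: sq_norm_scale power_divide algebra_simps)
  finally show ?thesis by simp
qed

text \<open>A vector supported on at most \<open>\<kappa>\<close> coordinates is rounded to the lattice of mesh \<open>1 / (4 \<surd>\<kappa>)\<close>;
  the supremum of the form on the support then absorbs the rounding error.\<close>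

lemma sparse_quad_form_bound:
  fixes a :: "nat \<Rightarrow> nat \<Rightarrow> real"
  assumes sym: "\<And>i j. i < n \<Longrightarrow> j < n \<Longrightarrow> a i j = a j i" and k: "\<kappa> > 0" and u: "u > 0"
    and net: "\<And>z. z \<in> lattice_ball n (21 * \<kappa>) \<Longrightarrow> \<bar>quad_form n a (\<lambda>i. real_of_int (z i)) (\<lambda>i. real_of_int (z i))\<bar> \<le> u * (21 * \<kappa>)"
    and J: "J \<subseteq> {..<n}" "real (card J) \<le> \<kappa>" and x: "\<And>i. i \<notin> J \<Longrightarrow> x i = 0"
  shows "\<bar>quad_form n a x x\<bar> \<le> 2 * u * sq_norm n x"
proof -
  \<comment> \<open>The supremum over the unit ball of one support. The rounding argument bounds it
    in terms of itself, so its finiteness has to be known first.\<close>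
  define X where "X = {\<bar>quad_form n a v v\<bar> |v. (\<forall>i. i \<notin> J \<longrightarrow> v i = 0) \<and> sq_norm n v \<le> 1}"
  define s where "s = Sup X"
  have ne: "X \<noteq> {}" unfolding X_def by (auto intro!: exI[of _ "\<lambda>_. 0"] simp: sq_norm_def)
  have bdd: "bdd_above X"
  proof (rule bdd_aboveI)
    fix y assume "y \<in> X"
    then obtain v where v: "y = \<bar>quad_form n a v v\<bar>" "sq_norm n v \<le> 1" unfolding X_def by auto
    define B where "B = (\<Sum>i<n. \<Sum>j<n. \<bar>a i j\<bar>)"
    have "quad_form n a v v \<le> B * sq_norm n v"
      using quad_form_diff_le[of n a v "\<lambda>_ _. 0"] by (simp add: quad_form_def B_def)
    moreover have "- quad_form n a v v \<le> B * sq_norm n v"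
      using quad_form_diff_le[of n "\<lambda>i j. - a i j" v "\<lambda>_ _. 0"] by (simp add: quad_form_def B_def sum_negf)
    moreover have "B * sq_norm n v \<le> B * 1" using v(2) by (intro mult_left_mono) (auto simp: B_def intro!: sum_nonneg)
    ultimately show "y \<le> B" unfolding v(1) by linarith
  qed
  have sX: "\<bar>quad_form n a v v\<bar> \<le> s" if "\<And>i. i \<notin> J \<Longrightarrow> v i = 0" "sq_norm n v \<le> 1" for v
    unfolding s_def by (rule cSup_upper[OF _ bdd]) (use that in \<open>auto simp: X_def\<close>)
  have s0: "s \<ge> 0" using sX[of "\<lambda>_. 0"] by (simp add: sq_norm_def quad_form_def)
  have sgen: "\<bar>quad_form n a v v\<bar> \<le> s * sq_norm n v" if v: "\<And>i. i \<notin> J \<Longrightarrow> v i = 0" for v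
  proof (cases "sq_norm n v = 0")
    case True
    hence "v i = 0" if "i < n" for i using that by (simp add: sq_norm_def sum_nonneg_eq_0_iff)
    hence "quad_form n a v v = 0" by (simp add: quad_form_def)
    thus ?thesis using True by simp
  next
    case False
    hence pos: "sq_norm n v > 0" using sq_norm_nonneg[of n v] by linarith
    define c where "c = 1 / sqrt (sq_norm n v)"
    have c: "c\<^sup>2 = 1 / sq_norm n v" using pos by (simp add: c_def power_divide)
    have "\<bar>quad_form n a (\<lambda>i. c * v i) (\<lambda>i. c * v i)\<bar> \<le> s"
      using v pos by (intro sX) (auto simp: sq_norm_scale c)
    thus ?thesis using pos by (simp add: quad_form_scale c abs_mult field_simps)
  qed
  \<comment> \<open>The mesh is 1 / \<tau>; rounding at most \<kappa> coordinates costs a squared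
    norm of at most \<kappa> / (2 * \<tau>)^2 = 1 / 64.\<close>
  define \<tau> where "\<tau> = 4 * sqrt \<kappa>"
  have \<tau>: "\<tau> > 0" "\<tau>\<^sup>2 = 16 * \<kappa>" using k by (auto simp: \<tau>_def power_mult_distrib)
  \<comment> \<open>21 / 16 bounds the squared norm of the rounded vector \<open>y\<close>, and
    \<tau>^2 * 21 / 16 is the radius 21 * \<kappa> of the net. The second summand comes from the
    rounding error v - y paired with v + y.\<close>
  have step: "\<bar>quad_form n a v v\<bar> \<le> 21 / 16 * u + 27 / 100 * s" if v: "\<And>i. i \<notin> J \<Longrightarrow> v i = 0" "sq_norm n v \<le> 1" for v
  proof -
    define z where "z = (\<lambda>i. if i < n then round (\<tau> * v i) else undefined)"
    define y where "y i = (if i < n then real_of_int (z i) / \<tau> else 0)" for i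
    define e where "e i = v i - y i" for i
    define f where "f i = v i + y i" for i
    have y0: "y i = 0" if "i \<notin> J" for i using v(1)[OF that] by (simp add: y_def z_def)
    have ei: "(e i)\<^sup>2 \<le> (1 / (2 * \<tau>))\<^sup>2" if "i < n" for i
    proof -
      have "\<bar>\<tau> * v i - real_of_int (z i)\<bar> \<le> 1 / 2"
        using of_int_round_abs_le[of "\<tau> * v i"] that by (simp add: z_def abs_minus_commute)
      moreover have "\<tau> * v i - real_of_int (z i) = \<tau> * e i" using that \<tau> by (simp add: e_def y_def field_simps)
      ultimately have "\<bar>e i\<bar> \<le> 1 / (2 * \<tau>)" using \<tau>(1) by (simp add: abs_mult field_simps)
      thus ?thesis by (metis abs_ge_zero power2_abs power_mono)
    qed
    have "sq_norm n e = (\<Sum>i\<in>J. (e i)\<^sup>2)"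
      unfolding sq_norm_def using J v(1) y0 by (intro sum.mono_neutral_right) (auto simp: e_def)
    also have "\<dots> \<le> (\<Sum>i\<in>J. (1 / (2 * \<tau>))\<^sup>2)" using J by (intro sum_mono ei) auto
    also have "\<dots> = card J / (64 * \<kappa>)" using \<tau> by (simp add: power_divide power_mult_distrib)
    also have "\<dots> \<le> 1 / 64" using J k by (simp add: field_simps)
    finally have e: "sq_norm n e \<le> 1 / 64" .
    have "sq_norm n (\<lambda>i. v i + - e i) \<le> (1 + 1 / 8) * sq_norm n v + (1 + 1 / (1 / 8)) * sq_norm n (\<lambda>i. - e i)"
      by (rule sq_norm_sum_le) simp
    moreover have "(\<lambda>i. v i + - e i) = y" by (auto simp: e_def)
    moreover have ne: "sq_norm n (\<lambda>i. - e i) = sq_norm n e" by (simp add: sq_norm_def)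
    ultimately have ysq: "sq_norm n y \<le> 21 / 16" using e v(2) by simp
    have "sq_norm n (\<lambda>i. 2 * v i + - e i) \<le> (1 + 1 / 16) * sq_norm n (\<lambda>i. 2 * v i) + (1 + 1 / (1 / 16)) * sq_norm n (\<lambda>i. - e i)"
      by (rule sq_norm_sum_le) simp
    moreover have "(\<lambda>i. 2 * v i + - e i) = f" by (auto simp: e_def f_def)
    ultimately have fsq: "sq_norm n f \<le> 46 / 10" using e v(2) ne by (simp add: sq_norm_scale)
    have zsq: "(\<Sum>i<n. (real_of_int (z i))\<^sup>2) = \<tau>\<^sup>2 * sq_norm n y"
      using \<tau>(1) by (simp add: sq_norm_def y_def power_divide flip: sum_divide_distrib)
    also have "\<dots> \<le> \<tau>\<^sup>2 * (21 / 16)" using ysq by (intro mult_left_mono) auto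
    finally have zR: "(\<Sum>i<n. (real_of_int (z i))\<^sup>2) \<le> 21 * \<kappa>" using \<tau> by simp
    have "z \<in> lattice_ball n (21 * \<kappa>)"
      unfolding lattice_ball_def mem_Collect_eq
    proof (intro conjI zR PiE_I)
      fix i assume i: "i \<in> {..<n}"
      have "(real_of_int (z i))\<^sup>2 \<le> (\<Sum>i<n. (real_of_int (z i))\<^sup>2)" using i by (intro member_le_sum) auto
      \<comment> \<open>An integer is in modulus at most its square, so the bound on the squared
        norm also puts \<open>z\<close> into the box.\<close>
      moreover have "\<bar>z i\<bar> \<le> (z i)\<^sup>2"
      proof (cases "z i = 0")
        case False
        hence "\<bar>z i\<bar> * 1 \<le> \<bar>z i\<bar> * \<bar>z i\<bar>" by (intro mult_left_mono) auto
        thus ?thesis by (simp add: power2_eq_square flip: abs_mult)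
      qed simp
      ultimately have "real_of_int \<bar>z i\<bar> \<le> 21 * \<kappa>" using zR by (metis of_int_le_iff of_int_power order_trans)
      hence "\<bar>z i\<bar> \<le> \<lceil>21 * \<kappa>\<rceil>" by linarith
      thus "z i \<in> {- \<lceil>21 * \<kappa>\<rceil>..\<lceil>21 * \<kappa>\<rceil>}" by auto
    qed (auto simp: z_def)
    from net[OF this] have "\<bar>quad_form n a (\<lambda>i. real_of_int (z i)) (\<lambda>i. real_of_int (z i))\<bar> \<le> u * (21 * \<kappa>)" .
    moreover have "quad_form n a (\<lambda>i. real_of_int (z i)) (\<lambda>i. real_of_int (z i)) = \<tau>\<^sup>2 * quad_form n a y y"
      using \<tau>(1) by (subst quad_form_scale[symmetric]) (auto simp: quad_form_def y_def intro!: sum.cong)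
    ultimately have qy: "\<bar>quad_form n a y y\<bar> \<le> 21 / 16 * u" using \<tau> k by (simp add: abs_mult)
    \<comment> \<open>The scaling 4 balances the squared norms, at most 1 / 64 for \<open>e\<close>
      and 4.6 for \<open>f\<close>.\<close>
    have "\<bar>quad_form n a e f\<bar> \<le> s / 2 * (4\<^sup>2 * sq_norm n e + sq_norm n f / 4\<^sup>2)"
      by (rule bilinear_bound[of n a 4 J s e f, OF sym]) (use sgen v(1) y0 in \<open>auto simp: e_def f_def\<close>)
    also have "\<dots> \<le> s / 2 * (54 / 100)" using e fsq s0 by (intro mult_left_mono) auto
    finally have "\<bar>quad_form n a e f\<bar> \<le> 27 / 100 * s" by simp
    moreover have "quad_form n a v v - quad_form n a y y = quad_form n a e f"
      using quad_form_polarize(2)[of n a v y, OF sym] by (simp add: e_def[abs_def] f_def[abs_def])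
    ultimately show ?thesis using qy by linarith
  qed
  \<comment> \<open>Since 27 / 100 is below 1, the inequality for the supremum closes, and (21 / 16)
    / (73 / 100) is less than 2.\<close>
  have "s \<le> 21 / 16 * u + 27 / 100 * s"
    unfolding s_def by (rule cSup_least[OF ne]) (use step in \<open>auto simp: X_def s_def\<close>)
  hence "s \<le> 2 * u" using u by simp
  hence "s * sq_norm n x \<le> 2 * u * sq_norm n x" by (intro mult_right_mono) auto
  moreover have "\<bar>quad_form n a x x\<bar> \<le> s * sq_norm n x" by (rule sgen) (rule x)
  ultimately show ?thesis by linarith
qed

section \<open>Uniform bounds for the GOE quadratic form\<close>

context GOE
begin

text \<open>At a point of squared norm at most R = 21 * \<kappa> the form has variance at most 2 *
  R^2 / n, so exceeding u * R has probability of order exp (- n * u^2 / 4), whatever R is.\<close>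

definition net_event :: "real \<Rightarrow> real \<Rightarrow> 'a set" where
  "net_event \<kappa> u = {\<omega> \<in> space M. \<forall>z\<in>lattice_ball n (21 * \<kappa>).
      \<bar>quad_form n (\<lambda>i j. A \<omega> $$ (i,j)) (\<lambda>i. real_of_int (z i)) (\<lambda>i. real_of_int (z i))\<bar> \<le> u * (21 * \<kappa>)}"

lemma quad_form_eq_lin_form: "quad_form n (\<lambda>i j. A \<omega> $$ (i,j)) x x = lin_form n (\<lambda>i j. x i * x j) (A \<omega>)"
  by (simp add: quad_form_def lin_form_def mult_ac)

lemma net_event_sets [measurable]: "net_event \<kappa> u \<in> events"
  unfolding net_event_def quad_form_eq_lin_form
proof (rule sets.sets_Collect_finite_All[OF _ finite_lattice_ball])
  fix z
  show "{\<omega> \<in> space M. \<bar>lin_form n (\<lambda>i j. real_of_int (z i) * real_of_int (z j)) (A \<omega>)\<bar> \<le> u * (21 * \<kappa>)} \<in> events"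
    by measurable
qed

text \<open>A union bound in which the lattice count has to be beaten by the tail exponent n * u^2 /
  4. The parameter \<open>b\<close> is free: it will be 1 for \<kappa> = n and large when \<kappa>
  is a small fraction of n.\<close>

lemma prob_net_event:
  assumes b: "b \<ge> 1" and k: "\<kappa> > 0" and u: "u > 0"
  shows "prob (space M - net_event \<kappa> u) \<le> 2 * exp (b * (21 * \<kappa>) + 4 * real n * exp (- b) - real n * u\<^sup>2 / 4)"
proof -
  define R where "R = 21 * \<kappa>"
  have R: "R > 0" using k by (simp add: R_def)
  define Bz where "Bz z = {\<omega> \<in> space M. u * R \<le> \<bar>lin_form n (\<lambda>i j. real_of_int (z i) * real_of_int (z j)) (A \<omega>)\<bar>}" for z
  have Bz: "prob (Bz z) \<le> 2 * exp (- (real n * u\<^sup>2 / 4))" if "z \<in> lattice_ball n R" for z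
  proof -
    have "(\<Sum>i<n. \<Sum>j<n. (real_of_int (z i) * real_of_int (z j))\<^sup>2) = (\<Sum>i<n. (real_of_int (z i))\<^sup>2)\<^sup>2"
      by (simp add: sum_product power2_eq_square mult_ac)
    also have "\<dots> \<le> R\<^sup>2"
    proof (rule power_mono)
      show "(\<Sum>i<n. (real_of_int (z i))\<^sup>2) \<le> R" using that unfolding lattice_ball_def by blast
    qed (simp add: sum_nonneg)
    finally have V: "(\<Sum>i<n. \<Sum>j<n. (real_of_int (z i) * real_of_int (z j))\<^sup>2) \<le> R\<^sup>2" .
    have "prob (Bz z) \<le> 2 * exp (- (real n * (u * R)\<^sup>2 / (4 * R\<^sup>2)))"
      unfolding Bz_def
    proof (rule lin_form_tail[OF _ V])
      show "real_of_int (z i) * real_of_int (z j) = real_of_int (z j) * real_of_int (z i)" for i j by (rule mult.commute)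
    qed (use u R in auto)
    also have "real n * (u * R)\<^sup>2 / (4 * R\<^sup>2) = real n * u\<^sup>2 / 4" using R by (simp add: power_mult_distrib)
    finally show ?thesis .
  qed
  have "prob (space M - net_event \<kappa> u) \<le> prob (\<Union>z\<in>lattice_ball n R. Bz z)"
  proof (rule finite_measure_mono)
    show "space M - net_event \<kappa> u \<subseteq> (\<Union>z\<in>lattice_ball n R. Bz z)"
      unfolding net_event_def Bz_def R_def quad_form_eq_lin_form by (auto simp: not_le intro: less_imp_le)
    show "(\<Union>z\<in>lattice_ball n R. Bz z) \<in> events"
      unfolding Bz_def by (intro sets.finite_UN finite_lattice_ball) measurable
  qed
  also have "\<dots> \<le> (\<Sum>z\<in>lattice_ball n R. prob (Bz z))"
    by (intro finite_measure_subadditive_finite finite_lattice_ball) (auto simp: Bz_def)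
  also have "\<dots> \<le> (\<Sum>z\<in>lattice_ball n R. 2 * exp (- (real n * u\<^sup>2 / 4)))" by (intro sum_mono Bz)
  also have "\<dots> = real (card (lattice_ball n R)) * (2 * exp (- (real n * u\<^sup>2 / 4)))" by simp
  also have "\<dots> \<le> exp (b * R + 4 * real n * exp (- b)) * (2 * exp (- (real n * u\<^sup>2 / 4)))"
    by (intro mult_right_mono card_lattice_ball_le b R) auto
  also have "\<dots> = 2 * exp (b * R + 4 * real n * exp (- b) - real n * u\<^sup>2 / 4)"
    unfolding exp_diff by (simp only: exp_minus divide_inverse mult_ac)
  finally show ?thesis by (simp add: R_def)
qed

lemma net_eventD:
  assumes "\<omega> \<in> net_event \<kappa> u" "\<kappa> > 0" "u > 0" "J \<subseteq> {..<n}" "real (card J) \<le> \<kappa>" "\<And>i. i \<notin> J \<Longrightarrow> x i = 0"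
  shows "\<bar>quad_form n (\<lambda>i j. A \<omega> $$ (i,j)) x x\<bar> \<le> 2 * u * sq_norm n x"
  by (rule sparse_quad_form_bound[of n _ \<kappa> u J]) (use assms A_sym in \<open>auto simp: net_event_def\<close>)

end

section \<open>Deterministic eigenvalue estimates\<close>

definition mat_vec :: "nat \<Rightarrow> (nat \<Rightarrow> nat \<Rightarrow> real) \<Rightarrow> (nat \<Rightarrow> real) \<Rightarrow> nat \<Rightarrow> real" where
  "mat_vec n a x i = (\<Sum>j<n. a i j * x j)"

lemma quad_form_mat_vec: "quad_form n a x y = (\<Sum>i<n. x i * mat_vec n a y i)"
  by (simp add: quad_form_def mat_vec_def sum_distrib_left mult_ac)

lemma quad_form_sym:
  assumes "\<And>i j. i < n \<Longrightarrow> j < n \<Longrightarrow> a i j = a j i"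
  shows "quad_form n a y x = quad_form n a x y"
  unfolding quad_form_def by (subst sum.swap) (intro sum.cong refl, use assms in auto)

lemma quad_form_add_left: "quad_form n a (\<lambda>i. x i + y i) z = quad_form n a x z + quad_form n a y z"
  and quad_form_add_right: "quad_form n a z (\<lambda>i. x i + y i) = quad_form n a z x + quad_form n a z y"
  and quad_form_diff_left: "quad_form n a (\<lambda>i. x i - y i) z = quad_form n a x z - quad_form n a y z"
  and quad_form_diff_right: "quad_form n a z (\<lambda>i. x i - y i) = quad_form n a z x - quad_form n a z y"
  and quad_form_scale_left: "quad_form n a (\<lambda>i. c * x i) z = c * quad_form n a x z"
  and quad_form_scale_right: "quad_form n a z (\<lambda>i. c * x i) = c * quad_form n a z x"
  by (simp_all add: quad_form_def algebra_simps sum.distrib sum_subtractf sum_distrib_left)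

text \<open>The image is tested against its own restriction \<open>y\<close> to \<open>T\<close>;
  with the scaling 1 / sqrt s, half of |y|^2 is absorbed on the left.\<close>

lemma block_norm_bound:
  assumes sym: "\<And>i j. i < n \<Longrightarrow> j < n \<Longrightarrow> a i j = a j i" and s: "s > 0"
    and bd: "\<And>v. (\<And>i. i \<notin> J \<Longrightarrow> v i = 0) \<Longrightarrow> \<bar>quad_form n a v v\<bar> \<le> s * sq_norm n v"
    and p: "\<And>i. i \<notin> J \<Longrightarrow> p i = 0" and T: "T \<subseteq> J" "T \<subseteq> {..<n}"
  shows "(\<Sum>i\<in>T. (mat_vec n a p i)\<^sup>2) \<le> s\<^sup>2 * sq_norm n p"
proof -
  define y where "y i = (if i \<in> T then mat_vec n a p i else 0)" for i
  have yy: "sq_norm n y = (\<Sum>i\<in>T. (mat_vec n a p i)\<^sup>2)"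
    unfolding sq_norm_def using T by (intro sum.mono_neutral_cong_right) (auto simp: y_def)
  have "quad_form n a y p = (\<Sum>i\<in>T. (mat_vec n a p i)\<^sup>2)"
    unfolding quad_form_mat_vec using T by (intro sum.mono_neutral_cong_right) (auto simp: y_def power2_eq_square)
  hence "sq_norm n y \<le> \<bar>quad_form n a y p\<bar>" using yy by simp
  also have "\<dots> \<le> s / 2 * ((1 / sqrt s)\<^sup>2 * sq_norm n y + sq_norm n p / (1 / sqrt s)\<^sup>2)"
    by (rule bilinear_bound[of n a "1 / sqrt s" J s y p, OF sym]) (use s bd p T in \<open>auto simp: y_def\<close>)
  also have "\<dots> = sq_norm n y / 2 + s\<^sup>2 * sq_norm n p / 2"
    using s by (simp add: power_divide field_simps power2_eq_square)
  finally show ?thesis using yy by simp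
qed

section \<open>The Schur complement in variational form\<close>

locale schur_split =
  fixes n :: nat and a :: "nat \<Rightarrow> nat \<Rightarrow> real" and d :: "nat \<Rightarrow> real" and S :: "nat set"
  assumes sym: "\<And>i j. i < n \<Longrightarrow> j < n \<Longrightarrow> a i j = a j i" and S: "S \<subseteq> {..<n}"
begin

definition lap :: "nat \<Rightarrow> nat \<Rightarrow> real" where
  "lap i j = (if i = j then d i else 0) - a i j"

text \<open>For \<open>p\<close> on \<open>S\<close>, the image under the block from
  \<open>S\<close> to its complement; \<open>lap\<close> contains this block with the opposite
  sign.\<close>

definition cross :: "(nat \<Rightarrow> real) \<Rightarrow> nat \<Rightarrow> real" where
  "cross p i = (if i < n \<and> i \<notin> S then mat_vec n a p i else 0)"

lemma lap_sym: "i < n \<Longrightarrow> j < n \<Longrightarrow> lap i j = lap j i"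
  using sym by (auto simp: lap_def)

lemma quad_form_lap: "quad_form n lap x y = (\<Sum>i<n. d i * x i * y i) - quad_form n a x y"
proof -
  have "quad_form n lap x y = (\<Sum>i<n. \<Sum>j<n. (if i = j then d i * x i * y i else 0) - a i j * x i * y j)"
    unfolding quad_form_def lap_def by (intro sum.cong refl) (auto simp: algebra_simps)
  thus ?thesis by (simp add: sum_subtractf quad_form_def)
qed

text \<open>Exact elimination would use the inverse of l minus the block of \<open>lap\<close> off
  \<open>S\<close>. Here 1 / l stands in for that inverse, so completing the square leaves residual
  terms in \<open>lap\<close>; \<open>r\<close> is the deviation of \<open>q\<close> from - v /
  l.\<close>

lemma schur_identity:
  assumes p: "\<And>i. i \<notin> S \<Longrightarrow> p i = 0" and q: "\<And>i. i \<in> S \<Longrightarrow> q i = 0" and l: "l \<noteq> 0"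
  defines "v \<equiv> cross p" and "x \<equiv> \<lambda>i. p i + q i"
  defines "r \<equiv> \<lambda>i. q i + 1 / l * v i"
  shows "quad_form n lap x x - l * sq_norm n x = (\<Sum>i\<in>S. (d i - l) * (p i)\<^sup>2) - quad_form n a p p
     + sq_norm n v / l + quad_form n lap v v / l\<^sup>2 - 2 / l * quad_form n lap r v
     + (quad_form n lap r r - l * sq_norm n r)"
proof -
  define dot where "dot y z = (\<Sum>i<n. y i * z i)" for y z :: "nat \<Rightarrow> real"
  have dots: "sq_norm n y = dot y y" for y by (simp add: sq_norm_def dot_def power2_eq_square)
  have dlin: "dot (\<lambda>i. y i + w i) z = dot y z + dot w z" "dot z (\<lambda>i. y i + w i) = dot z y + dot z w"
     "dot (\<lambda>i. c * y i) z = c * dot y z" "dot z (\<lambda>i. c * y i) = c * dot z y" for y z w c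
    by (simp_all add: dot_def sum.distrib sum_distrib_left algebra_simps)
  have dsym: "dot y z = dot z y" for y z by (simp add: dot_def mult.commute)
  have pp: "quad_form n lap p p - l * dot p p = (\<Sum>i\<in>S. (d i - l) * (p i)\<^sup>2) - quad_form n a p p"
  proof -
    have "(\<Sum>i\<in>S. (d i - l) * (p i)\<^sup>2) = (\<Sum>i<n. (d i - l) * (p i)\<^sup>2)"
      using S p by (intro sum.mono_neutral_left) auto
    thus ?thesis by (simp add: quad_form_lap dot_def sum_distrib_left sum_subtractf algebra_simps power2_eq_square)
  qed
  have "(\<Sum>i<n. d i * p i * q i) = 0" using p q by (intro sum.neutral) auto
  moreover have "quad_form n a p q = dot q v"
  proof -
    have "quad_form n a p q = quad_form n a q p" by (rule quad_form_sym[OF sym])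
    also have "\<dots> = dot q v" unfolding quad_form_mat_vec dot_def v_def
      by (intro sum.cong) (use q in \<open>auto simp: cross_def\<close>)
    finally show "quad_form n a p q = dot q v" .
  qed
  ultimately have pq: "quad_form n lap p q = - dot q v" by (simp add: quad_form_lap)
  have qp: "quad_form n lap q p = - dot q v" using pq quad_form_sym[of n lap p q, OF lap_sym] by simp
  have dpq: "dot p q = 0" unfolding dot_def using p q by (intro sum.neutral) auto
  have vr: "quad_form n lap v q = quad_form n lap q v" by (rule quad_form_sym[OF lap_sym])
  have xx: "quad_form n lap x x - l * dot x x = (quad_form n lap p p - l * dot p p) - 2 * dot q v + quad_form n lap q q - l * dot q q"
    unfolding x_def by (simp add: quad_form_add_left quad_form_add_right dlin pq qp dpq dsym[of q p] algebra_simps)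
  define c where "c = 1 / l"
  have rr: "quad_form n lap r r = quad_form n lap q q + 2 * c * quad_form n lap q v + quad_form n lap v v * c\<^sup>2"
    "dot r r = dot q q + 2 * c * dot q v + dot v v * c\<^sup>2"
    "quad_form n lap r v = quad_form n lap q v + quad_form n lap v v * c"
    unfolding r_def c_def[symmetric]
    by (simp_all add: quad_form_add_left quad_form_add_right quad_form_scale_left quad_form_scale_right
        dlin vr dsym[of v q] power2_eq_square algebra_simps)
  show ?thesis
    unfolding dots xx pp rr c_def using l by (simp add: field_simps power2_eq_square)
qed

text \<open>The block off \<open>S\<close> lies below \<open>l\<close> by a margin \<mu>. This
  margin absorbs the mixed term between \<open>r\<close> and the image of \<open>v\<close>, at the
  cost \<gamma>2 / (l^2 * \<mu>).\<close>

lemma schur_upper: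
  assumes l: "l > 0" and mu: "\<mu> > 0" and nu: "\<nu> + \<mu> \<le> l"
    and H1: "\<And>p. (\<And>i. i \<notin> S \<Longrightarrow> p i = 0) \<Longrightarrow> \<bar>quad_form n a p p\<bar> \<le> \<alpha> * sq_norm n p"
    and H2: "\<And>p. (\<And>i. i \<notin> S \<Longrightarrow> p i = 0) \<Longrightarrow> \<bar>sq_norm n (cross p) - sq_norm n p\<bar> \<le> \<beta> * sq_norm n p"
    and H3: "\<And>p. (\<And>i. i \<notin> S \<Longrightarrow> p i = 0) \<Longrightarrow> \<bar>quad_form n lap (cross p) (cross p)\<bar> \<le> \<gamma>1 * sq_norm n p"
    and H4: "\<And>p. (\<And>i. i \<notin> S \<Longrightarrow> p i = 0) \<Longrightarrow> sq_norm n (mat_vec n lap (cross p)) \<le> \<gamma>2 * sq_norm n p"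
    and H5: "\<And>r. (\<And>i. i \<in> S \<Longrightarrow> r i = 0) \<Longrightarrow> quad_form n lap r r \<le> \<nu> * sq_norm n r"
  shows "quad_form n lap x x - l * sq_norm n x
     \<le> (\<Sum>i\<in>S. (d i + (\<alpha> + (1 + \<beta>) / l + \<gamma>1 / l\<^sup>2 + \<gamma>2 / (l\<^sup>2 * \<mu>)) - l) * (x i)\<^sup>2)"
proof -
  define p where "p i = (if i \<in> S then x i else 0)" for i
  define q where "q i = (if i \<in> S then 0 else x i)" for i
  define v where "v = cross p"
  define r where "r = (\<lambda>i. q i + 1 / l * v i)"
  define w where "w = mat_vec n lap v"
  have p: "\<And>i. i \<notin> S \<Longrightarrow> p i = 0" and q: "\<And>i. i \<in> S \<Longrightarrow> q i = 0" by (auto simp: p_def q_def)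
  have x: "x = (\<lambda>i. p i + q i)" by (auto simp: p_def q_def)
  have r: "\<And>i. i \<in> S \<Longrightarrow> r i = 0" by (auto simp: r_def q_def v_def cross_def)
  have id: "quad_form n lap x x - l * sq_norm n x = (\<Sum>i\<in>S. (d i - l) * (p i)\<^sup>2) - quad_form n a p p
     + sq_norm n v / l + quad_form n lap v v / l\<^sup>2 - 2 / l * quad_form n lap r v
     + (quad_form n lap r r - l * sq_norm n r)"
    unfolding x r_def v_def by (rule schur_identity[OF p q]) (use l in auto)
  \<comment> \<open>AM-GM in each coordinate, from the square of sqrt \<mu> * r + w / (l * sqrt
    \<mu>).\<close>
  have "- 2 / l * quad_form n lap r v - \<mu> * sq_norm n r \<le> sq_norm n w / (l\<^sup>2 * \<mu>)"
  proof -
    have "- 2 / l * (r i * w i) - \<mu> * (r i)\<^sup>2 \<le> (w i)\<^sup>2 / (l\<^sup>2 * \<mu>)" for i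
    proof -
      have "0 \<le> (sqrt \<mu> * r i + w i / (l * sqrt \<mu>))\<^sup>2" by simp
      also have "\<dots> = \<mu> * (r i)\<^sup>2 + (w i)\<^sup>2 / (l\<^sup>2 * \<mu>) + 2 / l * (r i * w i)"
      proof -
        have "2 * (sqrt \<mu> * r i) * (w i / (l * sqrt \<mu>)) = 2 / l * (r i * w i)" using mu by simp
        thus ?thesis using mu by (simp add: power2_sum power_mult_distrib power_divide)
      qed
      finally show ?thesis by simp
    qed
    hence "(\<Sum>i<n. - 2 / l * (r i * w i) - \<mu> * (r i)\<^sup>2) \<le> (\<Sum>i<n. (w i)\<^sup>2 / (l\<^sup>2 * \<mu>))" by (intro sum_mono) auto
    thus ?thesis unfolding quad_form_mat_vec w_def[symmetric] sq_norm_def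
      by (simp add: sum_subtractf sum_distrib_left sum_divide_distrib sum_negf)
  qed
  moreover have "quad_form n lap r r - l * sq_norm n r \<le> - \<mu> * sq_norm n r"
  proof -
    have "(\<nu> + \<mu>) * sq_norm n r \<le> l * sq_norm n r" using nu by (intro mult_right_mono) auto
    thus ?thesis using H5[of r, OF r] by (simp add: algebra_simps)
  qed
  moreover have "sq_norm n w / (l\<^sup>2 * \<mu>) \<le> \<gamma>2 * sq_norm n p / (l\<^sup>2 * \<mu>)"
    unfolding w_def v_def using H4[of p, OF p] mu by (intro divide_right_mono) auto
  moreover have "quad_form n lap v v / l\<^sup>2 \<le> \<gamma>1 * sq_norm n p / l\<^sup>2"
    using H3[of p, OF p] unfolding v_def by (intro divide_right_mono) auto
  moreover have "sq_norm n v / l \<le> (1 + \<beta>) * sq_norm n p / l"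
    using H2[of p, OF p] l unfolding v_def by (intro divide_right_mono) (auto simp: algebra_simps)
  moreover have "- quad_form n a p p \<le> \<alpha> * sq_norm n p" using H1[of p, OF p] by linarith
  ultimately have "quad_form n lap x x - l * sq_norm n x \<le> (\<Sum>i\<in>S. (d i - l) * (p i)\<^sup>2)
      + (\<alpha> * sq_norm n p + (1 + \<beta>) * sq_norm n p / l + \<gamma>1 * sq_norm n p / l\<^sup>2 + \<gamma>2 * sq_norm n p / (l\<^sup>2 * \<mu>))"
    unfolding id by linarith
  also have "\<dots> = (\<Sum>i\<in>S. (d i - l) * (p i)\<^sup>2) + (\<alpha> + (1 + \<beta>) / l + \<gamma>1 / l\<^sup>2 + \<gamma>2 / (l\<^sup>2 * \<mu>)) * sq_norm n p"
    by (simp add: distrib_right)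
  also have "sq_norm n p = (\<Sum>i\<in>S. (p i)\<^sup>2)"
    unfolding sq_norm_def using S p by (intro sum.mono_neutral_right) auto
  also have "(\<Sum>i\<in>S. (d i - l) * (p i)\<^sup>2) + (\<alpha> + (1 + \<beta>) / l + \<gamma>1 / l\<^sup>2 + \<gamma>2 / (l\<^sup>2 * \<mu>)) * (\<Sum>i\<in>S. (p i)\<^sup>2)
      = (\<Sum>i\<in>S. (d i + (\<alpha> + (1 + \<beta>) / l + \<gamma>1 / l\<^sup>2 + \<gamma>2 / (l\<^sup>2 * \<mu>)) - l) * (p i)\<^sup>2)"
    unfolding sum_distrib_left sum.distrib[symmetric] by (intro sum.cong refl) (simp only: distrib_right left_diff_distrib add_ac diff_conv_add_uminus)
  also have "\<dots> = (\<Sum>i\<in>S. (d i + (\<alpha> + (1 + \<beta>) / l + \<gamma>1 / l\<^sup>2 + \<gamma>2 / (l\<^sup>2 * \<mu>)) - l) * (x i)\<^sup>2)"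
    by (intro sum.cong) (auto simp: p_def)
  finally show ?thesis .
qed

text \<open>For a lower bound a trial vector suffices. This one makes the deviation \<open>r\<close>
  of \<open>schur_identity\<close> vanish, which leaves only terms in \<open>p\<close> and
  \<open>cross p\<close>.\<close>

lemma schur_lower:
  assumes l: "l > 0"
    and H1: "\<And>p. (\<And>i. i \<notin> S \<Longrightarrow> p i = 0) \<Longrightarrow> \<bar>quad_form n a p p\<bar> \<le> \<alpha> * sq_norm n p"
    and H2: "\<And>p. (\<And>i. i \<notin> S \<Longrightarrow> p i = 0) \<Longrightarrow> \<bar>sq_norm n (cross p) - sq_norm n p\<bar> \<le> \<beta> * sq_norm n p"
    and H3: "\<And>p. (\<And>i. i \<notin> S \<Longrightarrow> p i = 0) \<Longrightarrow> \<bar>quad_form n lap (cross p) (cross p)\<bar> \<le> \<gamma>1 * sq_norm n p"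
    and p: "\<And>i. i \<notin> S \<Longrightarrow> p i = 0"
  defines "x \<equiv> \<lambda>i. p i - 1 / l * cross p i"
  shows "quad_form n lap x x - l * sq_norm n x
     \<ge> (\<Sum>i\<in>S. (d i + ((1 - \<beta>) / l - \<alpha> - \<gamma>1 / l\<^sup>2) - l) * (p i)\<^sup>2)"
proof -
  define v where "v = cross p"
  define q where "q i = - 1 / l * v i" for i
  have q: "\<And>i. i \<in> S \<Longrightarrow> q i = 0" by (auto simp: q_def v_def cross_def)
  have x: "x = (\<lambda>i. p i + q i)" by (auto simp: x_def q_def v_def)
  have r: "(\<lambda>i. q i + 1 / l * cross p i) = (\<lambda>_. 0)" by (auto simp: q_def v_def)
  have z: "quad_form n lap (\<lambda>_. 0) y = 0" "sq_norm n (\<lambda>_. 0) = 0" for y by (auto simp: quad_form_def sq_norm_def)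
  have id: "quad_form n lap x x - l * sq_norm n x = (\<Sum>i\<in>S. (d i - l) * (p i)\<^sup>2) - quad_form n a p p
     + sq_norm n v / l + quad_form n lap v v / l\<^sup>2"
    using schur_identity[of p q l, OF p q] l unfolding x r z v_def by simp
  have "quad_form n lap v v / l\<^sup>2 \<ge> (- \<gamma>1 * sq_norm n p) / l\<^sup>2"
    using H3[of p, OF p] unfolding v_def by (intro divide_right_mono) auto
  moreover have "sq_norm n v / l \<ge> (1 - \<beta>) * sq_norm n p / l"
    using H2[of p, OF p] l unfolding v_def by (intro divide_right_mono) (auto simp: algebra_simps)
  moreover have "- quad_form n a p p \<ge> - \<alpha> * sq_norm n p" using H1[of p, OF p] by (simp add: abs_le_iff)
  ultimately have "quad_form n lap x x - l * sq_norm n x \<ge> (\<Sum>i\<in>S. (d i - l) * (p i)\<^sup>2)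
      + (- \<alpha> * sq_norm n p + (1 - \<beta>) * sq_norm n p / l + (- \<gamma>1 * sq_norm n p) / l\<^sup>2)"
    unfolding id by linarith
  also have "(\<Sum>i\<in>S. (d i - l) * (p i)\<^sup>2)
      + (- \<alpha> * sq_norm n p + (1 - \<beta>) * sq_norm n p / l + (- \<gamma>1 * sq_norm n p) / l\<^sup>2)
      = (\<Sum>i\<in>S. (d i - l) * (p i)\<^sup>2) + ((1 - \<beta>) / l - \<alpha> - \<gamma>1 / l\<^sup>2) * sq_norm n p"
    by (simp add: left_diff_distrib)
  also have "sq_norm n p = (\<Sum>i\<in>S. (p i)\<^sup>2)"
    unfolding sq_norm_def using S p by (intro sum.mono_neutral_right) auto
  also have "(\<Sum>i\<in>S. (d i - l) * (p i)\<^sup>2) + ((1 - \<beta>) / l - \<alpha> - \<gamma>1 / l\<^sup>2) * (\<Sum>i\<in>S. (p i)\<^sup>2)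
      = (\<Sum>i\<in>S. (d i + ((1 - \<beta>) / l - \<alpha> - \<gamma>1 / l\<^sup>2) - l) * (p i)\<^sup>2)"
    unfolding sum_distrib_left sum.distrib[symmetric] by (intro sum.cong refl) (simp only: distrib_right left_diff_distrib add_ac diff_conv_add_uminus)
  finally show ?thesis .
qed

text \<open>The Schur correction is nearly scalar: each of the two eigenvalues lies between
  \<open>d i + k0\<close> and \<open>d i + k1\<close> for its index, so the gap is off by at most
  \<open>k1 - k0\<close>. In that difference the main parts 1 / \<Lambda> and 1 / \<Lambda>' nearly
  cancel.\<close>

lemma top_eigenvalue_gap:
  fixes B :: "real mat"
  assumes B: "B \<in> carrier_mat n n" "transpose_mat B = B" and BL: "\<And>i j. i < n \<Longrightarrow> j < n \<Longrightarrow> B $$ (i,j) = lap i j"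
    and mu: "\<mu> > 0" and nu: "\<nu> + \<mu> \<le> \<Lambda>" and L: "1 \<le> \<Lambda>" "1 \<le> \<Lambda>'"
    and H1: "\<And>p. (\<And>i. i \<notin> S \<Longrightarrow> p i = 0) \<Longrightarrow> \<bar>quad_form n a p p\<bar> \<le> \<alpha> * sq_norm n p"
    and H2: "\<And>p. (\<And>i. i \<notin> S \<Longrightarrow> p i = 0) \<Longrightarrow> \<bar>sq_norm n (cross p) - sq_norm n p\<bar> \<le> \<beta> * sq_norm n p"
    and H3: "\<And>p. (\<And>i. i \<notin> S \<Longrightarrow> p i = 0) \<Longrightarrow> \<bar>quad_form n lap (cross p) (cross p)\<bar> \<le> \<gamma>1 * sq_norm n p"
    and H4: "\<And>p. (\<And>i. i \<notin> S \<Longrightarrow> p i = 0) \<Longrightarrow> sq_norm n (mat_vec n lap (cross p)) \<le> \<gamma>2 * sq_norm n p"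
    and H5: "\<And>r. (\<And>i. i \<in> S \<Longrightarrow> r i = 0) \<Longrightarrow> quad_form n lap r r \<le> \<nu> * sq_norm n r"
    and nn: "0 \<le> \<alpha>" "0 \<le> \<beta>" "\<beta> \<le> 1" "0 \<le> \<gamma>1" "0 \<le> \<gamma>2" and small: "\<alpha> + \<gamma>1 / \<Lambda>\<^sup>2 \<le> 1"
    and i: "i1 \<in> S" "i2 \<in> S" "i1 \<noteq> i2" and d: "\<Lambda> + 1 \<le> d i2" "d i2 \<le> d i1" "d i1 + 1 \<le> \<Lambda>'" "\<And>i. i \<in> S \<Longrightarrow> i \<noteq> i1 \<Longrightarrow> d i \<le> d i2"
  shows "\<bar>(ordered_eigenvalue 1 B - ordered_eigenvalue 2 B) - (d i1 - d i2)\<bar>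
    \<le> 2 * \<alpha> + (1 + \<beta>) / \<Lambda> - (1 - \<beta>) / \<Lambda>' + 2 * \<gamma>1 / \<Lambda>\<^sup>2 + \<gamma>2 / (\<Lambda>\<^sup>2 * \<mu>)"
proof -
  have n2: "n \<ge> 2"
  proof -
    have "card {i1,i2} \<le> card {..<n}" using i S by (intro card_mono) auto
    thus ?thesis using i by simp
  qed
  have BQ: "quad_form n (\<lambda>i j. B $$ (i,j)) x x = quad_form n lap x x" for x
    unfolding quad_form_def by (intro sum.cong refl) (use BL in auto)
  \<comment> \<open>\<open>k1\<close> bounds the correction from above for all \<open>l\<close> from
    \<Lambda> on, \<open>k0\<close> from below for \<open>l\<close> between \<Lambda> and
    \<Lambda>'. The margins of 1 in the hypotheses on \<open>d\<close>, with |k0| at most 1, keep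
    \<open>d i1 + k0\<close> and \<open>d i2 + k0\<close> in that range.\<close>
  define k1 where "k1 = \<alpha> + (1 + \<beta>) / \<Lambda> + \<gamma>1 / \<Lambda>\<^sup>2 + \<gamma>2 / (\<Lambda>\<^sup>2 * \<mu>)"
  define k0 where "k0 = (1 - \<beta>) / \<Lambda>' - \<alpha> - \<gamma>1 / \<Lambda>\<^sup>2"
  have k10: "k1 \<ge> 0" unfolding k1_def using nn L mu by (intro add_nonneg_nonneg) auto
  have "(1 - \<beta>) / \<Lambda>' \<le> 1 / \<Lambda>'" "1 / \<Lambda>' \<le> 1" "0 \<le> (1 - \<beta>) / \<Lambda>'" using nn L by (auto simp: divide_right_mono)
  moreover have "0 \<le> \<gamma>1 / \<Lambda>\<^sup>2" using nn by simp
  ultimately have k0: "- 1 \<le> k0" "k0 \<le> 1" unfolding k0_def using small nn by linarith+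
  have up: "quad_form n lap x x - l * sq_norm n x \<le> (\<Sum>i\<in>S. (d i + k1 - l) * (x i)\<^sup>2)" if l: "l \<ge> \<Lambda>" for l x
  proof -
    have l0: "l > 0" using l L by linarith
    have sq: "\<Lambda>\<^sup>2 \<le> l\<^sup>2" using l L by (intro power_mono) auto
    have "quad_form n lap x x - l * sq_norm n x
     \<le> (\<Sum>i\<in>S. (d i + (\<alpha> + (1 + \<beta>) / l + \<gamma>1 / l\<^sup>2 + \<gamma>2 / (l\<^sup>2 * \<mu>)) - l) * (x i)\<^sup>2)"
      by (rule schur_upper[OF l0 mu _ H1 H2 H3 H4 H5]) (use nu l in auto)
    also have "\<dots> \<le> (\<Sum>i\<in>S. (d i + k1 - l) * (x i)\<^sup>2)"
    proof (intro sum_mono mult_right_mono diff_right_mono add_left_mono)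
      have "(1 + \<beta>) / l \<le> (1 + \<beta>) / \<Lambda>" using nn L l by (intro divide_left_mono) auto
      moreover have "\<gamma>1 / l\<^sup>2 \<le> \<gamma>1 / \<Lambda>\<^sup>2" using nn L l0 sq by (intro divide_left_mono) auto
      moreover have "\<gamma>2 / (l\<^sup>2 * \<mu>) \<le> \<gamma>2 / (\<Lambda>\<^sup>2 * \<mu>)"
        using nn L l0 sq mu by (intro divide_left_mono mult_right_mono) auto
      ultimately show "\<alpha> + (1 + \<beta>) / l + \<gamma>1 / l\<^sup>2 + \<gamma>2 / (l\<^sup>2 * \<mu>) \<le> k1" unfolding k1_def by linarith
    qed auto
    finally show ?thesis .
  qed
  have low: "quad_form n lap (\<lambda>i. p i - 1 / l * cross p i) (\<lambda>i. p i - 1 / l * cross p i) - l * sq_norm n (\<lambda>i. p i - 1 / l * cross p i)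
      \<ge> (\<Sum>i\<in>S. (d i + k0 - l) * (p i)\<^sup>2)" if l: "\<Lambda> \<le> l" "l \<le> \<Lambda>'" and p: "\<And>i. i \<notin> S \<Longrightarrow> p i = 0" for l p
  proof -
    have l0: "l > 0" using l L by linarith
    have sq: "\<Lambda>\<^sup>2 \<le> l\<^sup>2" using l L by (intro power_mono) auto
    have "(\<Sum>i\<in>S. (d i + k0 - l) * (p i)\<^sup>2) \<le> (\<Sum>i\<in>S. (d i + ((1 - \<beta>) / l - \<alpha> - \<gamma>1 / l\<^sup>2) - l) * (p i)\<^sup>2)"
    proof (intro sum_mono mult_right_mono diff_right_mono add_left_mono)
      have "(1 - \<beta>) / \<Lambda>' \<le> (1 - \<beta>) / l" using nn L l l0 by (intro divide_left_mono) auto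
      moreover have "\<gamma>1 / l\<^sup>2 \<le> \<gamma>1 / \<Lambda>\<^sup>2" using nn L l0 sq by (intro divide_left_mono) auto
      ultimately show "k0 \<le> (1 - \<beta>) / l - \<alpha> - \<gamma>1 / l\<^sup>2" unfolding k0_def by linarith
    qed auto
    also have "\<dots> \<le> quad_form n lap (\<lambda>i. p i - 1 / l * cross p i) (\<lambda>i. p i - 1 / l * cross p i) - l * sq_norm n (\<lambda>i. p i - 1 / l * cross p i)"
      by (rule schur_lower[OF l0 H1 H2 H3 p])
    finally show ?thesis .
  qed
  have dle: "d i \<le> d i1" if "i \<in> S" for i using d that by (metis order_trans order_refl)
  have u1: "ordered_eigenvalue 1 B \<le> d i1 + k1"
  proof (rule first_eigenvalue_le[OF B])
    fix x
    have "quad_form n lap x x - (d i1 + k1) * sq_norm n x \<le> (\<Sum>i\<in>S. (d i + k1 - (d i1 + k1)) * (x i)\<^sup>2)"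
      by (rule up) (use d k10 in linarith)
    also have "\<dots> \<le> 0" using dle by (intro sum_nonpos mult_nonpos_nonneg) auto
    finally show "quad_form n (\<lambda>i j. B $$ (i,j)) x x \<le> (d i1 + k1) * sq_norm n x" unfolding BQ by simp
  qed (use n2 in auto)
  have u2: "ordered_eigenvalue 2 B \<le> d i2 + k1"
  proof (rule second_eigenvalue_le[OF B n2])
    fix x :: "nat \<Rightarrow> real" assume x: "x i1 = 0"
    have "quad_form n lap x x - (d i2 + k1) * sq_norm n x \<le> (\<Sum>i\<in>S. (d i + k1 - (d i2 + k1)) * (x i)\<^sup>2)"
      by (rule up) (use d k10 in linarith)
    also have "\<dots> \<le> 0"
    proof (rule sum_nonpos)
      fix i assume "i \<in> S"
      thus "(d i + k1 - (d i2 + k1)) * (x i)\<^sup>2 \<le> 0" using d(4)[of i] x by (cases "i = i1") (auto intro!: mult_nonpos_nonneg)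
    qed
    finally show "quad_form n (\<lambda>i j. B $$ (i,j)) x x \<le> (d i2 + k1) * sq_norm n x" unfolding BQ by simp
  qed
  define e where "e k i = (if i = k then 1 else 0 :: real)" for k i :: nat
  have l1: "d i1 + k0 \<le> ordered_eigenvalue 1 B"
  proof (rule first_eigenvalue_ge[OF B])
    let ?x = "\<lambda>i. e i1 i - 1 / (d i1 + k0) * cross (e i1) i"
    have "(?x i1)\<^sup>2 \<le> sq_norm n ?x" unfolding sq_norm_def using i S by (intro member_le_sum) auto
    moreover have "?x i1 = 1" using i by (simp add: e_def cross_def)
    ultimately show "0 < sq_norm n ?x" by simp
    have "0 \<le> (\<Sum>i\<in>S. (d i + k0 - (d i1 + k0)) * (e i1 i)\<^sup>2)" by (intro sum_nonneg) (auto simp: e_def)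
    also have "\<dots> \<le> quad_form n lap ?x ?x - (d i1 + k0) * sq_norm n ?x"
      by (rule low) (use d k0 i in \<open>auto simp: e_def\<close>)
    finally show "(d i1 + k0) * sq_norm n ?x \<le> quad_form n (\<lambda>i j. B $$ (i,j)) ?x ?x" unfolding BQ by simp
  qed (use n2 in auto)
  have l2: "d i2 + k0 \<le> ordered_eigenvalue 2 B"
  proof (rule second_eigenvalue_ge[OF B n2])
    \<comment> \<open>Both trial vectors use the same \<open>l\<close>, so every combination of them
      is the trial vector of the combined \<open>p\<close>.\<close>
    let ?l = "d i2 + k0"
    let ?f = "\<lambda>i. e i1 i - 1 / ?l * cross (e i1) i" and ?g = "\<lambda>i. e i2 i - 1 / ?l * cross (e i2) i"
    fix s t
    define p where "p i = s * e i1 i + t * e i2 i" for i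
    have fg: "(\<lambda>i. s * ?f i + t * ?g i) = (\<lambda>i. p i - 1 / ?l * cross p i)"
    proof
      fix i
      have "cross p i = s * cross (e i1) i + t * cross (e i2) i"
        by (simp add: p_def cross_def mat_vec_def sum.distrib algebra_simps sum_distrib_left)
      thus "s * ?f i + t * ?g i = p i - 1 / ?l * cross p i" by (simp add: p_def algebra_simps add_divide_distrib)
    qed
    have p: "p i = 0" if "i \<notin> S" for i using that i by (auto simp: p_def e_def)
    have px: "p k - 1 / ?l * cross p k = p k" if "k \<in> S" for k using that by (simp add: cross_def)
    show "s = 0 \<and> t = 0" if z: "sq_norm n (\<lambda>i. s * ?f i + t * ?g i) = 0"
    proof -
      have "(p k)\<^sup>2 \<le> 0" if k: "k \<in> S" for k
      proof -
        have "(p k - 1 / ?l * cross p k)\<^sup>2 \<le> sq_norm n (\<lambda>i. p i - 1 / ?l * cross p i)"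
          unfolding sq_norm_def using k S by (intro member_le_sum) auto
        thus ?thesis using z unfolding fg px[OF k] by simp
      qed
      from this[OF i(1)] this[OF i(2)] show ?thesis using i(3) by (simp add: p_def e_def)
    qed
    have "0 \<le> (\<Sum>i\<in>S. (d i + k0 - ?l) * (p i)\<^sup>2)"
    proof (rule sum_nonneg)
      fix i assume "i \<in> S"
      show "0 \<le> (d i + k0 - ?l) * (p i)\<^sup>2" using d(2) by (auto simp: p_def e_def)
    qed
    also have "\<dots> \<le> quad_form n lap (\<lambda>i. p i - 1 / ?l * cross p i) (\<lambda>i. p i - 1 / ?l * cross p i) - ?l * sq_norm n (\<lambda>i. p i - 1 / ?l * cross p i)"
      by (rule low) (use d k0 p in auto)
    finally show "?l * sq_norm n (\<lambda>i. s * ?f i + t * ?g i) \<le> quad_form n (\<lambda>i j. B $$ (i,j)) (\<lambda>i. s * ?f i + t * ?g i) (\<lambda>i. s * ?f i + t * ?g i)"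
      unfolding fg BQ by simp
  qed
  have "\<bar>(ordered_eigenvalue 1 B - ordered_eigenvalue 2 B) - (d i1 - d i2)\<bar> \<le> k1 - k0"
    using u1 u2 l1 l2 by linarith
  also have "k1 - k0 = 2 * \<alpha> + (1 + \<beta>) / \<Lambda> - (1 - \<beta>) / \<Lambda>' + 2 * \<gamma>1 / \<Lambda>\<^sup>2 + \<gamma>2 / (\<Lambda>\<^sup>2 * \<mu>)"
    by (simp add: k1_def k0_def)
  finally show ?thesis .
qed

end

section \<open>Verifying the Schur hypotheses from norm, entry and sparsity bounds\<close>

context schur_split
begin

context
  fixes C \<epsilon> \<kappa> \<delta>1 \<delta>2 s Dm K \<theta> :: real
  assumes C: "C \<ge> 1" and E1: "\<And>x. \<bar>quad_form n a x x\<bar> \<le> C * sq_norm n x"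
    and eps: "\<epsilon> > 0" and E2: "\<And>J x. J \<subseteq> {..<n} \<Longrightarrow> real (card J) \<le> \<kappa> \<Longrightarrow> (\<And>i. i \<notin> J \<Longrightarrow> x i = 0) \<Longrightarrow> \<bar>quad_form n a x x\<bar> \<le> \<epsilon> * sq_norm n x"
    and E3: "\<And>i j. i < n \<Longrightarrow> j < n \<Longrightarrow> \<bar>a i j\<bar> \<le> \<delta>1"
    and E4: "\<And>i j. i < n \<Longrightarrow> j < n \<Longrightarrow> \<bar>(\<Sum>k<n. a i k * a j k) - (if i = j then 1 else 0)\<bar> \<le> \<delta>2"
    and nn: "0 \<le> \<delta>1" "0 \<le> \<delta>2" and s: "real (card S) \<le> s"
    and d: "\<And>i. i < n \<Longrightarrow> d i = (\<Sum>j<n. a i j)" and Dm: "\<And>i. i < n \<Longrightarrow> \<bar>d i\<bar> \<le> Dm"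
    and \<theta>: "\<And>i. i < n \<Longrightarrow> i \<notin> S \<Longrightarrow> d i \<le> \<theta>"
    and K: "K > 0" "C\<^sup>2 * real n / K\<^sup>2 + s \<le> \<kappa>" and small: "s * \<delta>2 + s\<^sup>2 * \<delta>1\<^sup>2 \<le> 1"
begin

lemma supported_sum:
  fixes f :: "nat \<Rightarrow> real"
  assumes "\<And>i. i \<notin> S \<Longrightarrow> p i = 0"
  shows "(\<Sum>i<n. f i * p i) = (\<Sum>i\<in>S. f i * p i)"
  using S assms by (intro sum.mono_neutral_right) auto

lemma supported_sq_norm:
  assumes "\<And>i. i \<notin> S \<Longrightarrow> p i = 0"
  shows "sq_norm n p = (\<Sum>i\<in>S. (p i)\<^sup>2)"
  unfolding sq_norm_def using S assms by (intro sum.mono_neutral_right) auto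

lemma l1_bound:
  assumes "\<And>i. i \<notin> S \<Longrightarrow> p i = 0"
  shows "(\<Sum>i\<in>S. \<bar>p i\<bar>)\<^sup>2 \<le> s * sq_norm n p"
proof -
  have "(\<Sum>i\<in>S. \<bar>p i\<bar> * 1)\<^sup>2 \<le> (\<Sum>i\<in>S. \<bar>p i\<bar>\<^sup>2) * (\<Sum>i\<in>S. 1\<^sup>2)"
    by (rule Cauchy_Schwarz_ineq_sum)
  also have "\<dots> = card S * sq_norm n p" using supported_sq_norm[of p, OF assms] by simp
  also have "\<dots> \<le> s * sq_norm n p" using s by (intro mult_right_mono) auto
  finally show ?thesis by simp
qed

text \<open>Cauchy-Schwarz on a support of at most \<open>s\<close> indices loses a factor
  \<open>s\<close>; with \<open>s\<close> = n^(1/8) and entries below n^(-1/4) this is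
  affordable.\<close>

lemma double_sum_bound:
  assumes p: "\<And>i. i \<notin> S \<Longrightarrow> p i = 0" and b: "\<And>i j. i < n \<Longrightarrow> j < n \<Longrightarrow> \<bar>b i j\<bar> \<le> \<delta>" "\<delta> \<ge> 0"
  shows "\<bar>quad_form n b p p\<bar> \<le> s * \<delta> * sq_norm n p"
proof -
  have "quad_form n b p p = (\<Sum>i\<in>S. \<Sum>j\<in>S. b i j * p i * p j)"
  proof -
    have ss: "(\<Sum>i<n. f i * p i) = (\<Sum>i\<in>S. f i * p i)" for f by (rule supported_sum) (rule p)
    have "quad_form n b p p = (\<Sum>i<n. (\<Sum>j<n. b i j * p j) * p i)"
      by (simp add: quad_form_mat_vec mat_vec_def mult.commute)
    also have "\<dots> = (\<Sum>i\<in>S. (\<Sum>j\<in>S. b i j * p j) * p i)" unfolding ss ..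
    finally show ?thesis by (simp add: sum_distrib_right sum_distrib_left mult_ac)
  qed
  also have "\<bar>\<dots>\<bar> \<le> (\<Sum>i\<in>S. \<Sum>j\<in>S. \<delta> * (\<bar>p i\<bar> * \<bar>p j\<bar>))"
  proof (rule order_trans[OF sum_abs], rule sum_mono)
    fix i assume i: "i \<in> S"
    show "\<bar>\<Sum>j\<in>S. b i j * p i * p j\<bar> \<le> (\<Sum>j\<in>S. \<delta> * (\<bar>p i\<bar> * \<bar>p j\<bar>))"
    proof (rule order_trans[OF sum_abs], rule sum_mono)
      fix j assume "j \<in> S"
      hence "\<bar>b i j\<bar> * (\<bar>p i\<bar> * \<bar>p j\<bar>) \<le> \<delta> * (\<bar>p i\<bar> * \<bar>p j\<bar>)"
        using i S by (intro mult_right_mono b) auto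
      thus "\<bar>b i j * p i * p j\<bar> \<le> \<delta> * (\<bar>p i\<bar> * \<bar>p j\<bar>)" by (simp add: abs_mult mult_ac)
    qed
  qed
  also have "\<dots> = \<delta> * (\<Sum>i\<in>S. \<bar>p i\<bar>)\<^sup>2"
    unfolding power2_eq_square sum_product by (simp only: sum_distrib_left)
  also have "\<dots> \<le> \<delta> * (s * sq_norm n p)" using b(2) by (intro mult_left_mono l1_bound p)
  finally show ?thesis by (simp add: mult_ac)
qed

lemma form_bound_S:
  assumes p: "\<And>i. i \<notin> S \<Longrightarrow> p i = 0"
  shows "\<bar>quad_form n a p p\<bar> \<le> s * \<delta>1 * sq_norm n p"
  using double_sum_bound[of p a \<delta>1] p E3 nn by auto

lemma image_norm:
  "sq_norm n (mat_vec n a p) = quad_form n (\<lambda>i j. \<Sum>k<n. a i k * a j k) p p"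
proof -
  have "sq_norm n (mat_vec n a p) = (\<Sum>k<n. \<Sum>i<n. \<Sum>j<n. a k i * p i * (a k j * p j))"
    by (simp add: sq_norm_def mat_vec_def power2_eq_square sum_product)
  also have "\<dots> = (\<Sum>k<n. \<Sum>i<n. \<Sum>j<n. a i k * a j k * p i * p j)"
    by (intro sum.cong refl) (use sym in \<open>auto\<close>)
  also have "\<dots> = (\<Sum>i<n. \<Sum>k<n. \<Sum>j<n. a i k * a j k * p i * p j)" by (rule sum.swap)
  also have "\<dots> = (\<Sum>i<n. \<Sum>j<n. \<Sum>k<n. a i k * a j k * p i * p j)" by (intro sum.cong refl sum.swap)
  finally show ?thesis by (simp add: quad_form_def sum_distrib_right)
qed

text \<open>The squared norm of the full image is the form of the squared matrix, which is entrywise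
  near the identity. What \<open>cross\<close> omits is the image inside \<open>S\<close>, small by
  the entry bound.\<close>

lemma cross_norm:
  assumes p: "\<And>i. i \<notin> S \<Longrightarrow> p i = 0"
  shows "\<bar>sq_norm n (cross p) - sq_norm n p\<bar> \<le> (s * \<delta>2 + s\<^sup>2 * \<delta>1\<^sup>2) * sq_norm n p"
proof -
  have "sq_norm n (mat_vec n a p) = sq_norm n (cross p) + (\<Sum>i\<in>S. (mat_vec n a p i)\<^sup>2)"
  proof -
    have "(\<Sum>i\<in>S. (mat_vec n a p i)\<^sup>2) = (\<Sum>i<n. if i \<in> S then (mat_vec n a p i)\<^sup>2 else 0)"
      using S by (simp add: sum.If_cases Int_absorb1)
    thus ?thesis unfolding sq_norm_def by (simp flip: sum.distrib) (intro sum.cong, auto simp: cross_def)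
  qed
  moreover have "quad_form n (\<lambda>i j. (\<Sum>k<n. a i k * a j k) - (if i = j then 1 else 0)) p p
      = sq_norm n (mat_vec n a p) - sq_norm n p"
  proof -
    have "(\<Sum>i<n. \<Sum>j<n. (if i = j then 1 else 0) * p i * p j) = (\<Sum>i<n. \<Sum>j<n. if i = j then p i * p i else 0)"
      by (intro sum.cong refl) auto
    thus ?thesis unfolding image_norm
      by (simp add: quad_form_def left_diff_distrib sum_subtractf sq_norm_def power2_eq_square)
  qed
  moreover have "\<bar>quad_form n (\<lambda>i j. (\<Sum>k<n. a i k * a j k) - (if i = j then 1 else 0)) p p\<bar> \<le> s * \<delta>2 * sq_norm n p"
    using p E4 nn by (intro double_sum_bound) auto
  moreover have "(\<Sum>i\<in>S. (mat_vec n a p i)\<^sup>2) \<le> s\<^sup>2 * \<delta>1\<^sup>2 * sq_norm n p"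
  proof -
    have ss: "(\<Sum>i<n. f i * p i) = (\<Sum>i\<in>S. f i * p i)" for f by (rule supported_sum) (rule p)
    have "(mat_vec n a p i)\<^sup>2 \<le> \<delta>1\<^sup>2 * (s * sq_norm n p)" if i: "i \<in> S" for i
    proof -
      have "\<bar>mat_vec n a p i\<bar> = \<bar>\<Sum>j\<in>S. a i j * p j\<bar>" unfolding mat_vec_def ss ..
      also have "\<dots> \<le> (\<Sum>j\<in>S. \<delta>1 * \<bar>p j\<bar>)"
        by (intro order_trans[OF sum_abs] sum_mono) (use E3 S i in \<open>auto simp: abs_mult intro!: mult_right_mono\<close>)
      also have "\<dots> = \<delta>1 * (\<Sum>j\<in>S. \<bar>p j\<bar>)" by (simp add: sum_distrib_left)
      finally have "\<bar>mat_vec n a p i\<bar>\<^sup>2 \<le> (\<delta>1 * (\<Sum>j\<in>S. \<bar>p j\<bar>))\<^sup>2" by (intro power_mono) auto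
      also have "\<dots> \<le> \<delta>1\<^sup>2 * (s * sq_norm n p)"
        unfolding power_mult_distrib using l1_bound[of p, OF p] by (intro mult_left_mono) auto
      finally show ?thesis by simp
    qed
    hence "(\<Sum>i\<in>S. (mat_vec n a p i)\<^sup>2) \<le> (\<Sum>i\<in>S. \<delta>1\<^sup>2 * (s * sq_norm n p))" by (intro sum_mono)
    also have "\<dots> = card S * (\<delta>1\<^sup>2 * (s * sq_norm n p))" by simp
    also have "\<dots> \<le> s * (\<delta>1\<^sup>2 * (s * sq_norm n p))"
      using s by (intro mult_right_mono mult_nonneg_nonneg) auto
    finally show ?thesis by (simp add: power2_eq_square mult_ac)
  qed
  moreover have "0 \<le> (\<Sum>i\<in>S. (mat_vec n a p i)\<^sup>2)" by (intro sum_nonneg) auto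
  ultimately show ?thesis unfolding distrib_right by linarith
qed

lemma cross_norm_le:
  assumes p: "\<And>i. i \<notin> S \<Longrightarrow> p i = 0"
  shows "sq_norm n (cross p) \<le> 2 * sq_norm n p"
proof -
  have "(s * \<delta>2 + s\<^sup>2 * \<delta>1\<^sup>2) * sq_norm n p \<le> 1 * sq_norm n p" using small by (intro mult_right_mono) auto
  thus ?thesis using cross_norm[of p, OF p] by linarith
qed

lemma mat_vec_norm_le: "sq_norm n (mat_vec n a x) \<le> C\<^sup>2 * sq_norm n x"
proof -
  \<comment> \<open>Cut off at \<open>n\<close> to have the support that
    \<open>block_norm_bound\<close> asks for.\<close>
  define x' where "x' i = (if i < n then x i else 0)" for i
  have "(\<Sum>i\<in>{..<n}. (mat_vec n a x' i)\<^sup>2) \<le> C\<^sup>2 * sq_norm n x'"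
    by (rule block_norm_bound[of n a C "{..<n}", OF sym]) (use C E1 in \<open>auto simp: x'_def\<close>)
  thus ?thesis by (simp add: sq_norm_def mat_vec_def x'_def)
qed

text \<open>These indices are few, because the row sums form the image of the all-ones vector, whose
  norm is controlled. Yet \<open>d\<close> may be as large as \<open>Dm\<close> on them, so they
  need separate treatment.\<close>

definition large where "large = {i. i < n \<and> \<bar>d i\<bar> > K}"

lemma card_large: "real (card large) \<le> C\<^sup>2 * real n / K\<^sup>2"
proof -
  have fl: "finite large" by (simp add: large_def)
  have "real (card large) * K\<^sup>2 = (\<Sum>i\<in>large. K\<^sup>2)" by simp
  also have "\<dots> \<le> (\<Sum>i\<in>large. (d i)\<^sup>2)"
    using K by (intro sum_mono) (auto simp: large_def abs_le_square_iff[symmetric])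
  also have "\<dots> \<le> (\<Sum>i<n. (d i)\<^sup>2)" by (intro sum_mono2) (auto simp: large_def)
  also have "\<dots> = sq_norm n (mat_vec n a (\<lambda>_. 1))" using d by (simp add: sq_norm_def mat_vec_def)
  also have "\<dots> \<le> C\<^sup>2 * sq_norm n (\<lambda>_. 1)" by (rule mat_vec_norm_le)
  finally show ?thesis using K by (simp add: sq_norm_def field_simps)
qed

text \<open>The large indices and \<open>S\<close> together fit into one set of at most \<kappa>
  indices, whose block has norm at most \<epsilon>.\<close>

lemma cross_large:
  assumes p: "\<And>i. i \<notin> S \<Longrightarrow> p i = 0"
  shows "(\<Sum>i\<in>large. (cross p i)\<^sup>2) \<le> \<epsilon>\<^sup>2 * sq_norm n p"
proof -
  let ?J = "large \<union> S"
  have "card ?J \<le> card large + card S" by (rule card_Un_le)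
  hence cJ: "real (card ?J) \<le> \<kappa>" using card_large s K by linarith
  have "(\<Sum>i\<in>large. (cross p i)\<^sup>2) \<le> (\<Sum>i\<in>large. (mat_vec n a p i)\<^sup>2)"
    by (intro sum_mono) (auto simp: cross_def)
  also have "\<dots> \<le> \<epsilon>\<^sup>2 * sq_norm n p"
    by (rule block_norm_bound[of n a \<epsilon> ?J, OF sym]) (use eps E2[OF _ cJ] S p in \<open>auto simp: large_def\<close>)
  finally show ?thesis .
qed

text \<open>Off \<open>large\<close> the weight is bounded by a constant; on \<open>large\<close>
  its full size \<open>D\<close> meets the factor \<epsilon>^2.\<close>

lemma weighted_cross:
  assumes p: "\<And>i. i \<notin> S \<Longrightarrow> p i = 0" and w: "\<And>i. i < n \<Longrightarrow> 0 \<le> w i"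
    and wK: "\<And>i. i < n \<Longrightarrow> i \<notin> large \<Longrightarrow> w i \<le> k" and wD: "\<And>i. i < n \<Longrightarrow> w i \<le> D" and kD: "0 \<le> k" "0 \<le> D"
  shows "(\<Sum>i<n. w i * (cross p i)\<^sup>2) \<le> (2 * k + D * \<epsilon>\<^sup>2) * sq_norm n p"
proof -
  have "(\<Sum>i<n. w i * (cross p i)\<^sup>2) \<le> (\<Sum>i<n. k * (cross p i)\<^sup>2 + (if i \<in> large then D * (cross p i)\<^sup>2 else 0))"
  proof (rule sum_mono)
    fix i assume "i \<in> {..<n}"
    hence "w i * (cross p i)\<^sup>2 \<le> D * (cross p i)\<^sup>2" "i \<notin> large \<Longrightarrow> w i * (cross p i)\<^sup>2 \<le> k * (cross p i)\<^sup>2"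
      using wK[of i] wD[of i] by (auto intro!: mult_right_mono)
    moreover have "0 \<le> k * (cross p i)\<^sup>2" using kD by simp
    ultimately show "w i * (cross p i)\<^sup>2 \<le> k * (cross p i)\<^sup>2 + (if i \<in> large then D * (cross p i)\<^sup>2 else 0)"
      by (cases "i \<in> large") (simp_all, linarith?)
  qed
  also have "\<dots> = k * sq_norm n (cross p) + D * (\<Sum>i\<in>large. (cross p i)\<^sup>2)"
  proof -
    have "{..<n} \<inter> large = large" by (auto simp: large_def)
    thus ?thesis by (simp add: sum.distrib sq_norm_def sum_distrib_left sum.If_cases)
  qed
  also have "\<dots> \<le> k * (2 * sq_norm n p) + D * (\<epsilon>\<^sup>2 * sq_norm n p)"
    using cross_norm_le[of p, OF p] cross_large[of p, OF p] kD by (intro add_mono mult_left_mono) auto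
  finally show ?thesis by (simp add: algebra_simps)
qed

lemma lap_cross:
  assumes p: "\<And>i. i \<notin> S \<Longrightarrow> p i = 0" and n: "n > 0"
  shows "\<bar>quad_form n lap (cross p) (cross p)\<bar> \<le> (2 * (K + C) + Dm * \<epsilon>\<^sup>2) * sq_norm n p"
proof -
  have Dm0: "Dm \<ge> 0" using Dm[OF n] by linarith
  have "\<bar>quad_form n lap (cross p) (cross p)\<bar> \<le> \<bar>\<Sum>i<n. d i * cross p i * cross p i\<bar> + \<bar>quad_form n a (cross p) (cross p)\<bar>"
    unfolding quad_form_lap by linarith
  also have "\<bar>\<Sum>i<n. d i * cross p i * cross p i\<bar> \<le> (\<Sum>i<n. \<bar>d i\<bar> * (cross p i)\<^sup>2)"
    by (intro order_trans[OF sum_abs] sum_mono) (simp add: abs_mult power2_eq_square mult_ac)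
  also have "(\<Sum>i<n. \<bar>d i\<bar> * (cross p i)\<^sup>2) \<le> (2 * K + Dm * \<epsilon>\<^sup>2) * sq_norm n p"
    by (rule weighted_cross[of p, OF p]) (use Dm Dm0 K in \<open>auto simp: large_def\<close>)
  also have "\<bar>quad_form n a (cross p) (cross p)\<bar> \<le> C * (2 * sq_norm n p)"
    using E1[of "cross p"] C cross_norm_le[of p, OF p] by (meson mult_left_mono order_trans zero_le_one)
  finally show ?thesis by (simp add: algebra_simps)
qed

text \<open>Here the splitting is decisive. This bound is later divided by \<Lambda>^2 * \<mu>, of
  third order in the scale, so a term Dm^2 without \<epsilon>^2 would contribute as much as the gap
  itself.\<close>

lemma lap_cross_norm:
  assumes p: "\<And>i. i \<notin> S \<Longrightarrow> p i = 0" and n: "n > 0"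
  shows "sq_norm n (mat_vec n lap (cross p)) \<le> (4 * (K\<^sup>2 + C\<^sup>2) + 2 * Dm\<^sup>2 * \<epsilon>\<^sup>2) * sq_norm n p"
proof -
  have Dm0: "Dm \<ge> 0" using Dm[OF n] by linarith
  have mv: "mat_vec n lap (cross p) i = d i * cross p i + - mat_vec n a (cross p) i" if "i < n" for i
  proof -
    have "mat_vec n lap (cross p) i = (\<Sum>j<n. (if i = j then d i * cross p i else 0) - a i j * cross p j)"
      unfolding mat_vec_def lap_def by (intro sum.cong) (auto simp: algebra_simps)
    thus ?thesis using that by (simp add: sum_subtractf mat_vec_def)
  qed
  have "sq_norm n (mat_vec n lap (cross p)) = sq_norm n (\<lambda>i. d i * cross p i + - mat_vec n a (cross p) i)"
    unfolding sq_norm_def by (intro sum.cong) (auto simp: mv)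
  also have "\<dots> \<le> (1 + 1) * sq_norm n (\<lambda>i. d i * cross p i) + (1 + 1 / 1) * sq_norm n (\<lambda>i. - mat_vec n a (cross p) i)"
    by (rule sq_norm_sum_le) simp
  also have "sq_norm n (\<lambda>i. - mat_vec n a (cross p) i) = sq_norm n (mat_vec n a (cross p))" by (simp add: sq_norm_def)
  also have "sq_norm n (mat_vec n a (cross p)) \<le> C\<^sup>2 * (2 * sq_norm n p)"
    using mat_vec_norm_le[of "cross p"] cross_norm_le[of p, OF p] by (meson mult_left_mono order_trans zero_le_power2)
  also have "sq_norm n (\<lambda>i. d i * cross p i) = (\<Sum>i<n. (d i)\<^sup>2 * (cross p i)\<^sup>2)" by (simp add: sq_norm_def power_mult_distrib)
  also have "\<dots> \<le> (2 * K\<^sup>2 + Dm\<^sup>2 * \<epsilon>\<^sup>2) * sq_norm n p"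
    by (rule weighted_cross[of p, OF p]) (use Dm Dm0 K in \<open>auto simp: large_def abs_le_square_iff[symmetric] not_less\<close>)
  finally show ?thesis by (simp add: algebra_simps)
qed

lemma lap_complement:
  assumes r: "\<And>i. i \<in> S \<Longrightarrow> r i = 0"
  shows "quad_form n lap r r \<le> (\<theta> + C) * sq_norm n r"
proof -
  have "(\<Sum>i<n. d i * r i * r i) \<le> (\<Sum>i<n. \<theta> * (r i)\<^sup>2)"
  proof (rule sum_mono)
    fix i assume "i \<in> {..<n}"
    thus "d i * r i * r i \<le> \<theta> * (r i)\<^sup>2"
      using \<theta>[of i] r[of i] mult_right_mono[of "d i" \<theta> "(r i)\<^sup>2"] by (cases "i \<in> S") (auto simp: power2_eq_square mult_ac)
  qed
  also have "\<dots> = \<theta> * sq_norm n r" by (simp add: sq_norm_def sum_distrib_left)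
  finally show ?thesis using E1[of r] by (simp add: quad_form_lap algebra_simps abs_le_iff)
qed

lemma eigenvalue_gap_bound:
  fixes B :: "real mat"
  assumes B: "B \<in> carrier_mat n n" "transpose_mat B = B" and BL: "\<And>i j. i < n \<Longrightarrow> j < n \<Longrightarrow> B $$ (i,j) = lap i j"
    and mu: "\<mu> > 0" and nu: "\<theta> + C + \<mu> \<le> \<Lambda>" and L: "1 \<le> \<Lambda>" "1 \<le> \<Lambda>'"
    and small': "s * \<delta>1 + (2 * (K + C) + Dm * \<epsilon>\<^sup>2) / \<Lambda>\<^sup>2 \<le> 1"
    and i: "i1 \<in> S" "i2 \<in> S" "i1 \<noteq> i2" and d': "\<Lambda> + 1 \<le> d i2" "d i2 \<le> d i1" "d i1 + 1 \<le> \<Lambda>'" "\<And>i. i \<in> S \<Longrightarrow> i \<noteq> i1 \<Longrightarrow> d i \<le> d i2"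
  shows "\<bar>(ordered_eigenvalue 1 B - ordered_eigenvalue 2 B) - (d i1 - d i2)\<bar>
    \<le> 2 * (s * \<delta>1) + (1 + (s * \<delta>2 + s\<^sup>2 * \<delta>1\<^sup>2)) / \<Lambda> - (1 - (s * \<delta>2 + s\<^sup>2 * \<delta>1\<^sup>2)) / \<Lambda>'
      + 2 * (2 * (K + C) + Dm * \<epsilon>\<^sup>2) / \<Lambda>\<^sup>2 + (4 * (K\<^sup>2 + C\<^sup>2) + 2 * Dm\<^sup>2 * \<epsilon>\<^sup>2) / (\<Lambda>\<^sup>2 * \<mu>)"
proof -
  have n: "n > 0" using i S by (metis lessThan_iff subsetD gr_zeroI not_less0)
  have Dm0: "Dm \<ge> 0" using Dm[OF n] by linarith
  have s0: "s \<ge> 0" using s by linarith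
  show ?thesis
  proof (rule top_eigenvalue_gap[OF B BL mu nu L])
    show "0 \<le> s * \<delta>1" "0 \<le> s * \<delta>2 + s\<^sup>2 * \<delta>1\<^sup>2" "0 \<le> 2 * (K + C) + Dm * \<epsilon>\<^sup>2" "0 \<le> 4 * (K\<^sup>2 + C\<^sup>2) + 2 * Dm\<^sup>2 * \<epsilon>\<^sup>2"
      using s0 nn K C Dm0 by auto
  qed (use form_bound_S cross_norm lap_cross[OF _ n] lap_cross_norm[OF _ n] lap_complement small small' i d' in auto)
qed

end

end

lemma laplacian_carrier:
  assumes "A \<in> carrier_mat n n"
  shows "laplacian A \<in> carrier_mat n n"
  using assms by (auto simp: laplacian_def degree_mat_def mat_diag_def)

lemma laplacian_index:
  assumes "A \<in> carrier_mat n n" "i < n" "j < n"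
  shows "laplacian A $$ (i,j) = (if i = j then \<Sum>j<n. A $$ (i,j) else 0) - A $$ (i,j)"
  using assms by (auto simp: laplacian_def degree_mat_def mat_diag_def)

lemma laplacian_transpose:
  assumes "A \<in> carrier_mat n n" "transpose_mat A = A"
  shows "transpose_mat (laplacian A) = laplacian A"
proof (rule eq_matI)
  have s: "A $$ (i,j) = A $$ (j,i)" if "i < n" "j < n" for i j
    using assms that by (metis carrier_matD index_transpose_mat(1))
  fix i j assume "i < dim_row (laplacian A)" "j < dim_col (laplacian A)"
  hence ij: "i < n" "j < n" using laplacian_carrier[OF assms(1)] by auto
  thus "transpose_mat (laplacian A) $$ (i,j) = laplacian A $$ (i,j)"
    using laplacian_carrier[OF assms(1)] s[of i j] by (simp add: laplacian_index[OF assms(1)])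
qed (use laplacian_carrier[OF assms(1)] in auto)

section \<open>The gap of independent standard normal variables\<close>

context prob_space
begin

lemma indep_vars_Max:
  fixes X :: "'i \<Rightarrow> 'a \<Rightarrow> real"
  assumes I: "finite I" "i \<notin> I" and indep: "indep_vars (\<lambda>_. borel) X (insert i I)"
  shows "indep_var borel (X i) borel (\<lambda>\<omega>. Max ((\<lambda>i. X i \<omega>)`I))"
proof -
  have "indep_var
    borel ((\<lambda>f. f i) \<circ> (\<lambda>\<omega>. restrict (\<lambda>i. X i \<omega>) {i}))
    borel ((\<lambda>f. Max (f`I)) \<circ> (\<lambda>\<omega>. restrict (\<lambda>i. X i \<omega>) I))"
    using I by (intro indep_var_compose[OF indep_var_restrict[OF indep]] borel_measurable_Max) auto
  also have "((\<lambda>f. f i) \<circ> (\<lambda>\<omega>. restrict (\<lambda>i. X i \<omega>) {i})) = X i"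
    by auto
  also have "((\<lambda>f. Max (f`I)) \<circ> (\<lambda>\<omega>. restrict (\<lambda>i. X i \<omega>) I)) = (\<lambda>\<omega>. Max ((\<lambda>i. X i \<omega>)`I))"
    by (auto cong: rev_conj_cong)
  finally show ?thesis
    unfolding indep_var_def .
qed

lemma prob_indep_std_normal:
  assumes ind: "indep_var borel Y borel Z" and Y: "distr M borel Y = std_normal"
    and B: "B \<in> sets (borel \<Otimes>\<^sub>M borel)"
  shows "prob {\<omega> \<in> space M. (Y \<omega>, Z \<omega>) \<in> B} = expectation (\<lambda>\<omega>. measure std_normal {y. (y, Z \<omega>) \<in> B})"
    and "(\<lambda>\<omega>. measure std_normal {y. (y, Z \<omega>) \<in> B}) \<in> borel_measurable M"
proof -
  have rv [measurable]: "Y \<in> borel_measurable M" "Z \<in> borel_measurable M"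
    using ind by (auto dest: indep_var_rv1 indep_var_rv2)
  interpret D: prob_space "distr M borel Z" by (rule prob_space_distr) simp
  interpret P: pair_prob_space std_normal "distr M borel Z" ..
  have eq: "std_normal \<Otimes>\<^sub>M distr M borel Z = distr M (borel \<Otimes>\<^sub>M borel) (\<lambda>\<omega>. (Y \<omega>, Z \<omega>))"
    using ind unfolding indep_var_distribution_eq Y by simp
  have B': "B \<in> sets (std_normal \<Otimes>\<^sub>M distr M borel Z)"
    using B by (simp cong: sets_pair_measure_cong)
  have m: "(\<lambda>z. emeasure std_normal ((\<lambda>y. (y, z)) -` B)) \<in> borel_measurable borel"
    using P.measurable_emeasure_Pair2[OF B'] by simp
  have v: "(\<lambda>y. (y, z)) -` B = {y. (y, z) \<in> B}" for z by auto
  have mm: "(\<lambda>z. measure std_normal {y. (y, z) \<in> B}) \<in> borel_measurable borel"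
    using m unfolding v measure_def by measurable
  show mZ: "(\<lambda>\<omega>. measure std_normal {y. (y, Z \<omega>) \<in> B}) \<in> borel_measurable M"
    using mm by measurable
  have "ennreal (prob {\<omega> \<in> space M. (Y \<omega>, Z \<omega>) \<in> B}) = emeasure (distr M (borel \<Otimes>\<^sub>M borel) (\<lambda>\<omega>. (Y \<omega>, Z \<omega>))) B"
    using B by (subst emeasure_distr) (auto simp: emeasure_eq_measure vimage_def Int_def conj_commute)
  also have "\<dots> = (\<integral>\<^sup>+z. emeasure std_normal ((\<lambda>y. (y, z)) -` B) \<partial>distr M borel Z)"
    unfolding eq[symmetric] by (rule P.emeasure_pair_measure_alt2[OF B'])
  also have "\<dots> = (\<integral>\<^sup>+\<omega>. ennreal (measure std_normal {y. (y, Z \<omega>) \<in> B}) \<partial>M)"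
    using m by (subst nn_integral_distr) (auto simp: v std_normal.emeasure_eq_measure)
  also have "\<dots> = ennreal (expectation (\<lambda>\<omega>. measure std_normal {y. (y, Z \<omega>) \<in> B}))"
    using mZ by (intro nn_integral_eq_integral integrable_const_bound[of _ 1]) auto
  finally show "prob {\<omega> \<in> space M. (Y \<omega>, Z \<omega>) \<in> B} = expectation (\<lambda>\<omega>. measure std_normal {y. (y, Z \<omega>) \<in> B})"
    by simp
qed

lemma prob_exceeds_shifted:
  assumes ind: "indep_var borel Y borel Z" and Y: "distr M borel Y = std_normal"
  shows "prob {\<omega> \<in> space M. Z \<omega> + h < Y \<omega>} = expectation (\<lambda>\<omega>. measure std_normal {Z \<omega> + h<..})"
    and "prob {\<omega> \<in> space M. Z \<omega> \<le> Y \<omega>} = expectation (\<lambda>\<omega>. measure std_normal {Z \<omega><..})"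
    and "integrable M (\<lambda>\<omega>. measure std_normal {Z \<omega> + h<..})"
proof -
  have B1: "{p. snd p + h < fst p} \<in> sets (borel \<Otimes>\<^sub>M (borel :: real measure))"
    by (subst borel_prod) (intro borel_open open_Collect_less continuous_intros)
  have B2: "{p. snd p \<le> fst p} \<in> sets (borel \<Otimes>\<^sub>M (borel :: real measure))"
    by (subst borel_prod) (intro borel_closed closed_Collect_le continuous_intros)
  have e: "{y. z + h < y} = {z + h<..}" "{y. z \<le> y} = {z..}" for z by auto
  show "prob {\<omega> \<in> space M. Z \<omega> + h < Y \<omega>} = expectation (\<lambda>\<omega>. measure std_normal {Z \<omega> + h<..})"
    using prob_indep_std_normal(1)[OF ind Y B1] by (simp add: e)
  show "prob {\<omega> \<in> space M. Z \<omega> \<le> Y \<omega>} = expectation (\<lambda>\<omega>. measure std_normal {Z \<omega><..})"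
    using prob_indep_std_normal(1)[OF ind Y B2] by (simp add: e std_normal_atLeast_eq_greaterThan)
  show "integrable M (\<lambda>\<omega>. measure std_normal {Z \<omega> + h<..})"
    using prob_indep_std_normal(2)[OF ind Y B1] by (intro integrable_const_bound[of _ 1]) (auto simp: e)
qed

lemma prob_exceeds_shifted_le:
  assumes ind: "indep_var borel Y borel Z" and Y: "distr M borel Y = std_normal"
    and h: "0 \<le> h" and lo: "\<And>\<omega>. \<omega> \<in> space M \<Longrightarrow> lo \<le> Z \<omega>"
  shows "prob {\<omega> \<in> space M. Z \<omega> + h < Y \<omega>} \<le> exp (- h * lo) * prob {\<omega> \<in> space M. Z \<omega> < Y \<omega>}"
proof -
  have "prob {\<omega> \<in> space M. Z \<omega> + h < Y \<omega>} \<le> expectation (\<lambda>\<omega>. exp (- h * lo) * measure std_normal {Z \<omega> + 0<..})"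
    unfolding prob_exceeds_shifted(1)[OF ind Y]
    using prob_exceeds_shifted(3)[OF ind Y, of h] prob_exceeds_shifted(3)[OF ind Y, of 0]
    by (intro integral_mono integrable_mult_right) (use std_normal_tail_shift_le[OF h lo] in auto)
  also have "\<dots> = exp (- h * lo) * prob {\<omega> \<in> space M. Z \<omega> + 0 < Y \<omega>}"
    unfolding prob_exceeds_shifted(1)[OF ind Y] by simp
  finally show ?thesis by simp
qed

lemma prob_exceeds_shifted_ge:
  assumes ind: "indep_var borel Y borel Z" and Y: "distr M borel Y = std_normal" and h: "0 \<le> h"
  shows "exp (- h * hi - h\<^sup>2 / 2) * (prob {\<omega> \<in> space M. Z \<omega> \<le> Y \<omega>} - measure std_normal {hi<..})
    \<le> prob {\<omega> \<in> space M. Z \<omega> + h < Y \<omega>}"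
proof -
  define c where "c = exp (- h * hi - h\<^sup>2 / 2)"
  have int: "integrable M (\<lambda>\<omega>. measure std_normal {Z \<omega><..})" using prob_exceeds_shifted(3)[OF ind Y, of 0] by simp
  have "c * (prob {\<omega> \<in> space M. Z \<omega> \<le> Y \<omega>} - measure std_normal {hi<..})
     = expectation (\<lambda>\<omega>. c * (measure std_normal {Z \<omega><..} - measure std_normal {hi<..}))"
    unfolding prob_exceeds_shifted(2)[OF ind Y] using int by (simp add: prob_space)
  also have "\<dots> \<le> expectation (\<lambda>\<omega>. measure std_normal {Z \<omega> + h<..})"
    using int prob_exceeds_shifted(3)[OF ind Y, of h]
    by (intro integral_mono integrable_mult_right integrable_diff) (use std_normal_tail_shift_ge[OF h] in \<open>auto simp: c_def\<close>)
  also have "\<dots> = prob {\<omega> \<in> space M. Z \<omega> + h < Y \<omega>}"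
    by (rule prob_exceeds_shifted(1)[OF ind Y, symmetric])
  finally show ?thesis by (simp add: c_def)
qed

end

section \<open>Leading indices among independent standard normal variables\<close>

locale iid_normal = prob_space M for M :: "'a measure" +
  fixes n :: nat and Y :: "nat \<Rightarrow> 'a \<Rightarrow> real"
  assumes indep: "indep_vars (\<lambda>_. borel) Y {..<n}"
    and std: "\<And>i. i < n \<Longrightarrow> distr M borel (Y i) = std_normal"
begin

lemma Y_measurable [measurable]: "i < n \<Longrightarrow> Y i \<in> borel_measurable M"
  using indep by (auto simp: indep_vars_def)

lemma prob_Y: "i < n \<Longrightarrow> B \<in> sets borel \<Longrightarrow> prob {\<omega> \<in> space M. Y i \<omega> \<in> B} = measure std_normal B"
  by (subst std[symmetric]) (auto simp: measure_distr vimage_def Int_def conj_commute)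

text \<open>The gap of the two largest values exceeds \<open>h\<close> exactly when some index leads
  by \<open>h\<close>. For \<open>h \<ge> 0\<close> at most one index does, so the gap probability
  is a sum over indices, each term comparing one variable with the rest.\<close>

definition leads :: "real \<Rightarrow> nat \<Rightarrow> 'a set" where
  "leads h i = {\<omega> \<in> space M. \<forall>j<n. j \<noteq> i \<longrightarrow> Y j \<omega> + h < Y i \<omega>}"

definition all_below :: "real \<Rightarrow> nat set \<Rightarrow> 'a set" where
  "all_below t J = {\<omega> \<in> space M. \<forall>j\<in>J. Y j \<omega> < t}"

lemma leads_sets [measurable]: "i < n \<Longrightarrow> leads h i \<in> events"
  unfolding leads_def by measurable

lemma all_below_sets [measurable]: "J \<subseteq> {..<n} \<Longrightarrow> all_below t J \<in> events"
  unfolding all_below_def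
  by (intro sets.sets_Collect_finite_All) (auto intro: finite_subset)

lemma prob_all_below:
  assumes "J \<subseteq> {..<n}"
  shows "prob (all_below t J) \<le> exp (- (card J * measure std_normal {t..}))"
proof (cases "J = {}")
  case False
  have fJ: "finite J" using assms finite_subset by blast
  have "all_below t J = (\<Inter>j\<in>J. Y j -` {..<t} \<inter> space M)" using False by (auto simp: all_below_def)
  hence "prob (all_below t J) = (\<Prod>j\<in>J. prob (Y j -` {..<t} \<inter> space M))"
    using indep_varsD_finite[OF indep_vars_subset[OF indep assms] False fJ, of "\<lambda>_. {..<t}"] by simp
  also have "\<dots> \<le> (\<Prod>j\<in>J. exp (- measure std_normal {t..}))"
  proof (intro prod_mono conjI)
    fix j assume "j \<in> J"
    hence j: "j < n" using assms by auto
    have "prob (Y j -` {..<t} \<inter> space M) = measure std_normal {..<t}"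
      using prob_Y[OF j, of "{..<t}"] by (simp add: vimage_def Int_def conj_commute)
    also have "\<dots> = 1 - measure std_normal {t..}"
    proof -
      have "{..<t} = space std_normal - {t..}" by auto
      thus ?thesis using std_normal.prob_compl[of "{t..}"] by simp
    qed
    also have "\<dots> \<le> exp (- measure std_normal {t..})" using exp_ge_add_one_self[of "- measure std_normal {t..}"] by simp
    finally show "prob (Y j -` {..<t} \<inter> space M) \<le> exp (- measure std_normal {t..})" .
  qed simp
  also have "\<dots> = exp (- (card J * measure std_normal {t..}))" by (simp flip: exp_of_nat_mult)
  finally show ?thesis .
qed simp

lemma leads_disjoint: "0 \<le> h \<Longrightarrow> disjoint_family_on (leads h) {..<n}"
  by (force simp: disjoint_family_on_def leads_def)

lemma sum_prob_leads_le_1: "0 \<le> h \<Longrightarrow> (\<Sum>i<n. prob (leads h i)) \<le> 1"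
  by (subst finite_measure_finite_Union[symmetric]) (auto simp: leads_disjoint)

text \<open>Reduces leading to a comparison of a normal variable with an independent one;
  \<open>n \<ge> 2\<close> keeps the index set of the maximum nonempty.\<close>

lemma rest_Max:
  assumes n: "n \<ge> 2" and i: "i < n"
  defines "Z \<equiv> \<lambda>\<omega>. Max ((\<lambda>j. Y j \<omega>) ` ({..<n} - {i}))"
  shows "indep_var borel (Y i) borel Z"
    and "leads h i = {\<omega> \<in> space M. Z \<omega> + h < Y i \<omega>}"
    and "\<And>\<omega>. (\<forall>j<n. j \<noteq> i \<longrightarrow> Y j \<omega> \<le> t) \<longleftrightarrow> Z \<omega> \<le> t"
    and "\<And>\<omega>. Z \<omega> < t \<longleftrightarrow> (\<forall>j\<in>{..<n}-{i}. Y j \<omega> < t)"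
proof -
  have ins: "insert i ({..<n} - {i}) = {..<n}" using i by auto
  show "indep_var borel (Y i) borel Z"
    unfolding Z_def by (rule indep_vars_Max) (use ins indep in auto)
  have "card ({..<n} - {i}) \<noteq> 0" using n i by simp
  hence ne: "{..<n} - {i} \<noteq> {}" by force
  show *: "\<And>\<omega>. (\<forall>j<n. j \<noteq> i \<longrightarrow> Y j \<omega> \<le> t) \<longleftrightarrow> Z \<omega> \<le> t" for t
    unfolding Z_def using ne by (subst Max_le_iff) auto
  show lt: "\<And>\<omega>. Z \<omega> < t \<longleftrightarrow> (\<forall>j\<in>{..<n}-{i}. Y j \<omega> < t)" for t
    unfolding Z_def using ne by (subst Max_less_iff) auto
  show "leads h i = {\<omega> \<in> space M. Z \<omega> + h < Y i \<omega>}"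
    unfolding leads_def using lt[of _ "Y i _ - h"] by (auto simp: algebra_simps)
qed

text \<open>If all variables but one are below \<open>lo\<close>, then one of the two halves lies
  entirely below it, whichever index is the exception. Two fixed events thus replace a union over
  \<open>n\<close> indices.\<close>

lemma prob_half_below:
  "prob (all_below lo {..<n div 2} \<union> all_below lo {n div 2..<n}) \<le> 2 * exp (- (real (n div 2) * measure std_normal {lo..}))"
proof -
  have "prob (all_below lo {..<n div 2} \<union> all_below lo {n div 2..<n}) \<le> prob (all_below lo {..<n div 2}) + prob (all_below lo {n div 2..<n})"
    by (rule measure_Un_le; rule all_below_sets; auto)
  also have "\<dots> \<le> exp (- (real (n div 2) * measure std_normal {lo..})) + exp (- (real (n div 2) * measure std_normal {lo..}))"
  proof (rule add_mono)
    show "prob (all_below lo {..<n div 2}) \<le> exp (- (real (n div 2) * measure std_normal {lo..}))"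
      using prob_all_below[of "{..<n div 2}" lo] by simp
    have "prob (all_below lo {n div 2..<n}) \<le> exp (- (real (card {n div 2..<n}) * measure std_normal {lo..}))"
      by (rule prob_all_below) auto
    also have "\<dots> \<le> exp (- (real (n div 2) * measure std_normal {lo..}))" by (simp add: mult_right_mono)
    finally show "prob (all_below lo {n div 2..<n}) \<le> exp (- (real (n div 2) * measure std_normal {lo..}))" .
  qed
  finally show ?thesis by simp
qed

lemma sum_prob_leads_le:
  assumes n: "n \<ge> 2" and h: "0 \<le> h"
  shows "(\<Sum>i<n. prob (leads h i)) \<le> exp (- h * lo) + 2 * exp (- (real (n div 2) * measure std_normal {lo..}))"
proof -
  define Z where "Z i \<omega> = Max ((\<lambda>j. Y j \<omega>) ` ({..<n} - {i}))" for i \<omega>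
  note Z = rest_Max[OF n, folded Z_def]
  \<comment> \<open>What is lost of \<open>leads 0 i\<close> when \<open>Z i\<close> is raised to
    \<open>lo\<close>. These events are disjoint in \<open>i\<close>, so their total is the
    probability of a single rare event.\<close>
  define L where "L i = leads 0 i \<inter> {\<omega> \<in> space M. Z i \<omega> < lo}" for i
  have Zm [measurable]: "Z i \<in> borel_measurable M" if "i < n" for i
    using indep_var_rv2[OF Z(1)[OF that]] by simp
  have Lm [measurable]: "L i \<in> events" if "i < n" for i unfolding L_def using that by measurable
  have "prob (leads h i) \<le> exp (- h * lo) * prob (leads 0 i) + prob (L i)" if i: "i < n" for i
  proof -
    \<comment> \<open>Raising the maximum of the rest to \<open>lo\<close> keeps it independent of
      \<open>Y i\<close> and makes the shift estimate hold with the constant exp (- h * lo).\<close>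
    have iv: "indep_var borel (Y i) borel (\<lambda>\<omega>. max lo (Z i \<omega>))"
      using indep_var_compose[OF Z(1)[OF i], of "\<lambda>x. x" borel "\<lambda>z. max lo z" borel] by (simp add: comp_def)
    have "prob (leads h i) \<le> prob ({\<omega> \<in> space M. max lo (Z i \<omega>) + h < Y i \<omega>} \<union> L i)"
      using i h by (intro finite_measure_mono) (auto simp: L_def Z(2)[OF i])
    also have "\<dots> \<le> prob {\<omega> \<in> space M. max lo (Z i \<omega>) + h < Y i \<omega>} + prob (L i)"
      using i by (intro measure_Un_le) auto
    also have "prob {\<omega> \<in> space M. max lo (Z i \<omega>) + h < Y i \<omega>} \<le> exp (- h * lo) * prob {\<omega> \<in> space M. max lo (Z i \<omega>) < Y i \<omega>}"
      by (rule prob_exceeds_shifted_le[OF iv std[OF i] h]) auto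
    also have "\<dots> \<le> exp (- h * lo) * prob (leads 0 i)"
      using i by (intro mult_left_mono finite_measure_mono) (auto simp: Z(2)[OF i])
    finally show ?thesis by simp
  qed
  hence "(\<Sum>i<n. prob (leads h i)) \<le> (\<Sum>i<n. exp (- h * lo) * prob (leads 0 i) + prob (L i))" by (intro sum_mono) auto
  also have "\<dots> = exp (- h * lo) * (\<Sum>i<n. prob (leads 0 i)) + (\<Sum>i<n. prob (L i))"
    by (simp add: sum.distrib sum_distrib_left)
  also have "\<dots> \<le> exp (- h * lo) * 1 + (\<Sum>i<n. prob (L i))"
    using sum_prob_leads_le_1[of 0] by (intro add_right_mono mult_left_mono) auto
  also have "(\<Sum>i<n. prob (L i)) = prob (\<Union>i<n. L i)"
    using leads_disjoint[of 0] by (intro finite_measure_finite_Union[symmetric]) (auto simp: L_def disjoint_family_on_def)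
  also have "\<dots> \<le> prob (all_below lo {..<n div 2} \<union> all_below lo {n div 2..<n})"
  proof (rule finite_measure_mono)
    show "(\<Union>i<n. L i) \<subseteq> all_below lo {..<n div 2} \<union> all_below lo {n div 2..<n}"
    proof
      fix \<omega> assume "\<omega> \<in> (\<Union>i<n. L i)"
      then obtain i where i: "i < n" "\<omega> \<in> space M" "\<forall>j\<in>{..<n}-{i}. Y j \<omega> < lo"
        by (auto simp: L_def Z(4))
      thus "\<omega> \<in> all_below lo {..<n div 2} \<union> all_below lo {n div 2..<n}"
        by (cases "i < n div 2") (auto simp: all_below_def)
    qed
    show "all_below lo {..<n div 2} \<union> all_below lo {n div 2..<n} \<in> events"
    proof (intro sets.Un all_below_sets)
      show "{..<n div 2} \<subseteq> {..<n}" "{n div 2..<n} \<subseteq> {..<n}" by auto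
    qed
  qed
  also have "\<dots> \<le> 2 * exp (- (real (n div 2) * measure std_normal {lo..}))" by (rule prob_half_below)
  finally show ?thesis by simp
qed

text \<open>With the weak inequality some index dominates the rest even under ties, so the events
  \<open>W i\<close> cover the space. The tail above \<open>hi\<close> is lost once for each
  index.\<close>

lemma sum_prob_leads_ge:
  assumes n: "n \<ge> 2" and h: "0 \<le> h" and hi: "0 \<le> hi"
  shows "exp (- h * hi - h\<^sup>2 / 2) * (1 - n * exp (- hi\<^sup>2 / 2)) \<le> (\<Sum>i<n. prob (leads h i))"
proof -
  define Z where "Z i \<omega> = Max ((\<lambda>j. Y j \<omega>) ` ({..<n} - {i}))" for i \<omega>
  note Z = rest_Max[OF n, folded Z_def]
  define c where "c = exp (- h * hi - h\<^sup>2 / 2)"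
  define W where "W i = {\<omega> \<in> space M. Z i \<omega> \<le> Y i \<omega>}" for i
  have Zm [measurable]: "Z i \<in> borel_measurable M" if "i < n" for i
    using indep_var_rv2[OF Z(1)[OF that]] by simp
  have "1 = prob (\<Union>i<n. W i)"
  proof -
    have "space M \<subseteq> (\<Union>i<n. W i)"
    proof
      fix \<omega> assume \<omega>: "\<omega> \<in> space M"
      have "Max ((\<lambda>j. Y j \<omega>) ` {..<n}) \<in> (\<lambda>j. Y j \<omega>) ` {..<n}" using n by (intro Max_in) (auto simp: lessThan_empty_iff)
      then obtain i where i: "i < n" "Y i \<omega> = Max ((\<lambda>j. Y j \<omega>) ` {..<n})" by auto
      have "\<forall>j<n. j \<noteq> i \<longrightarrow> Y j \<omega> \<le> Y i \<omega>" unfolding i(2) by (auto intro!: Max_ge)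
      hence "Z i \<omega> \<le> Y i \<omega>" by (simp only: Z(3)[OF i(1)])
      thus "\<omega> \<in> (\<Union>i<n. W i)" using i(1) \<omega> unfolding W_def by blast
    qed
    moreover have "(\<Union>i<n. W i) \<subseteq> space M" by (auto simp: W_def)
    ultimately have "(\<Union>i<n. W i) = space M" by auto
    thus ?thesis by (simp add: prob_space)
  qed
  also have "\<dots> \<le> (\<Sum>i<n. prob (W i))"
    by (intro finite_measure_subadditive_finite) (auto simp: W_def)
  finally have W: "1 \<le> (\<Sum>i<n. prob (W i))" .
  have T: "measure std_normal {hi<..} \<le> exp (- hi\<^sup>2 / 2)"
    using std_normal_upper_tail_le[OF hi] by (simp add: std_normal_atLeast_eq_greaterThan)
  have "c * (1 - n * exp (- hi\<^sup>2 / 2)) \<le> c * ((\<Sum>i<n. prob (W i)) - (\<Sum>i<n. measure std_normal {hi<..}))"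
    using W T by (intro mult_left_mono diff_mono) (auto simp: c_def intro!: mult_left_mono)
  also have "\<dots> = (\<Sum>i<n. c * (prob (W i) - measure std_normal {hi<..}))"
    by (simp add: sum_distrib_left sum_subtractf right_diff_distrib)
  also have "\<dots> \<le> (\<Sum>i<n. prob (leads h i))"
  proof (rule sum_mono)
    fix i assume "i \<in> {..<n}"
    hence i: "i < n" by simp
    show "c * (prob (W i) - measure std_normal {hi<..}) \<le> prob (leads h i)"
      unfolding W_def c_def Z(2)[OF i] by (rule prob_exceeds_shifted_ge[OF Z(1)[OF i] std[OF i] h])
  qed
  finally show ?thesis by (simp add: c_def)
qed

lemma prob_Union_leads: "0 \<le> h \<Longrightarrow> prob (\<Union>i<n. leads h i) = (\<Sum>i<n. prob (leads h i))"
  by (intro finite_measure_finite_Union) (auto simp: leads_disjoint)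

end

text \<open>The exponent grows at least like n^(1 - \<delta>^2) up to a factor exp (- O(sqrt (ln
  n))), so a half-sample stays below \<delta> times the scale with vanishing probability.\<close>

lemma half_sample_tail_limit:
  fixes \<delta> :: real
  assumes d: "0 < \<delta>" "\<delta> < 1"
  shows "(\<lambda>n. exp (- (real (n div 2) * std_normal_density (\<delta> * sqrt (2 * ln (real n)) + 1)))) \<longlonglongrightarrow> 0"
proof -
  define a where "a n = sqrt (2 * ln (real n))" for n :: nat
  have a_pos: "a n > 0" if "n \<ge> 2" for n using that by (simp add: a_def)
  have d2: "\<delta>\<^sup>2 < 1" using d by (simp add: power_less_one_iff)
  have sq: "real (n div 2) * std_normal_density (\<delta> * a n + 1) \<ge> (1 / sqrt (2 * pi)) * ((real n - 1) / 2) * exp (- (\<delta>\<^sup>2 * ln n) - sqrt (2 * ln n) - 1)"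
    if n: "n \<ge> 2" for n
  proof -
    have "n \<le> 2 * (n div 2) + 1" by presburger
    hence "(real n - 1) / 2 \<le> real (n div 2)" by (simp add: field_simps flip: of_nat_le_iff[where 'a=real])
    moreover have "(1 / sqrt (2 * pi)) * exp (- (\<delta>\<^sup>2 * ln n) - sqrt (2 * ln n) - 1) \<le> std_normal_density (\<delta> * a n + 1)"
    proof -
      have "(\<delta> * a n + 1)\<^sup>2 / 2 = \<delta>\<^sup>2 * ln n + \<delta> * a n + 1 / 2"
        using n by (simp add: power2_sum power_mult_distrib a_def field_simps)
      also have "\<delta> * a n \<le> 1 * a n" using d a_pos[OF n] by (intro mult_right_mono) auto
      finally have "(\<delta> * a n + 1)\<^sup>2 / 2 \<le> \<delta>\<^sup>2 * ln n + sqrt (2 * ln n) + 1" by (simp add: a_def)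
      thus ?thesis by (simp add: std_normal_density_def divide_right_mono)
    qed
    ultimately have "((real n - 1) / 2) * ((1 / sqrt (2 * pi)) * exp (- (\<delta>\<^sup>2 * ln n) - sqrt (2 * ln n) - 1)) \<le> real (n div 2) * std_normal_density (\<delta> * a n + 1)"
      using n by (intro mult_mono) auto
    thus ?thesis by (simp add: mult_ac)
  qed
  have "filterlim (\<lambda>n. (1 / sqrt (2 * pi)) * ((real n - 1) / 2) * exp (- (\<delta>\<^sup>2 * ln (real n)) - sqrt (2 * ln (real n)) - 1)) at_top sequentially"
    using d2 by real_asymp
  hence "filterlim (\<lambda>n. real (n div 2) * std_normal_density (\<delta> * a n + 1)) at_top sequentially"
    by (rule filterlim_at_top_mono) (use sq in \<open>auto intro!: eventually_sequentiallyI[of 2]\<close>)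
  hence "((\<lambda>n. exp (- (real (n div 2) * std_normal_density (\<delta> * a n + 1)))) \<longlongrightarrow> 0) sequentially"
    by (intro filterlim_compose[OF exp_at_bot]) (simp only: filterlim_uminus_at_top)
  thus ?thesis by (simp add: a_def)
qed

text \<open>The levels \<open>lo\<close> and \<open>hi\<close> are (1 - \<epsilon>) and (1 +
  \<epsilon>) times the scale. For fixed \<epsilon> the two bounds tend to exp (- x * (1 -
  \<epsilon>)) and exp (- x * (1 + \<epsilon>)), and \<epsilon> is fixed before
  \<open>n\<close>.\<close>

lemma iid_normal_gap_limit:
  fixes M :: "nat \<Rightarrow> 'a measure" and Y :: "nat \<Rightarrow> nat \<Rightarrow> 'a \<Rightarrow> real"
  assumes iid: "\<And>n. n \<ge> 1 \<Longrightarrow> iid_normal (M n) n (Y n)" and x: "x > 0"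
  shows "(\<lambda>n. measure (M n) (\<Union>i<n. iid_normal.leads (M n) n (Y n) (x / sqrt (2 * ln (real n))) i)) \<longlonglongrightarrow> exp (- x)"
proof -
  define a where "a n = sqrt (2 * ln (real n))" for n :: nat
  define P where "P n = measure (M n) (\<Union>i<n. iid_normal.leads (M n) n (Y n) (x / a n) i)" for n
  have a_pos: "a n > 0" if "n \<ge> 2" for n using that by (simp add: a_def)
  have P: "P n = (\<Sum>i<n. measure (M n) (iid_normal.leads (M n) n (Y n) (x / a n) i))" if "n \<ge> 2" for n
    unfolding P_def using iid_normal.prob_Union_leads[OF iid, of n "x / a n"] a_pos[OF that] x that by simp
  have up: "P n \<le> exp (- x * (1 - \<epsilon>)) + 2 * exp (- (real (n div 2) * std_normal_density ((1 - \<epsilon>) * a n + 1)))"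
    if "n \<ge> 2" and e: "0 < \<epsilon>" "\<epsilon> < 1" for n \<epsilon>
  proof -
    interpret iid_normal "M n" n "Y n" using iid that by simp
    have "std_normal_density ((1 - \<epsilon>) * a n + 1) \<le> measure std_normal {(1 - \<epsilon>) * a n..}"
      using e a_pos[OF that(1)] by (intro std_normal_upper_tail_ge) simp
    hence "exp (- (real (n div 2) * measure std_normal {(1 - \<epsilon>) * a n..})) \<le> exp (- (real (n div 2) * std_normal_density ((1 - \<epsilon>) * a n + 1)))"
      by (simp add: mult_left_mono)
    moreover have "exp (- (x / a n) * ((1 - \<epsilon>) * a n)) = exp (- x * (1 - \<epsilon>))"
      using a_pos[OF that(1)] by simp
    ultimately show ?thesis
      using sum_prob_leads_le[OF that(1), of "x / a n" "(1 - \<epsilon>) * a n"] a_pos[OF that(1)] x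
      unfolding P[OF that(1)] by (smt (verit) divide_nonneg_pos)
  qed
  have low: "exp (- x * (1 + \<epsilon>) - (x / a n)\<^sup>2 / 2) * (1 - n * exp (- ((1 + \<epsilon>) * a n)\<^sup>2 / 2)) \<le> P n"
    if "n \<ge> 2" and e: "0 < \<epsilon>" for n \<epsilon>
  proof -
    interpret iid_normal "M n" n "Y n" using iid that by simp
    show ?thesis
      using sum_prob_leads_ge[OF that(1), of "x / a n" "(1 + \<epsilon>) * a n"] a_pos[OF that(1)] x e
      unfolding P[OF that(1)] by simp
  qed
  have up_lim: "(\<lambda>n. exp (- x * (1 - \<epsilon>)) + 2 * exp (- (real (n div 2) * std_normal_density ((1 - \<epsilon>) * a n + 1)))) \<longlonglongrightarrow> exp (- x * (1 - \<epsilon>)) + 2 * 0"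
    if e: "0 < \<epsilon>" "\<epsilon> < 1" for \<epsilon>
    using half_sample_tail_limit[of "1 - \<epsilon>"] e by (intro tendsto_add tendsto_mult tendsto_const) (simp add: a_def)
  have low_lim: "(\<lambda>n. exp (- x * (1 + \<epsilon>) - (x / a n)\<^sup>2 / 2) * (1 - n * exp (- ((1 + \<epsilon>) * a n)\<^sup>2 / 2))) \<longlonglongrightarrow> exp (- x * (1 + \<epsilon>) - 0\<^sup>2 / 2) * (1 - 0)"
    if e: "0 < \<epsilon>" for \<epsilon>
  proof (intro tendsto_mult tendsto_diff tendsto_const tendsto_exp tendsto_divide tendsto_power)
    show "(\<lambda>n. x / a n) \<longlonglongrightarrow> 0" unfolding a_def by real_asymp
    define \<delta> where "\<delta> = (1 + \<epsilon>)\<^sup>2"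
    have d: "\<delta> > 1" using e by (simp add: \<delta>_def power2_eq_square algebra_simps add_pos_pos)
    have "(\<lambda>n. real n * exp (- (\<delta> * ln (real n)))) \<longlonglongrightarrow> 0" using d by real_asymp
    moreover have "\<forall>\<^sub>F n in sequentially. real n * exp (- (\<delta> * ln (real n))) = real n * exp (- ((1 + \<epsilon>) * a n)\<^sup>2 / 2)"
      by (rule eventually_sequentiallyI[of 2]) (simp add: a_def \<delta>_def power_mult_distrib)
    ultimately show "(\<lambda>n. real n * exp (- ((1 + \<epsilon>) * a n)\<^sup>2 / 2)) \<longlonglongrightarrow> 0" by (rule Lim_transform_eventually)
  qed auto
  have "P \<longlonglongrightarrow> exp (- x)"
  proof (rule LIMSEQ_I)
    fix e :: real assume e: "e > 0"
    have c1: "((\<lambda>\<epsilon>. exp (- x * (1 - \<epsilon>)) + 2 * 0) \<longlongrightarrow> exp (- x * (1 - 0)) + 2 * 0) (at_right 0)"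
      by (intro tendsto_intros)
    have c2: "((\<lambda>\<epsilon>. exp (- x * (1 + \<epsilon>) - 0\<^sup>2 / 2) * (1 - 0)) \<longlongrightarrow> exp (- x * (1 + 0) - 0\<^sup>2 / 2) * (1 - 0)) (at_right 0)"
      by (intro tendsto_intros)
    have "\<forall>\<^sub>F \<epsilon> in at_right 0. exp (- x * (1 - \<epsilon>)) + 2 * 0 < exp (- x) + e \<and> exp (- x) - e < exp (- x * (1 + \<epsilon>) - 0\<^sup>2 / 2) * (1 - 0) \<and> \<epsilon> \<in> {0<..<1::real}"
      using order_tendstoD(2)[OF c1, of "exp (-x) + e"] order_tendstoD(1)[OF c2, of "exp (-x) - e"] e
      by (intro eventually_conj eventually_at_right_real) auto
    then obtain \<epsilon> where \<epsilon>: "exp (- x * (1 - \<epsilon>)) + 2 * 0 < exp (- x) + e" "exp (- x) - e < exp (- x * (1 + \<epsilon>) - 0\<^sup>2 / 2) * (1 - 0)" "0 < \<epsilon>" "\<epsilon> < 1"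
      using eventually_happens'[OF trivial_limit_at_right_real] by auto
    have "\<forall>\<^sub>F n in sequentially. exp (- x * (1 - \<epsilon>)) + 2 * exp (- (real (n div 2) * std_normal_density ((1 - \<epsilon>) * a n + 1))) < exp (- x) + e"
      using order_tendstoD(2)[OF up_lim[OF \<epsilon>(3,4)] \<epsilon>(1)] .
    moreover have "\<forall>\<^sub>F n in sequentially. exp (- x) - e < exp (- x * (1 + \<epsilon>) - (x / a n)\<^sup>2 / 2) * (1 - n * exp (- ((1 + \<epsilon>) * a n)\<^sup>2 / 2))"
      using order_tendstoD(1)[OF low_lim[OF \<epsilon>(3)] \<epsilon>(2)] .
    moreover have "\<forall>\<^sub>F n in sequentially. n \<ge> (2::nat)" by (rule eventually_ge_at_top)
    ultimately have "\<forall>\<^sub>F n in sequentially. norm (P n - exp (- x)) < e"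
    proof eventually_elim
      case (elim n)
      show ?case using elim up[OF elim(3) \<epsilon>(3,4)] low[OF elim(3) \<epsilon>(3)] by (simp add: abs_less_iff)
    qed
    thus "\<exists>no. \<forall>n\<ge>no. norm (P n - exp (- x)) < e" by (simp add: eventually_sequentially)
  qed
  thus ?thesis by (simp add: P_def[abs_def] a_def)
qed

section \<open>Row sums, entries and squared entries of a GOE matrix\<close>

lemma sum_row_delta:
  "m < n \<Longrightarrow> (\<Sum>k<n. \<Sum>l<n. if k = m then f l else 0) = (\<Sum>l<n. f l)" for f :: "nat \<Rightarrow> real"
proof -
  have "(\<Sum>k<n. \<Sum>l<n. if k = m then f l else 0) = (\<Sum>k<n. if k = m then (\<Sum>l<n. f l) else 0)"
    by (intro sum.cong) auto
  thus "m < n \<Longrightarrow> ?thesis" by simp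
qed

context iid_normal
begin

lemma prob_max_abs:
  assumes "0 \<le> t"
  shows "prob {\<omega> \<in> space M. \<exists>i<n. t \<le> \<bar>Y i \<omega>\<bar>} \<le> n * (2 * exp (- t\<^sup>2 / 2))"
proof -
  have "{\<omega> \<in> space M. \<exists>i<n. t \<le> \<bar>Y i \<omega>\<bar>} = (\<Union>i<n. {\<omega> \<in> space M. t \<le> \<bar>Y i \<omega>\<bar>})" by auto
  also have "prob \<dots> \<le> (\<Sum>i<n. prob {\<omega> \<in> space M. t \<le> \<bar>Y i \<omega>\<bar>})"
    by (intro finite_measure_subadditive_finite) auto
  also have "\<dots> \<le> (\<Sum>i<n. 2 * exp (- t\<^sup>2 / 2))"
  proof (rule sum_mono)
    fix i assume "i \<in> {..<n}"
    thus "prob {\<omega> \<in> space M. t \<le> \<bar>Y i \<omega>\<bar>} \<le> 2 * exp (- t\<^sup>2 / 2)"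
      using prob_Y[of i "{y. t \<le> \<bar>y\<bar>}"] std_normal_abs_tail[OF assms] by simp
  qed
  finally show ?thesis by simp
qed

lemma card_exceedances: "real (card {i. i < n \<and> t \<le> Y i \<omega>}) = (\<Sum>i<n. if t \<le> Y i \<omega> then 1 else 0)"
proof -
  have "{..<n} \<inter> {i. t \<le> Y i \<omega>} = {i. i < n \<and> t \<le> Y i \<omega>}" by auto
  thus ?thesis by (simp add: sum.If_cases)
qed

lemma card_exceedances_measurable [measurable]:
  "(\<lambda>\<omega>. real (card {i. i < n \<and> t \<le> Y i \<omega>})) \<in> borel_measurable M"
  unfolding card_exceedances by measurable

lemma prob_card_exceedances:
  assumes t: "0 \<le> t" and s: "s > 0"
  shows "prob {\<omega> \<in> space M. s \<le> real (card {i. i < n \<and> t \<le> Y i \<omega>})} \<le> n * exp (- t\<^sup>2 / 2) / s"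
proof -
  define B where "B i = {\<omega> \<in> space M. t \<le> Y i \<omega>}" for i
  have Bm [measurable]: "B i \<in> events" if "i < n" for i unfolding B_def using that by measurable
  have card: "real (card {i. i < n \<and> t \<le> Y i \<omega>}) = (\<Sum>i<n. indicator (B i) \<omega>)" if "\<omega> \<in> space M" for \<omega>
    unfolding card_exceedances using that by (intro sum.cong) (auto simp: B_def)
  have int: "integrable M (\<lambda>\<omega>. \<Sum>i<n. indicator (B i) \<omega> :: real)"
    by (intro Bochner_Integration.integrable_sum integrable_real_indicator) (auto simp: emeasure_eq_measure)
  have "prob {\<omega> \<in> space M. s \<le> real (card {i. i < n \<and> t \<le> Y i \<omega>})} = prob {\<omega> \<in> space M. s \<le> (\<Sum>i<n. indicator (B i) \<omega>)}"
    by (intro arg_cong[where f=prob] Collect_cong) (use card in auto)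
  also have "\<dots> \<le> expectation (\<lambda>\<omega>. \<Sum>i<n. indicator (B i) \<omega>) / s"
    by (rule integral_Markov_inequality_measure[OF int sets.top _ s]) (simp add: sum_nonneg)
  also have "expectation (\<lambda>\<omega>. \<Sum>i<n. indicator (B i) \<omega>) = (\<Sum>i<n. prob (B i))"
    by (subst Bochner_Integration.integral_sum) (auto simp: emeasure_eq_measure intro!: sum.cong integrable_real_indicator)
  also have "\<dots> \<le> (\<Sum>i<n. exp (- t\<^sup>2 / 2))"
  proof (rule sum_mono)
    fix i assume "i \<in> {..<n}"
    thus "prob (B i) \<le> exp (- t\<^sup>2 / 2)"
      using prob_Y[of i "{t..}"] std_normal_upper_tail_le[OF t] by (simp add: B_def)
  qed
  finally show ?thesis using s by (simp add: divide_right_mono)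
qed

end

context GOE
begin

definition row_sum :: "nat \<Rightarrow> 'a \<Rightarrow> real" where
  "row_sum i \<omega> = (\<Sum>j<n. A \<omega> $$ (i,j))"

text \<open>The row sums have covariance \<open>I + J / n\<close> with \<open>J\<close> the all-ones matrix; subtracting this multiple of
  their total makes them independent without changing their differences.\<close>

definition total_shift :: "'a \<Rightarrow> real" where
  "total_shift \<omega> = (1 - 1 / sqrt 2) / n * (\<Sum>i<n. row_sum i \<omega>)"

definition white_row_sum :: "nat \<Rightarrow> 'a \<Rightarrow> real" where
  "white_row_sum i \<omega> = lin_form n (\<lambda>k l. ((if k = i then 1 else 0) + (if l = i then 1 else 0)) / 2 - (1 - 1 / sqrt 2) / n) (A \<omega>)"

lemma row_sum_eq:
  assumes "\<omega> \<in> space M" "i < n"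
  shows "row_sum i \<omega> = white_row_sum i \<omega> + total_shift \<omega>"
proof -
  define c where "c = (1 - 1 / sqrt 2) / real n"
  have "white_row_sum i \<omega> = (\<Sum>k<n. \<Sum>l<n. (if k = i then A \<omega> $$ (i,l) / 2 else 0) + (if l = i then A \<omega> $$ (k,i) / 2 else 0) - c * A \<omega> $$ (k,l))"
    unfolding white_row_sum_def lin_form_def c_def[symmetric]
    by (intro sum.cong refl) (auto simp: algebra_simps)
  also have "\<dots> = (\<Sum>l<n. A \<omega> $$ (i,l) / 2) + (\<Sum>k<n. A \<omega> $$ (k,i) / 2) - c * (\<Sum>k<n. \<Sum>l<n. A \<omega> $$ (k,l))"
    using assms by (simp add: sum.distrib sum_subtractf sum_distrib_left sum_row_delta)
  also have "(\<Sum>k<n. A \<omega> $$ (k,i) / 2) = (\<Sum>k<n. A \<omega> $$ (i,k) / 2)"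
    by (intro sum.cong refl) (use A_sym assms in auto)
  finally show ?thesis using assms by (simp add: total_shift_def row_sum_def c_def flip: sum_divide_distrib)
qed

lemma iid_white_row_sum: "iid_normal M n white_row_sum"
proof -
  define w where "w = 1 - 1 / sqrt (2::real)"
  define K where "K i k l = ((if k = i then 1 else 0) + (if l = i then 1 else 0)) / 2 - w / real n" for i k l :: nat
  \<comment> \<open>The inner product of two different coefficient matrices is 1 / 2 - 2 * w + w^2,
    and 1 - 1 / sqrt 2 is a root of it.\<close>
  have w: "1 / 2 - 2 * w + w\<^sup>2 = 0" by (simp add: w_def power2_eq_square field_simps)
  have orth: "(\<Sum>k<n. \<Sum>l<n. K i k l * K j k l) = (if i = j then n / 2 else 0)" if "i < n" "j < n" for i j
  proof -
    define e where "e = (if i = j then 1 else 0 :: real)"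
    define c where "c = w / real n"
    have "(\<Sum>k<n. \<Sum>l<n. K i k l * K j k l) = (\<Sum>k<n. \<Sum>l<n.
       (if k = i then e / 4 - c / 2 else 0) + (if l = i then e / 4 - c / 2 else 0)
       + (if k = j then - c / 2 else 0) + (if l = j then - c / 2 else 0)
       + (if k = i then (if l = j then 1 / 4 else 0) else 0) + (if k = j then (if l = i then 1 / 4 else 0) else 0) + c * c)"
      unfolding K_def c_def[symmetric] e_def by (intro sum.cong refl) (auto simp: field_simps)
    also have "\<dots> = real n * (e / 4 - c / 2) + real n * (e / 4 - c / 2) + real n * (- c / 2) + real n * (- c / 2)
        + 1 / 4 + 1 / 4 + real n * (real n * (c * c))"
    proof -
      have R: "(\<Sum>k<n. \<Sum>l<n. if k = m then x else 0) = real n * x" if "m < n" for m and x :: real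
        by (subst sum_row_delta[OF that]) simp
      have C: "(\<Sum>k<n. \<Sum>l<n. if l = m then x else 0) = real n * x" if "m < n" for m and x :: real
        using that by simp
      have D: "(\<Sum>k<n. \<Sum>l<n. if k = m then (if l = p then x else 0) else 0) = x" if "m < n" "p < n" for m p and x :: real
        by (subst sum_row_delta[OF that(1)]) (simp add: that)
      show ?thesis unfolding sum.distrib R[OF that(1)] R[OF that(2)] C[OF that(1)] C[OF that(2)] D[OF that] D[OF that(2,1)] by simp
    qed
    also have "\<dots> = real n * e / 2 + (1 / 2 - 2 * w + w\<^sup>2)"
      using n_pos by (simp add: c_def power2_eq_square field_simps)
    also have "\<dots> = (if i = j then n / 2 else 0)" unfolding w by (simp add: e_def)
    finally show ?thesis .
  qed
  have Y: "white_row_sum = (\<lambda>i \<omega>. lin_form n (K i) (A \<omega>))"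
    unfolding white_row_sum_def K_def w_def by simp
  have symK: "K i k l = K i l k" for i k l by (simp add: K_def)
  show ?thesis
  proof
    show "indep_vars (\<lambda>_. borel) white_row_sum {..<n}"
      unfolding Y by (rule orthogonal_lin_forms(1)) (use orth symK in auto)
    fix i assume "i < n"
    thus "distr M borel (white_row_sum i) = std_normal"
      unfolding Y using orthogonal_lin_forms(2)[of "{..<n}" K i] orth symK by auto
  qed
qed

sublocale white: iid_normal M n white_row_sum by (rule iid_white_row_sum)

section \<open>Entries of the matrix and of its square\<close>

definition entry_event :: "real \<Rightarrow> 'a set" where
  "entry_event \<delta> = {\<omega> \<in> space M. \<forall>i\<in>{..<n}. \<forall>j\<in>{..<n}. \<bar>A \<omega> $$ (i,j)\<bar> \<le> \<delta>}"

lemma entry_event_sets [measurable]: "entry_event \<delta> \<in> events"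
  unfolding entry_event_def
proof (intro sets.sets_Collect_finite_All)
  fix i j assume "i \<in> {..<n}" "j \<in> {..<n}"
  hence [measurable]: "(\<lambda>\<omega>. A \<omega> $$ (i,j)) \<in> borel_measurable M" by (intro A_measurable) auto
  show "{\<omega> \<in> space M. \<bar>A \<omega> $$ (i,j)\<bar> \<le> \<delta>} \<in> events" by measurable
qed auto

lemma prob_entry:
  assumes ij: "i < n" "j < n" and d: "\<delta> > 0"
  shows "prob {\<omega> \<in> space M. \<delta> \<le> \<bar>A \<omega> $$ (i,j)\<bar>} \<le> 2 * exp (- (real n * \<delta>\<^sup>2 / 4))"
proof -
  \<comment> \<open>The symmetrized elementary matrix makes diagonal and off-diagonal entries one
    case of the tail bound.\<close>
  define K where "K k l = ((if k = i \<and> l = j then 1 else 0) + (if k = j \<and> l = i then 1 else 0 :: real)) / 2" for k l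
  have s1: "(\<Sum>k<n. \<Sum>l<n. if k = p \<and> l = q then f k l else 0) = f p q" if "p < n" "q < n" for p q and f :: "nat \<Rightarrow> nat \<Rightarrow> real"
  proof -
    have "(\<Sum>k<n. \<Sum>l<n. if k = p \<and> l = q then f k l else 0) = (\<Sum>k<n. if k = p then (\<Sum>l<n. if l = q then f p l else 0) else 0)"
      by (intro sum.cong) auto
    thus ?thesis using that by simp
  qed
  have "lin_form n K (A \<omega>) = A \<omega> $$ (i,j)" if "\<omega> \<in> space M" for \<omega>
  proof -
    have "lin_form n K (A \<omega>) = (\<Sum>k<n. \<Sum>l<n. (if k = i \<and> l = j then A \<omega> $$ (k,l) / 2 else 0) + (if k = j \<and> l = i then A \<omega> $$ (k,l) / 2 else 0))"
      unfolding lin_form_def K_def by (simp add: add_divide_distrib distrib_right if_distrib[of "\<lambda>x. x / 2"] if_distrib[of "\<lambda>x. x * _"] cong: if_cong)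
    also have "\<dots> = A \<omega> $$ (i,j) / 2 + A \<omega> $$ (j,i) / 2"
      unfolding sum.distrib using s1[of i j "\<lambda>k l. A \<omega> $$ (k,l) / 2"] s1[of j i "\<lambda>k l. A \<omega> $$ (k,l) / 2"] ij by simp
    finally show ?thesis using A_sym[OF that ij] by simp
  qed
  hence "prob {\<omega> \<in> space M. \<delta> \<le> \<bar>A \<omega> $$ (i,j)\<bar>} = prob {\<omega> \<in> space M. \<delta> \<le> \<bar>lin_form n K (A \<omega>)\<bar>}"
    by (intro arg_cong[where f=prob] Collect_cong) auto
  also have "\<dots> \<le> 2 * exp (- (real n * \<delta>\<^sup>2 / (4 * 1)))"
  proof (rule lin_form_tail)
    show "K k l = K l k" for k l by (simp add: K_def add.commute conj_commute)
    have "(\<Sum>k<n. \<Sum>l<n. (K k l)\<^sup>2) \<le> (\<Sum>k<n. \<Sum>l<n. (if k = i \<and> l = j then 1 / 2 else 0) + (if k = j \<and> l = i then 1 / 2 else 0))"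
    proof (intro sum_mono)
      fix k l
      have pq: "((p + q) / 2)\<^sup>2 \<le> p / 2 + q / 2" if "p \<in> {0,1}" "q \<in> {0,1}" for p q :: real
        using that by (auto simp: power2_eq_square)
      have i2: "(if P then 1 / 2 else 0) = (if P then 1 else 0 :: real) / 2" for P by simp
      show "(K k l)\<^sup>2 \<le> (if k = i \<and> l = j then 1 / 2 else 0) + (if k = j \<and> l = i then 1 / 2 else 0)"
        unfolding K_def i2 by (rule pq) auto
    qed
    also have "\<dots> = 1"
      unfolding sum.distrib using s1[of i j "\<lambda>_ _. 1 / 2"] s1[of j i "\<lambda>_ _. 1 / 2"] ij by simp
    finally show "(\<Sum>k<n. \<Sum>l<n. (K k l)\<^sup>2) \<le> 1" .
  qed (use d in auto)
  finally show ?thesis by simp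
qed

lemma prob_entry_event:
  assumes d: "\<delta> > 0"
  shows "prob (space M - entry_event \<delta>) \<le> real n * (real n * (2 * exp (- (real n * \<delta>\<^sup>2 / 4))))"
proof -
  define B where "B i j = {\<omega> \<in> space M. \<delta> \<le> \<bar>A \<omega> $$ (i,j)\<bar>}" for i j
  have Bm: "B i j \<in> events" if "i < n" "j < n" for i j
  proof -
    have [measurable]: "(\<lambda>\<omega>. A \<omega> $$ (i,j)) \<in> borel_measurable M" using that by (intro A_measurable)
    show ?thesis unfolding B_def by measurable
  qed
  have "prob (space M - entry_event \<delta>) \<le> prob (\<Union>i<n. \<Union>j<n. B i j)"
  proof (rule finite_measure_mono)
    show "space M - entry_event \<delta> \<subseteq> (\<Union>i<n. \<Union>j<n. B i j)"
      by (auto simp: entry_event_def B_def not_le intro: less_imp_le)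
    show "(\<Union>i<n. \<Union>j<n. B i j) \<in> events" by (intro sets.finite_UN Bm) auto
  qed
  also have "\<dots> \<le> (\<Sum>i<n. prob (\<Union>j<n. B i j))"
    using Bm by (intro finite_measure_subadditive_finite) (auto intro!: sets.finite_UN)
  also have "\<dots> \<le> (\<Sum>i<n. \<Sum>j<n. prob (B i j))"
    using Bm by (intro sum_mono finite_measure_subadditive_finite) auto
  also have "\<dots> \<le> (\<Sum>i<n. \<Sum>j<n. 2 * exp (- (real n * \<delta>\<^sup>2 / 4)))"
    unfolding B_def by (intro sum_mono prob_entry d) auto
  finally show ?thesis by simp
qed

text \<open>For a unit vector the coordinates k and l of the image have covariance ((if k = l then 1
  else 0) + x k * x l) / n, so those where \<open>x\<close> vanishes are independent. The family
  \<open>h'\<close> of linear forms is separate from \<open>h\<close> because their agreement rests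
  on the symmetry of \<open>A\<close>, which is known on the space only.\<close>

lemma image_coordinates_iid:
  assumes x: "sq_norm n x = 1"
  defines "I \<equiv> {k. k < n \<and> x k = 0}"
  defines "h \<equiv> \<lambda>k \<omega>. sqrt n * mat_vec n (\<lambda>i j. A \<omega> $$ (i,j)) x k"
  shows "\<exists>h'. indep_vars (\<lambda>_. borel) h' I \<and> (\<forall>k\<in>I. distr M borel (h' k) = std_normal) \<and> (\<forall>k\<in>I. \<forall>\<omega>\<in>space M. h' k \<omega> = h k \<omega>)"
proof -
  define K where "K k i j = sqrt n / 2 * ((if i = k then x j else 0) + (if j = k then x i else 0))" for k i j :: nat
  have xx: "(\<Sum>i<n. x i * x i) = 1" using x by (simp only: sq_norm_def power2_eq_square)
  have orth: "(\<Sum>i<n. \<Sum>j<n. K k i j * K l i j) = (if k = l then n / 2 else 0)" if kl: "k \<in> I" "l \<in> I" for k l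
  proof -
    have k0: "x k = 0" "x l = 0" "k < n" "l < n" using kl by (auto simp: I_def)
    define e where "e = (if k = l then 1 else 0 :: real)"
    have "(\<Sum>i<n. \<Sum>j<n. K k i j * K l i j) = (\<Sum>i<n. \<Sum>j<n.
        (if i = k then real n / 4 * (e * (x j * x j)) else 0) + (if j = k then real n / 4 * (e * (x i * x i)) else 0))"
    proof (intro sum.cong refl)
      fix i j
      have "K k i j * K l i j = (sqrt n * sqrt n) / 4 * (((if i = k then x j else 0) + (if j = k then x i else 0)) * ((if i = l then x j else 0) + (if j = l then x i else 0)))"
        unfolding K_def by (simp add: mult_ac)
      also have "((if i = k then x j else 0) + (if j = k then x i else 0)) * ((if i = l then x j else 0) + (if j = l then x i else 0))
          = (if i = k then e * (x j * x j) else 0) + (if j = k then e * (x i * x i) else 0)"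
        using k0 by (auto simp: e_def)
      finally show "K k i j * K l i j = (if i = k then real n / 4 * (e * (x j * x j)) else 0) + (if j = k then real n / 4 * (e * (x i * x i)) else 0)"
        by (auto simp: distrib_left)
    qed
    also have "\<dots> = (\<Sum>j<n. real n / 4 * (e * (x j * x j))) + (\<Sum>i<n. real n / 4 * (e * (x i * x i)))"
      using k0 by (simp add: sum.distrib sum_row_delta)
    also have "(\<Sum>j<n. real n / 4 * (e * (x j * x j))) = real n / 4 * (e * (\<Sum>j<n. x j * x j))"
      by (simp only: sum_distrib_left)
    finally have "(\<Sum>i<n. \<Sum>j<n. K k i j * K l i j) = real n / 2 * e" unfolding xx by simp
    also have "real n / 2 * e = (if k = l then n / 2 else 0)" by (simp add: e_def)
    finally show ?thesis .
  qed
  have symK: "K k i j = K k j i" for k i j by (simp add: K_def)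
  have fI: "finite I" by (simp add: I_def)
  have eq: "lin_form n (K k) (A \<omega>) = h k \<omega>" if k: "k \<in> I" and \<omega>: "\<omega> \<in> space M" for k \<omega>
  proof -
    have kn: "k < n" using k by (simp add: I_def)
    have "lin_form n (K k) (A \<omega>) = sqrt n / 2 * (\<Sum>i<n. \<Sum>j<n. (if i = k then A \<omega> $$ (k,j) * x j else 0) + (if j = k then A \<omega> $$ (i,k) * x i else 0))"
      unfolding lin_form_def sum_distrib_left by (intro sum.cong refl) (auto simp: K_def algebra_simps)
    also have "(\<Sum>i<n. \<Sum>j<n. (if i = k then A \<omega> $$ (k,j) * x j else 0) + (if j = k then A \<omega> $$ (i,k) * x i else 0))
        = (\<Sum>i<n. if i = k then (\<Sum>j<n. A \<omega> $$ (k,j) * x j) else 0) + (\<Sum>i<n. A \<omega> $$ (i,k) * x i)"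
      using kn by (simp add: sum.distrib sum_row_delta)
    also have "(\<Sum>i<n. A \<omega> $$ (i,k) * x i) = (\<Sum>j<n. A \<omega> $$ (k,j) * x j)"
      by (intro sum.cong refl) (use A_sym[OF \<omega>] kn in auto)
    finally show ?thesis using kn by (simp add: h_def mat_vec_def)
  qed
  show ?thesis
    by (intro exI[of _ "\<lambda>k \<omega>. lin_form n (K k) (A \<omega>)"] conjI ballI eq orthogonal_lin_forms[OF fI] orth) (auto simp: symK)
qed

text \<open>The unit vectors \<open>e\<^sub>i\<close> and \<open>(e\<^sub>i \<plusminus> e\<^sub>j) / \<surd>2\<close>; by polarization, the norms of their images determine
  the entries of \<open>A\<^sup>2\<close>.\<close>

definition test_vec :: "nat \<Rightarrow> nat \<Rightarrow> real \<Rightarrow> nat \<Rightarrow> real" where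
  "test_vec i j c k = (if i = j then (if k = i then 1 else 0)
     else ((if k = i then 1 else 0) + c * (if k = j then 1 else 0)) / sqrt 2)"

lemma sq_norm_test_vec:
  assumes "i < n" "j < n" "c \<in> {-1,1}"
  shows "sq_norm n (test_vec i j c) = 1"
proof (cases "i = j")
  case True
  have "sq_norm n (test_vec i j c) = (\<Sum>k<n. if k = i then 1 else 0)"
    unfolding sq_norm_def by (intro sum.cong) (use True in \<open>auto simp: test_vec_def\<close>)
  thus ?thesis using assms by simp
next
  case False
  have "sq_norm n (test_vec i j c) = (\<Sum>k<n. (if k = i then 1 / 2 else 0) + (if k = j then 1 / 2 else 0))"
    unfolding sq_norm_def by (intro sum.cong) (use False assms in \<open>auto simp: test_vec_def power_divide\<close>)
  thus ?thesis using assms by (simp add: sum.distrib)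
qed

definition zero_set :: "(nat \<Rightarrow> real) \<Rightarrow> nat set" where
  "zero_set x = {k. k < n \<and> x k = 0}"

text \<open>The sums leave out the at most two coordinates where the test vector is nonzero, since
  the image is correlated there; \<open>entry_event\<close> controls those.\<close>

definition image_event :: "real \<Rightarrow> 'a set" where
  "image_event v = {\<omega> \<in> space M. \<forall>i\<in>{..<n}. \<forall>j\<in>{..<n}. \<forall>c\<in>{-1,1}.
     \<bar>\<Sum>k\<in>zero_set (test_vec i j c). (mat_vec n (\<lambda>i j. A \<omega> $$ (i,j)) (test_vec i j c) k)\<^sup>2 - 1 / n\<bar> \<le> v}"

lemma mat_vec_measurable [measurable]: "k < n \<Longrightarrow> (\<lambda>\<omega>. mat_vec n (\<lambda>i j. A \<omega> $$ (i,j)) x k) \<in> borel_measurable M"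
  unfolding mat_vec_def by (intro borel_measurable_sum borel_measurable_times borel_measurable_const A_measurable) auto

lemma image_sum_measurable [measurable]:
  "(\<lambda>\<omega>. \<Sum>k\<in>zero_set x. (mat_vec n (\<lambda>i j. A \<omega> $$ (i,j)) x k)\<^sup>2 - 1 / n) \<in> borel_measurable M"
  unfolding zero_set_def by (intro borel_measurable_sum borel_measurable_diff borel_measurable_power mat_vec_measurable borel_measurable_const) auto

lemma image_event_sets [measurable]: "image_event v \<in> events"
  unfolding image_event_def by (intro sets.sets_Collect_finite_All) auto

lemma prob_image:
  assumes x: "sq_norm n x = 1" and n: "n \<ge> 16"
  shows "prob {\<omega> \<in> space M. v \<le> \<bar>\<Sum>k\<in>zero_set x. (mat_vec n (\<lambda>i j. A \<omega> $$ (i,j)) x k)\<^sup>2 - 1 / n\<bar>} \<le> 2 * exp (4 - sqrt n * v)"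
proof -
  define I where "I = zero_set x"
  define Q where "Q \<omega> = (\<Sum>k\<in>I. (mat_vec n (\<lambda>i j. A \<omega> $$ (i,j)) x k)\<^sup>2 - 1 / n)" for \<omega>
  obtain h where h: "indep_vars (\<lambda>_. borel) h I" "\<And>k. k \<in> I \<Longrightarrow> distr M borel (h k) = std_normal"
     "\<And>k \<omega>. k \<in> I \<Longrightarrow> \<omega> \<in> space M \<Longrightarrow> h k \<omega> = sqrt n * mat_vec n (\<lambda>i j. A \<omega> $$ (i,j)) x k"
    using image_coordinates_iid[OF x] unfolding I_def zero_set_def by blast
  have fI: "finite I" by (simp add: I_def zero_set_def)
  have nQ: "(\<Sum>k\<in>I. (h k \<omega>)\<^sup>2 - 1) = real n * Q \<omega>" if "\<omega> \<in> space M" for \<omega>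
    unfolding Q_def sum_distrib_left using n that by (intro sum.cong refl) (simp add: h(3) power_mult_distrib right_diff_distrib)
  have [measurable]: "Q \<in> borel_measurable M" unfolding Q_def I_def by measurable
  have one: "prob {\<omega> \<in> space M. v \<le> c * Q \<omega>} \<le> exp (4 - sqrt n * v)" if c: "c \<in> {-1,1}" for c
  proof -
    \<comment> \<open>The exponential parameter 1 / sqrt n keeps the quadratic cost 4 * s^2 * card I
      below 4, and \<open>n \<ge> 16\<close> puts it into the range of
      \<open>chi_square_tail\<close>.\<close>
    have s: "1 / sqrt n \<le> 1 / 4"
    proof -
      have "sqrt 16 \<le> sqrt (real n)" using n by (intro real_sqrt_le_mono) simp
      thus ?thesis by (intro frac_le) auto
    qed
    have "prob {\<omega> \<in> space M. n * v \<le> c * (\<Sum>k\<in>I. (h k \<omega>)\<^sup>2 - 1)} \<le> exp (4 * (1 / sqrt n)\<^sup>2 * card I - 1 / sqrt n * (n * v))"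
      by (rule chi_square_tail[OF fI h(1,2) _ s c]) auto
    also have "{\<omega> \<in> space M. n * v \<le> c * (\<Sum>k\<in>I. (h k \<omega>)\<^sup>2 - 1)} = {\<omega> \<in> space M. v \<le> c * Q \<omega>}"
    proof (intro Collect_cong conj_cong refl)
      fix \<omega> assume "\<omega> \<in> space M"
      hence "c * (\<Sum>k\<in>I. (h k \<omega>)\<^sup>2 - 1) = real n * (c * Q \<omega>)" by (simp add: nQ)
      note eq = this
      show "(n * v \<le> c * (\<Sum>k\<in>I. (h k \<omega>)\<^sup>2 - 1)) = (v \<le> c * Q \<omega>)" unfolding eq using n by simp
    qed
    also have "exp (4 * (1 / sqrt n)\<^sup>2 * card I - 1 / sqrt n * (n * v)) \<le> exp (4 - sqrt n * v)"
    proof -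
      have "card I \<le> card {..<n}" by (intro card_mono) (auto simp: I_def zero_set_def)
      hence "4 * (1 / sqrt n)\<^sup>2 * card I \<le> 4" using n by (simp add: power_divide field_simps)
      moreover have "1 / sqrt n * (n * v) = (real n / sqrt n) * v" by simp
      hence "1 / sqrt n * (n * v) = sqrt n * v" by (subst (asm) real_div_sqrt) auto
      ultimately show ?thesis by simp
    qed
    finally show ?thesis .
  qed
  have "{\<omega> \<in> space M. v \<le> \<bar>Q \<omega>\<bar>} \<subseteq> {\<omega> \<in> space M. v \<le> 1 * Q \<omega>} \<union> {\<omega> \<in> space M. v \<le> -1 * Q \<omega>}" by (auto simp: abs_if)
  hence "prob {\<omega> \<in> space M. v \<le> \<bar>Q \<omega>\<bar>} \<le> prob ({\<omega> \<in> space M. v \<le> 1 * Q \<omega>} \<union> {\<omega> \<in> space M. v \<le> -1 * Q \<omega>})"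
    by (rule finite_measure_mono) measurable
  also have "\<dots> \<le> prob {\<omega> \<in> space M. v \<le> 1 * Q \<omega>} + prob {\<omega> \<in> space M. v \<le> -1 * Q \<omega>}"
    by (rule measure_Un_le; measurable)
  also have "\<dots> \<le> 2 * exp (4 - sqrt n * v)" using one[of 1] one[of "-1"] by simp
  finally show ?thesis by (simp add: Q_def I_def)
qed

lemma prob_image_event:
  assumes n: "n \<ge> 16"
  shows "prob (space M - image_event v) \<le> real n * (real n * (4 * exp (4 - sqrt n * v)))"
proof -
  define B where "B i j c = {\<omega> \<in> space M. v \<le> \<bar>\<Sum>k\<in>zero_set (test_vec i j c). (mat_vec n (\<lambda>i j. A \<omega> $$ (i,j)) (test_vec i j c) k)\<^sup>2 - 1 / n\<bar>}" for i j c
  have Bm [measurable]: "B i j c \<in> events" for i j c unfolding B_def by measurable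
  have "prob (space M - image_event v) \<le> prob (\<Union>i<n. \<Union>j<n. \<Union>c\<in>{-1,1}. B i j c)"
  proof (rule finite_measure_mono)
    show "space M - image_event v \<subseteq> (\<Union>i<n. \<Union>j<n. \<Union>c\<in>{-1,1}. B i j c)"
      unfolding image_event_def B_def by (force simp: not_le)
    show "(\<Union>i<n. \<Union>j<n. \<Union>c\<in>{-1,1}. B i j c) \<in> events" by (intro sets.finite_UN Bm) auto
  qed
  also have "\<dots> \<le> (\<Sum>i<n. prob (\<Union>j<n. \<Union>c\<in>{-1,1}. B i j c))"
    using Bm by (intro finite_measure_subadditive_finite) (auto intro!: sets.finite_UN)
  also have "\<dots> \<le> (\<Sum>i<n. \<Sum>j<n. prob (\<Union>c\<in>{-1,1}. B i j c))"
    using Bm by (intro sum_mono finite_measure_subadditive_finite) (auto intro!: sets.finite_UN)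
  also have "\<dots> \<le> (\<Sum>i<n. \<Sum>j<n. \<Sum>c\<in>{-1,1}. prob (B i j c))"
    using Bm by (intro sum_mono finite_measure_subadditive_finite) auto
  also have "\<dots> \<le> (\<Sum>i<n. \<Sum>j<n. \<Sum>c\<in>{-1,1::real}. 2 * exp (4 - sqrt n * v))"
    unfolding B_def by (intro sum_mono prob_image sq_norm_test_vec n) auto
  finally show ?thesis by simp
qed

text \<open>The errors are the fluctuation \<open>v\<close> on the zero coordinates, at most two
  further squares of size 2 * \<delta>^2 each, and their shares 1 / n of the centring. Off the
  diagonal, the difference of the two test norms is twice the entry of the square.\<close>

lemma square_entries:
  assumes \<omega>: "\<omega> \<in> entry_event \<delta>" "\<omega> \<in> image_event v" and d: "\<delta> \<ge> 0" and ij: "i < n" "j < n"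
  defines "a \<equiv> \<lambda>i j. A \<omega> $$ (i,j)"
  shows "\<bar>(\<Sum>k<n. a i k * a j k) - (if i = j then 1 else 0)\<bar> \<le> v + 4 * \<delta>\<^sup>2 + 2 / n"
proof -
  have \<omega>s: "\<omega> \<in> space M" using \<omega> by (simp add: entry_event_def)
  define F where "F c = sq_norm n (mat_vec n a (test_vec i j c))" for c
  have mv: "mat_vec n a (test_vec i j c) k = (if i = j then a k i else (a k i + c * a k j) / sqrt 2)" if "k < n" for c k
  proof (cases "i = j")
    case True
    have "mat_vec n a (test_vec i j c) k = (\<Sum>l<n. if l = i then a k l else 0)"
      unfolding mat_vec_def by (intro sum.cong) (use True in \<open>auto simp: test_vec_def\<close>)
    thus ?thesis using True ij by simp
  next
    case False
    have "mat_vec n a (test_vec i j c) k = (\<Sum>l<n. (if l = i then a k l / sqrt 2 else 0) + (if l = j then c * a k l / sqrt 2 else 0))"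
      unfolding mat_vec_def by (intro sum.cong) (use False in \<open>auto simp: test_vec_def\<close>)
    thus ?thesis using False ij by (simp add: sum.distrib add_divide_distrib)
  qed
  have F: "\<bar>F c - 1\<bar> \<le> v + 4 * \<delta>\<^sup>2 + 2 / n" if c: "c \<in> {-1,1}" for c
  proof -
    define x where "x = test_vec i j c"
    define J where "J = {..<n} - zero_set x"
    have J: "J \<subseteq> {i,j}" by (auto simp: J_def zero_set_def x_def test_vec_def split: if_splits)
    have "card J \<le> card {i,j}" by (rule card_mono[OF _ J]) auto
    hence cJ: "card J \<le> 2" by (rule order_trans) (rule card_insert_le_m1; simp)
    have Z: "zero_set x \<subseteq> {..<n}" by (auto simp: zero_set_def)
    have split: "(\<Sum>k<n. f k) = (\<Sum>k\<in>zero_set x. f k) + (\<Sum>k\<in>J. f k)" for f :: "nat \<Rightarrow> real"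
      unfolding J_def using sum.subset_diff[OF Z, of f] by simp
    have "F c = (\<Sum>k\<in>zero_set x. (mat_vec n a x k)\<^sup>2) + (\<Sum>k\<in>J. (mat_vec n a x k)\<^sup>2)"
      unfolding F_def sq_norm_def x_def[symmetric] by (rule split)
    moreover have "1 = (\<Sum>k\<in>zero_set x. 1 / real n) + card J / n"
      using split[of "\<lambda>_. 1 / real n"] n_pos by simp
    ultimately have eq: "F c - 1 = (\<Sum>k\<in>zero_set x. (mat_vec n a x k)\<^sup>2 - 1 / n) + ((\<Sum>k\<in>J. (mat_vec n a x k)\<^sup>2) - card J / n)"
      by (simp add: sum_subtractf)
    have "\<bar>\<Sum>k\<in>zero_set x. (mat_vec n a x k)\<^sup>2 - 1 / n\<bar> \<le> v"
      using \<omega>(2) ij c by (auto simp: image_event_def a_def x_def)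
    moreover have "(\<Sum>k\<in>J. (mat_vec n a x k)\<^sup>2) \<le> (\<Sum>k\<in>J. 2 * \<delta>\<^sup>2)"
    proof (rule sum_mono)
      fix k assume "k \<in> J"
      hence k: "k < n" by (auto simp: J_def)
      have e: "\<bar>a k l\<bar> \<le> \<delta>" if "l < n" for l using \<omega>(1) k that by (auto simp: entry_event_def a_def)
      have e2: "(a k l)\<^sup>2 \<le> \<delta>\<^sup>2" if "l < n" for l using e[OF that] d by (metis abs_ge_zero power2_abs power_mono)
      show "(mat_vec n a x k)\<^sup>2 \<le> 2 * \<delta>\<^sup>2"
      proof (cases "i = j")
        case True
        have "(a k i)\<^sup>2 \<le> 2 * \<delta>\<^sup>2" using e2[OF ij(1)] zero_le_power2[of \<delta>] by linarith
        thus ?thesis using True mv[OF k, of c] by (simp add: x_def)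
      next
        case False
        have "(a k i + c * a k j)\<^sup>2 \<le> (2 * \<delta>)\<^sup>2"
        proof -
          have "\<bar>a k i + c * a k j\<bar> \<le> 2 * \<delta>" using e[OF ij(1)] e[OF ij(2)] c by auto
          thus ?thesis by (metis abs_ge_zero power2_abs power_mono)
        qed
        thus ?thesis using False mv[OF k, of c] by (simp add: x_def power_divide power_mult_distrib)
      qed
    qed
    moreover have "(\<Sum>k\<in>J. 2 * \<delta>\<^sup>2) \<le> 4 * \<delta>\<^sup>2"
    proof -
      have "real (card J) * (2 * \<delta>\<^sup>2) \<le> 2 * (2 * \<delta>\<^sup>2)" using cJ by (intro mult_right_mono) auto
      thus ?thesis by simp
    qed
    moreover have "0 \<le> (\<Sum>k\<in>J. (mat_vec n a x k)\<^sup>2)" by (intro sum_nonneg) auto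
    moreover have "card J / n \<le> 2 / n" "0 \<le> card J / n" "0 \<le> 2 / real n" using cJ by (auto intro: divide_right_mono)
    moreover have "0 \<le> \<delta>\<^sup>2" by simp
    ultimately show ?thesis unfolding eq by linarith
  qed
  have as: "a k l = a l k" if "k < n" "l < n" for k l using A_sym[OF \<omega>s that] by (simp add: a_def)
  show ?thesis
  proof (cases "i = j")
    case True
    have "F 1 = (\<Sum>k<n. a i k * a j k)"
      unfolding F_def sq_norm_def by (intro sum.cong refl) (use True mv as ij in \<open>auto simp: power2_eq_square\<close>)
    thus ?thesis using F[of 1] True by simp
  next
    case False
    have "F 1 - F (-1) = (\<Sum>k<n. ((a k i + 1 * a k j) / sqrt 2)\<^sup>2 - ((a k i + (-1) * a k j) / sqrt 2)\<^sup>2)"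
      unfolding F_def sq_norm_def sum_subtractf[symmetric] by (intro sum.cong refl) (use False mv in auto)
    also have "\<dots> = (\<Sum>k<n. 2 * (a i k * a j k))"
    proof (intro sum.cong refl)
      fix k assume k: "k \<in> {..<n}"
      have "((p + 1 * q) / sqrt 2)\<^sup>2 - ((p + (-1) * q) / sqrt 2)\<^sup>2 = 2 * (p * q)" for p q :: real
        by (simp add: power_divide power2_eq_square field_simps)
      thus "((a k i + 1 * a k j) / sqrt 2)\<^sup>2 - ((a k i + (-1) * a k j) / sqrt 2)\<^sup>2 = 2 * (a i k * a j k)"
        using as[of k i] as[of k j] k ij by (simp only: lessThan_iff)
    qed
    finally have "F 1 - F (-1) = 2 * (\<Sum>k<n. a i k * a j k)" by (simp add: sum_distrib_left)
    thus ?thesis using F[of 1] F[of "-1"] False by (simp add: abs_le_iff)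
  qed
qed

end

section \<open>The eigenvalue gap of the Laplacian\<close>

definition max_scale :: "nat \<Rightarrow> real" where
  "max_scale n = sqrt (2 * ln (real n))"

text \<open>The right-hand side of \<open>eigenvalue_gap_bound\<close> at the thresholds of the event \<open>good\<close> below.\<close>

definition gap_error :: "real \<Rightarrow> real \<Rightarrow> nat \<Rightarrow> real" where
  "gap_error \<epsilon> K n = (let a = max_scale n; \<delta> = real n powr (-1/4); s = real n powr (1/8);
     \<beta> = s * (\<delta> + 4 * \<delta>\<^sup>2 + 2 / n) + s\<^sup>2 * \<delta>\<^sup>2; Dm = (1 + \<epsilon>) * a + 20; l = (1 - \<epsilon>) * a - 21; l' = (1 + \<epsilon>) * a + 21 in
     2 * (s * \<delta>) + (1 + \<beta>) / l - (1 - \<beta>) / l' + 2 * (2 * (K + 20) + Dm * \<epsilon>\<^sup>2) / l\<^sup>2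
       + (4 * (K\<^sup>2 + 20\<^sup>2) + 2 * Dm\<^sup>2 * \<epsilon>\<^sup>2) / (l\<^sup>2 * (a / 64)))"

text \<open>The limit of \<open>max_scale n * gap_error \<epsilon> K n\<close>. \<open>K\<close> has
  dropped out, its terms being of lower order, so \<epsilon> can be fixed before the sparsity and
  \<open>K\<close>.\<close>

definition gap_error_limit :: "real \<Rightarrow> real" where
  "gap_error_limit \<epsilon> = 1 / (1 - \<epsilon>) - 1 / (1 + \<epsilon>) + 2 * ((1 + \<epsilon>) * \<epsilon>\<^sup>2) / (1 - \<epsilon>)\<^sup>2
     + 2 * (1 + \<epsilon>)\<^sup>2 * \<epsilon>\<^sup>2 / ((1 - \<epsilon>)\<^sup>2 * (1 / 64))"

lemma max_scale_at_top: "filterlim max_scale at_top sequentially"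
  unfolding max_scale_def by real_asymp

lemma gap_error_tendsto:
  assumes e: "0 < \<epsilon>" "\<epsilon> < 1"
  shows "(\<lambda>n. max_scale n * gap_error \<epsilon> K n) \<longlonglongrightarrow> gap_error_limit \<epsilon>"
proof -
  define a where "a = max_scale"
  define \<alpha> where "\<alpha> n = real n powr (1/8) * real n powr (-1/4)" for n :: nat
  define \<beta> where "\<beta> n = real n powr (1/8) * (real n powr (-1/4) + 4 * (real n powr (-1/4))\<^sup>2 + 2 / n) + (real n powr (1/8))\<^sup>2 * (real n powr (-1/4))\<^sup>2" for n :: nat
  have a: "filterlim a at_top sequentially" unfolding a_def by (rule max_scale_at_top)
  have lin: "(\<lambda>n. (c * a n + d) / a n) \<longlonglongrightarrow> c" for c d
  proof -
    have "(\<lambda>n. d / a n) \<longlonglongrightarrow> 0" by (rule real_tendsto_divide_at_top[OF tendsto_const a])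
    hence "(\<lambda>n. c + d / a n) \<longlonglongrightarrow> c + 0" by (intro tendsto_add tendsto_const)
    moreover have "\<forall>\<^sub>F n in sequentially. c + d / a n = (c * a n + d) / a n"
      using filterlim_at_top_dense[THEN iffD1, OF a, rule_format, of 0] by eventually_elim (simp add: field_simps)
    ultimately show ?thesis by (auto intro: Lim_transform_eventually)
  qed
  have \<alpha>: "(\<lambda>n. a n * \<alpha> n) \<longlonglongrightarrow> 0" unfolding a_def max_scale_def \<alpha>_def by real_asymp
  have \<beta>: "\<beta> \<longlonglongrightarrow> 0" unfolding \<beta>_def by real_asymp
  \<comment> \<open>The same product with numerators and denominators divided by suitable powers of
    \<open>a n\<close>, so that limits can be taken factor by factor.\<close>
  define X where "X n = 2 * (a n * \<alpha> n) + (1 + \<beta> n) / (((1 - \<epsilon>) * a n + (-21)) / a n) - (1 - \<beta> n) / (((1 + \<epsilon>) * a n + 21) / a n)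
     + 2 * (((1 + \<epsilon>) * \<epsilon>\<^sup>2 * a n + (2 * (K + 20) + 20 * \<epsilon>\<^sup>2)) / a n) / (((1 - \<epsilon>) * a n + (-21)) / a n)\<^sup>2
     + (4 * (K\<^sup>2 + 20\<^sup>2) / a n / a n + 2 * (((1 + \<epsilon>) * a n + 20) / a n)\<^sup>2 * \<epsilon>\<^sup>2) / ((((1 - \<epsilon>) * a n + (-21)) / a n)\<^sup>2 * (1 / 64))" for n
  have z: "(\<lambda>n. 4 * (K\<^sup>2 + 20\<^sup>2) / a n / a n) \<longlonglongrightarrow> 0"
    by (rule real_tendsto_divide_at_top[OF real_tendsto_divide_at_top[OF tendsto_const a] a])
  have "X \<longlonglongrightarrow> 2 * 0 + (1 + 0) / (1 - \<epsilon>) - (1 - 0) / (1 + \<epsilon>) + 2 * ((1 + \<epsilon>) * \<epsilon>\<^sup>2) / (1 - \<epsilon>)\<^sup>2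
     + (0 + 2 * (1 + \<epsilon>)\<^sup>2 * \<epsilon>\<^sup>2) / ((1 - \<epsilon>)\<^sup>2 * (1 / 64))"
    unfolding X_def by (intro tendsto_intros \<alpha> \<beta> lin z) (use e in auto)
  moreover have "\<forall>\<^sub>F n in sequentially. X n = max_scale n * gap_error \<epsilon> K n"
  proof -
    have "filterlim (\<lambda>n. (1 - \<epsilon>) * a n) at_top sequentially"
      using e by (intro filterlim_tendsto_pos_mult_at_top[OF tendsto_const _ a]) auto
    hence "\<forall>\<^sub>F n in sequentially. (1 - \<epsilon>) * a n > 21" by (simp add: filterlim_at_top_dense)
    moreover have "\<forall>\<^sub>F n in sequentially. a n > 0" using a by (simp add: filterlim_at_top_dense)
    ultimately show ?thesis
    proof eventually_elim
      case (elim n)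
      define l where "l = (1 - \<epsilon>) * a n - 21"
      define l' where "l' = (1 + \<epsilon>) * a n + 21"
      define D where "D = (1 + \<epsilon>) * a n + 20"
      have pos: "l > 0" "a n > 0" "l' > 0" using elim e by (auto simp: l_def l'_def add_pos_pos)
      have L: "(1 - \<epsilon>) * a n + (-21) = l" "(1 + \<epsilon>) * a n + 20 = D" "(1 + \<epsilon>) * a n + 21 = l'" by (auto simp: l_def D_def l'_def)
      have D2: "(1 + \<epsilon>) * \<epsilon>\<^sup>2 * a n + (2 * (K + 20) + 20 * \<epsilon>\<^sup>2) = 2 * (K + 20) + D * \<epsilon>\<^sup>2" by (simp add: D_def algebra_simps)
      have t3: "2 * (p / a n) / (l / a n)\<^sup>2 = a n * (2 * p / l\<^sup>2)" for p
        using pos(1,2) by (simp add: power_divide power2_eq_square)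
      have t4: "(p / a n / a n + 2 * (D / a n)\<^sup>2 * q) / ((l / a n)\<^sup>2 * (1 / 64)) = a n * ((p + 2 * D\<^sup>2 * q) / (l\<^sup>2 * (a n / 64)))" for p q
      proof -
        have "p / a n / a n + 2 * (D / a n)\<^sup>2 * q = (p + 2 * D\<^sup>2 * q) / (a n)\<^sup>2"
          by (simp add: power_divide power2_eq_square add_divide_distrib)
        thus ?thesis using pos(1,2) by (simp add: power_divide power2_eq_square)
      qed
      have t12: "p / (q / a n) = a n * (p / q)" for p q by simp
      have "X n = a n * (2 * \<alpha> n + (1 + \<beta> n) / l - (1 - \<beta> n) / l' + 2 * (2 * (K + 20) + D * \<epsilon>\<^sup>2) / l\<^sup>2
        + (4 * (K\<^sup>2 + 20\<^sup>2) + 2 * D\<^sup>2 * \<epsilon>\<^sup>2) / (l\<^sup>2 * (a n / 64)))"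
      proof -
        have "2 * (a n * x) + a n * y - a n * z + a n * u + a n * w = a n * (2 * x + y - z + u + w)" for x y z u w
          by (simp add: algebra_simps)
        thus ?thesis unfolding X_def L D2 t3 t4 t12 .
      qed
      thus ?case unfolding gap_error_def Let_def l_def l'_def D_def a_def \<alpha>_def \<beta>_def by simp
    qed
  qed
  ultimately have "(\<lambda>n. max_scale n * gap_error \<epsilon> K n) \<longlonglongrightarrow> 2 * 0 + (1 + 0) / (1 - \<epsilon>) - (1 - 0) / (1 + \<epsilon>) + 2 * ((1 + \<epsilon>) * \<epsilon>\<^sup>2) / (1 - \<epsilon>)\<^sup>2
     + (0 + 2 * (1 + \<epsilon>)\<^sup>2 * \<epsilon>\<^sup>2) / ((1 - \<epsilon>)\<^sup>2 * (1 / 64))" by (rule Lim_transform_eventually)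
  thus ?thesis by (simp add: gap_error_limit_def)
qed

lemma gap_error_limit_small:
  assumes "r > 0"
  obtains \<epsilon> where "0 < \<epsilon>" "\<epsilon> < 1/100" "gap_error_limit \<epsilon> < r"
proof -
  have "(gap_error_limit \<longlongrightarrow> 1 / (1 - 0) - 1 / (1 + 0) + 2 * ((1 + 0) * 0\<^sup>2) / (1 - 0)\<^sup>2
     + 2 * (1 + 0)\<^sup>2 * 0\<^sup>2 / ((1 - 0)\<^sup>2 * (1 / 64))) (at_right 0)"
    unfolding gap_error_limit_def by (intro tendsto_intros) auto
  hence "\<forall>\<^sub>F \<epsilon> in at_right 0. gap_error_limit \<epsilon> < r" using assms by (intro order_tendstoD(2)) auto
  moreover have "\<forall>\<^sub>F \<epsilon> in at_right 0. \<epsilon> \<in> {0<..<1/100::real}" by (rule eventually_at_right_real) simp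
  ultimately have "\<forall>\<^sub>F \<epsilon> in at_right 0. gap_error_limit \<epsilon> < r \<and> \<epsilon> \<in> {0<..<1/100::real}" by (rule eventually_conj)
  then obtain \<epsilon> where "gap_error_limit \<epsilon> < r" "\<epsilon> \<in> {0<..<1/100::real}"
    using eventually_happens'[OF trivial_limit_at_right_real] by blast
  thus ?thesis using that by auto
qed

section \<open>The good event and the eigenvalue gap on it\<close>

context GOE
begin

text \<open>The expected number of indices above 31/32 of the scale is at most n^(1 - (31/32)^2),
  well below n^(1/8). The last exclusion forces two whitened row sums to reach (1 - \<epsilon>)
  times the scale: with at most one, some half would lie below.\<close>

definition good :: "real \<Rightarrow> real \<Rightarrow> 'a set" where
  "good \<epsilon> \<eta> = net_event n 10 \<inter> net_event (\<eta> * n) (\<epsilon> / 2)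
     \<inter> entry_event (real n powr (-1/4)) \<inter> image_event (real n powr (-1/4))
     - {\<omega> \<in> space M. \<exists>i<n. (1 + \<epsilon>) * max_scale n \<le> \<bar>white_row_sum i \<omega>\<bar>}
     - {\<omega> \<in> space M. real n powr (1/8) \<le> real (card {i. i < n \<and> 31/32 * max_scale n \<le> white_row_sum i \<omega>})}
     - (white.all_below ((1 - \<epsilon>) * max_scale n) {..<n div 2} \<union> white.all_below ((1 - \<epsilon>) * max_scale n) {n div 2..<n})"

text \<open>Ties are allowed, so for n at least 2 such a pair exists at every outcome and almost
  sure distinctness need not be shown.\<close>

definition top_two :: "'a \<Rightarrow> nat \<Rightarrow> nat \<Rightarrow> bool" where
  "top_two \<omega> i1 i2 \<longleftrightarrow> i1 < n \<and> i2 < n \<and> i1 \<noteq> i2 \<and> white_row_sum i2 \<omega> \<le> white_row_sum i1 \<omega> \<and>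
     (\<forall>j<n. j \<noteq> i1 \<longrightarrow> white_row_sum j \<omega> \<le> white_row_sum i2 \<omega>)"

lemma top_two_exists:
  assumes "n \<ge> 2"
  obtains i1 i2 where "top_two \<omega> i1 i2"
proof -
  let ?Y = "\<lambda>j. white_row_sum j \<omega>"
  have "Max (?Y ` {..<n}) \<in> ?Y ` {..<n}" using assms by (intro Max_in) (auto simp: lessThan_empty_iff)
  then obtain i1 where i1: "i1 < n" "?Y i1 = Max (?Y ` {..<n})" by auto
  have max1: "?Y j \<le> ?Y i1" if "j < n" for j unfolding i1(2) using that by (intro Max_ge) auto
  have "card ({..<n} - {i1}) \<noteq> 0" using i1 assms by simp
  hence ne: "{..<n} - {i1} \<noteq> {}" by force
  have "Max (?Y ` ({..<n} - {i1})) \<in> ?Y ` ({..<n} - {i1})" using ne by (intro Max_in) auto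
  then obtain i2 where "Max (?Y ` ({..<n} - {i1})) = ?Y i2" "i2 \<in> {..<n} - {i1}" by (rule imageE)
  hence i2: "i2 < n" "i2 \<noteq> i1" "?Y i2 = Max (?Y ` ({..<n} - {i1}))" by auto
  have "?Y j \<le> ?Y i2" if "j < n" "j \<noteq> i1" for j unfolding i2(3) using that by (intro Max_ge) auto
  thus ?thesis using i1 i2 max1[of i2] by (intro that[of i1 i2]) (auto simp: top_two_def)
qed

lemma Union_leads_iff:
  assumes t: "top_two \<omega> i1 i2" and \<omega>: "\<omega> \<in> space M" and h: "h \<ge> 0"
  shows "\<omega> \<in> (\<Union>i<n. white.leads h i) \<longleftrightarrow> h < white_row_sum i1 \<omega> - white_row_sum i2 \<omega>"
proof
  assume "\<omega> \<in> (\<Union>i<n. white.leads h i)"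
  then obtain i where i: "i < n" "\<forall>j<n. j \<noteq> i \<longrightarrow> white_row_sum j \<omega> + h < white_row_sum i \<omega>"
    by (auto simp: white.leads_def)
  have "i = i1"
  proof (rule ccontr)
    assume ne: "i \<noteq> i1"
    hence "white_row_sum i1 \<omega> + h < white_row_sum i \<omega>" using i t by (auto simp: top_two_def)
    moreover have "white_row_sum i \<omega> \<le> white_row_sum i2 \<omega>" "white_row_sum i2 \<omega> \<le> white_row_sum i1 \<omega>"
      using t i ne by (auto simp: top_two_def)
    ultimately show False using h by linarith
  qed
  thus "h < white_row_sum i1 \<omega> - white_row_sum i2 \<omega>" using i(2)[rule_format, of i2] t by (auto simp: top_two_def)
next
  assume h': "h < white_row_sum i1 \<omega> - white_row_sum i2 \<omega>"
  have "\<omega> \<in> white.leads h i1"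
    unfolding white.leads_def using t \<omega> h' by (fastforce simp: top_two_def)
  thus "\<omega> \<in> (\<Union>i<n. white.leads h i)" using t by (auto simp: top_two_def)
qed

definition eigenvalue_gap :: "'a \<Rightarrow> real" where
  "eigenvalue_gap \<omega> = ordered_eigenvalue 1 (laplacian (A \<omega>)) - ordered_eigenvalue 2 (laplacian (A \<omega>))"

lemma eigenvalue_gap_measurable [measurable]:
  assumes n: "n \<ge> 2"
  shows "eigenvalue_gap \<in> borel_measurable M"
proof -
  have "(\<lambda>\<omega>. ordered_eigenvalue k (laplacian (A \<omega>))) \<in> borel_measurable M" if "k \<in> {1,2}" for k
  proof (rule borel_measurable_ordered_eigenvalue[OF n that])
    fix i j assume ij: "i < n" "j < n"
    have "(\<lambda>\<omega>. (if i = j then row_sum i \<omega> else 0) - A \<omega> $$ (i,j)) \<in> borel_measurable M"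
      unfolding row_sum_def using ij by (intro borel_measurable_diff measurable_If borel_measurable_sum A_measurable) auto
    thus "(\<lambda>\<omega>. laplacian (A \<omega>) $$ (i,j)) \<in> borel_measurable M"
      by (rule measurable_cong[THEN iffD1, rotated]) (use ij in \<open>auto simp: laplacian_index[OF A_carrier] row_sum_def\<close>)
  qed (use laplacian_carrier[OF A_carrier] laplacian_transpose[OF A_carrier A_transpose] in auto)
  thus ?thesis unfolding eigenvalue_gap_def by (intro borel_measurable_diff) auto
qed

lemma good_sets [measurable]: "good \<epsilon> \<eta> \<in> events"
proof -
  have "{\<omega> \<in> space M. \<exists>i<n. (1 + \<epsilon>) * max_scale n \<le> \<bar>white_row_sum i \<omega>\<bar>} \<in> events" by measurable
  moreover have "{\<omega> \<in> space M. real n powr (1/8) \<le> real (card {i. i < n \<and> 31/32 * max_scale n \<le> white_row_sum i \<omega>})} \<in> events"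
    by measurable
  moreover have "white.all_below t {..<n div 2} \<in> events" "white.all_below t {n div 2..<n} \<in> events" for t
    by (rule white.all_below_sets; auto)+
  ultimately show ?thesis unfolding good_def by (intro sets.Diff sets.Int sets.Un net_event_sets entry_event_sets image_event_sets)
qed

lemma good_eigenvalue_gap:
  fixes \<epsilon> \<eta> :: real
  assumes e: "0 < \<epsilon>" "\<epsilon> < 1/100" and \<eta>: "0 < \<eta>"
    and s: "real n powr (1/8) \<le> \<eta> * n / 2"
    and small: "real n powr (1/8) * (real n powr (-1/4) + 4 * (real n powr (-1/4))\<^sup>2 + 2 / n) + (real n powr (1/8))\<^sup>2 * (real n powr (-1/4))\<^sup>2 \<le> 1"
    and a: "12000 \<le> max_scale n"
    and small': "real n powr (1/8) * real n powr (-1/4) + (2 * (20 * sqrt (2 / \<eta>) + 20) + ((1 + \<epsilon>) * max_scale n + 20) * \<epsilon>\<^sup>2) / ((1 - \<epsilon>) * max_scale n - 21)\<^sup>2 \<le> 1"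
    and \<omega>: "\<omega> \<in> good \<epsilon> \<eta>" and tt: "top_two \<omega> i1 i2"
  shows "\<bar>eigenvalue_gap \<omega> - (white_row_sum i1 \<omega> - white_row_sum i2 \<omega>)\<bar> \<le> gap_error \<epsilon> (20 * sqrt (2 / \<eta>)) n"
proof -
  define b where "b i j = A \<omega> $$ (i,j)" for i j
  define Y where "Y i = white_row_sum i \<omega>" for i
  define sh where "sh = total_shift \<omega>"
  define m where "m = max_scale n"
  define S where "S = {i. i < n \<and> 31/32 * m \<le> Y i}"
  have g: "\<omega> \<in> net_event n 10" "\<omega> \<in> net_event (\<eta> * n) (\<epsilon> / 2)" "\<omega> \<in> entry_event (real n powr (-1/4))" "\<omega> \<in> image_event (real n powr (-1/4))"
    using \<omega> by (auto simp: good_def)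
  have \<omega>s: "\<omega> \<in> space M" using g(3) by (simp add: entry_event_def)
  have Ymax: "\<bar>Y i\<bar> < (1 + \<epsilon>) * m" if "i < n" for i using \<omega> \<omega>s that by (force simp: good_def Y_def m_def not_le)
  have cS: "real (card S) \<le> real n powr (1/8)" using \<omega> \<omega>s by (auto simp: good_def S_def Y_def m_def not_le)
  have t: "i1 < n" "i2 < n" "i1 \<noteq> i2" "Y i2 \<le> Y i1" "\<And>j. j < n \<Longrightarrow> j \<noteq> i1 \<Longrightarrow> Y j \<le> Y i2"
    using tt by (auto simp: top_two_def Y_def)
  have Y2: "(1 - \<epsilon>) * m \<le> Y i2"
  proof (rule ccontr)
    assume "\<not> ?thesis"
    hence "Y j < (1 - \<epsilon>) * m" if "j < n" "j \<noteq> i1" for j using t(5)[OF that] by linarith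
    hence "\<omega> \<in> white.all_below ((1 - \<epsilon>) * m) {..<n div 2} \<or> \<omega> \<in> white.all_below ((1 - \<epsilon>) * m) {n div 2..<n}"
      using \<omega>s by (cases "i1 < n div 2") (auto simp: white.all_below_def Y_def)
    thus False using \<omega> by (auto simp: good_def m_def)
  qed
  have E1: "\<bar>quad_form n b x x\<bar> \<le> 20 * sq_norm n x" for x
  proof -
    define x' where "x' i = (if i < n then x i else 0)" for i
    have "\<bar>quad_form n (\<lambda>i j. A \<omega> $$ (i,j)) x' x'\<bar> \<le> 2 * 10 * sq_norm n x'"
      by (rule net_eventD[OF g(1), of "{..<n}"]) (use n_pos in \<open>auto simp: x'_def\<close>)
    thus ?thesis by (simp add: quad_form_def sq_norm_def x'_def b_def)
  qed
  have E2: "\<bar>quad_form n b x x\<bar> \<le> \<epsilon> * sq_norm n x"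
    if "J \<subseteq> {..<n}" "real (card J) \<le> \<eta> * n" "\<And>i. i \<notin> J \<Longrightarrow> x i = 0" for J x
  proof -
    have "\<bar>quad_form n (\<lambda>i j. A \<omega> $$ (i,j)) x x\<bar> \<le> 2 * (\<epsilon> / 2) * sq_norm n x"
      by (rule net_eventD[OF g(2) _ _ that(1,2)]) (use e \<eta> n_pos that(3) in auto)
    thus ?thesis by (simp add: b_def[abs_def])
  qed
  have d_eq: "(\<Sum>j<n. b i j) = Y i + sh" if "i < n" for i
    using row_sum_eq[OF \<omega>s that] by (simp add: row_sum_def b_def Y_def sh_def)
  \<comment> \<open>The norm bound at the all-ones vector limits the sum of all entries to 20 * n.
    This is the 20 by which \<open>d\<close> and \<open>Y\<close> may differ below.\<close>
  have sh: "\<bar>sh\<bar> \<le> 20"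
  proof -
    have "\<bar>\<Sum>i<n. row_sum i \<omega>\<bar> \<le> 20 * real n"
      using E1[of "\<lambda>_. 1"] by (simp add: quad_form_def row_sum_def b_def sq_norm_def)
    moreover have c: "0 \<le> 1 - 1 / sqrt 2" "1 - 1 / sqrt 2 \<le> (1::real)" by auto
    ultimately have "(1 - 1 / sqrt 2) * \<bar>\<Sum>i<n. row_sum i \<omega>\<bar> \<le> 1 * (20 * real n)" by (intro mult_mono) auto
    hence "(1 - 1 / sqrt 2) * \<bar>\<Sum>i<n. row_sum i \<omega>\<bar> / real n \<le> 20" using n_pos by (simp add: divide_le_eq)
    moreover have "\<bar>sh\<bar> = (1 - 1 / sqrt 2) * \<bar>\<Sum>i<n. row_sum i \<omega>\<bar> / real n"
      unfolding sh_def total_shift_def abs_mult abs_divide using c(1) by (simp only: abs_of_nonneg of_nat_0_le_iff times_divide_eq_left)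
    ultimately show ?thesis by linarith
  qed
  interpret P: schur_split n b "\<lambda>i. \<Sum>j<n. b i j" S
    by unfold_locales (use A_sym[OF \<omega>s] in \<open>auto simp: b_def S_def\<close>)
  have em: "(1 - \<epsilon>) * m \<ge> 99/100 * m" "(1 + \<epsilon>) * m \<ge> m" using e a by (auto simp: m_def intro!: mult_right_mono)
  \<comment> \<open>99/100 exceeds 31/32 + 1/64 by 9/1600, and from scale 12000 on this surplus
    covers the additive constants 20 + 20 + 21.\<close>
  have L: "31/32 * m \<le> (1 - \<epsilon>) * m" "31/32 * m + 20 + 20 + m / 64 \<le> (1 - \<epsilon>) * m - 21"
      "1 \<le> (1 - \<epsilon>) * m - 21" "1 \<le> (1 + \<epsilon>) * m + 21" "0 < m / 64"
    using em a unfolding m_def by linarith+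
  have "\<bar>(ordered_eigenvalue 1 (laplacian (A \<omega>)) - ordered_eigenvalue 2 (laplacian (A \<omega>))) - ((\<Sum>j<n. b i1 j) - (\<Sum>j<n. b i2 j))\<bar>
    \<le> 2 * (real n powr (1/8) * real n powr (-1/4))
      + (1 + (real n powr (1/8) * (real n powr (-1/4) + 4 * (real n powr (-1/4))\<^sup>2 + 2 / n) + (real n powr (1/8))\<^sup>2 * (real n powr (-1/4))\<^sup>2)) / ((1 - \<epsilon>) * m - 21)
      - (1 - (real n powr (1/8) * (real n powr (-1/4) + 4 * (real n powr (-1/4))\<^sup>2 + 2 / n) + (real n powr (1/8))\<^sup>2 * (real n powr (-1/4))\<^sup>2)) / ((1 + \<epsilon>) * m + 21)
      + 2 * (2 * (20 * sqrt (2 / \<eta>) + 20) + ((1 + \<epsilon>) * m + 20) * \<epsilon>\<^sup>2) / ((1 - \<epsilon>) * m - 21)\<^sup>2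
      + (4 * ((20 * sqrt (2 / \<eta>))\<^sup>2 + 20\<^sup>2) + 2 * ((1 + \<epsilon>) * m + 20)\<^sup>2 * \<epsilon>\<^sup>2) / (((1 - \<epsilon>) * m - 21)\<^sup>2 * (m / 64))"
  \<comment> \<open>\<open>K = 20 * sqrt (2 / \<eta>)\<close> makes the count 20^2 * n / K^2 of
    large indices half of \<kappa>, the other half being for \<open>S\<close>. In \<Lambda> = (1 -
    \<epsilon>) * m - 21 and \<Lambda>' the 21 is the shift bound 20 plus the margin 1, and \<mu> =
    m / 64 is the room between 31/32 and 1 - \<epsilon>.\<close>
  proof (rule P.eigenvalue_gap_bound[where \<kappa> = "\<eta> * n" and \<theta> = "31/32 * m + 20"])
    show "laplacian (A \<omega>) \<in> carrier_mat n n" by (rule laplacian_carrier[OF A_carrier[OF \<omega>s]])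
    show "transpose_mat (laplacian (A \<omega>)) = laplacian (A \<omega>)" by (rule laplacian_transpose[OF A_carrier[OF \<omega>s] A_transpose[OF \<omega>s]])
    show "laplacian (A \<omega>) $$ (i,j) = P.lap i j" if "i < n" "j < n" for i j
      unfolding P.lap_def using laplacian_index[OF A_carrier[OF \<omega>s] that] by (simp add: b_def)
    show "\<bar>quad_form n b x x\<bar> \<le> 20 * sq_norm n x" for x by (rule E1)
    show "\<bar>quad_form n b x x\<bar> \<le> \<epsilon> * sq_norm n x"
      if "J \<subseteq> {..<n}" "real (card J) \<le> \<eta> * n" "\<And>i. i \<notin> J \<Longrightarrow> x i = 0" for J x by (rule E2[OF that])
    show "\<bar>b i j\<bar> \<le> real n powr (-1/4)" if "i < n" "j < n" for i j
      using g(3) that by (auto simp: entry_event_def b_def)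
    show "\<bar>(\<Sum>k<n. b i k * b j k) - (if i = j then 1 else 0)\<bar> \<le> real n powr (-1/4) + 4 * (real n powr (-1/4))\<^sup>2 + 2 / n"
      if "i < n" "j < n" for i j
      unfolding b_def by (rule square_entries[OF g(3,4) _ that]) simp
    show "\<bar>\<Sum>j<n. b i j\<bar> \<le> (1 + \<epsilon>) * m + 20" if "i < n" for i
      using Ymax[OF that] sh unfolding d_eq[OF that] by linarith
    show "(\<Sum>j<n. b i j) \<le> 31/32 * m + 20" if "i < n" "i \<notin> S" for i
      using that sh unfolding d_eq[OF that(1)] S_def by auto
    show "0 < 20 * sqrt (2 / \<eta>)" using \<eta> by simp
    show "20\<^sup>2 * real n / (20 * sqrt (2 / \<eta>))\<^sup>2 + real n powr (1/8) \<le> \<eta> * n"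
      using s \<eta> by (simp add: power_mult_distrib)
    show "31/32 * m + 20 + 20 + m / 64 \<le> (1 - \<epsilon>) * m - 21" by (rule L(2))
    show "1 \<le> (1 - \<epsilon>) * m - 21" "1 \<le> (1 + \<epsilon>) * m + 21" "0 < m / 64" by (rule L(3-5))+
    show "i1 \<in> S" "i2 \<in> S" using t(1,2,4) Y2 L(1) by (auto simp: S_def)
    show "(1 - \<epsilon>) * m - 21 + 1 \<le> (\<Sum>j<n. b i2 j)" using Y2 sh unfolding d_eq[OF t(2)] by linarith
    show "(\<Sum>j<n. b i2 j) \<le> (\<Sum>j<n. b i1 j)" using t(4) unfolding d_eq[OF t(1)] d_eq[OF t(2)] by simp
    show "(\<Sum>j<n. b i1 j) + 1 \<le> (1 + \<epsilon>) * m + 21" using Ymax[OF t(1)] sh unfolding d_eq[OF t(1)] by linarith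
    show "(\<Sum>j<n. b i j) \<le> (\<Sum>j<n. b i2 j)" if "i \<in> S" "i \<noteq> i1" for i
      using t(5)[OF _ that(2)] that(1) d_eq[of i] d_eq[OF t(2)] by (simp add: S_def)
  qed (use cS e small small' t(3) in \<open>auto simp: m_def\<close>)
  also have "\<dots> = gap_error \<epsilon> (20 * sqrt (2 / \<eta>)) n" by (simp add: gap_error_def Let_def m_def)
  also have "(\<Sum>j<n. b i1 j) - (\<Sum>j<n. b i2 j) = white_row_sum i1 \<omega> - white_row_sum i2 \<omega>"
    unfolding d_eq[OF t(1)] d_eq[OF t(2)] by (simp add: Y_def)
  finally show ?thesis by (simp add: eigenvalue_gap_def)
qed

end

section \<open>Probability of the bad event and the limit theorem\<close>

definition bad_bound :: "real \<Rightarrow> real \<Rightarrow> real \<Rightarrow> nat \<Rightarrow> real" where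
  "bad_bound \<epsilon> \<eta> b n =
     2 * exp (1 * (21 * real n) + 4 * real n * exp (- 1) - real n * 10\<^sup>2 / 4)
   + 2 * exp (b * (21 * (\<eta> * n)) + 4 * real n * exp (- b) - real n * (\<epsilon> / 2)\<^sup>2 / 4)
   + real n * (real n * (2 * exp (- (real n * (real n powr (-1/4))\<^sup>2 / 4))))
   + real n * (real n * (4 * exp (4 - sqrt n * real n powr (-1/4))))
   + real n * (2 * exp (- ((1 + \<epsilon>) * max_scale n)\<^sup>2 / 2))
   + real n * exp (- (31/32 * max_scale n)\<^sup>2 / 2) / real n powr (1/8)
   + 2 * exp (- (real (n div 2) * std_normal_density ((1 - \<epsilon>) * max_scale n + 1)))"

lemma (in GOE) prob_not_good:
  fixes \<epsilon> \<eta> b :: real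
  assumes e: "0 < \<epsilon>" "\<epsilon> < 1" and \<eta>: "0 < \<eta>" and b: "1 \<le> b" and n: "n \<ge> 16"
  shows "prob (space M - good \<epsilon> \<eta>) \<le> bad_bound \<epsilon> \<eta> b n"
proof -
  have m: "max_scale n \<ge> 0" using n by (simp add: max_scale_def)
  define B1 where "B1 = space M - net_event n 10"
  define B2 where "B2 = space M - net_event (\<eta> * n) (\<epsilon> / 2)"
  define B3 where "B3 = space M - entry_event (real n powr (-1/4))"
  define B4 where "B4 = space M - image_event (real n powr (-1/4))"
  define B5 where "B5 = {\<omega> \<in> space M. \<exists>i<n. (1 + \<epsilon>) * max_scale n \<le> \<bar>white_row_sum i \<omega>\<bar>}"
  define B6 where "B6 = {\<omega> \<in> space M. real n powr (1/8) \<le> real (card {i. i < n \<and> 31/32 * max_scale n \<le> white_row_sum i \<omega>})}"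
  define B7 where "B7 = white.all_below ((1 - \<epsilon>) * max_scale n) {..<n div 2} \<union> white.all_below ((1 - \<epsilon>) * max_scale n) {n div 2..<n}"
  have meas: "B1 \<in> events" "B2 \<in> events" "B3 \<in> events" "B4 \<in> events" "B5 \<in> events" "B6 \<in> events" "B7 \<in> events"
  proof -
    show "B1 \<in> events" "B2 \<in> events" "B3 \<in> events" "B4 \<in> events" "B5 \<in> events" "B6 \<in> events"
      unfolding B1_def B2_def B3_def B4_def B5_def B6_def by measurable
    show "B7 \<in> events" unfolding B7_def
    proof (intro sets.Un white.all_below_sets)
      show "{..<n div 2} \<subseteq> {..<n}" "{n div 2..<n} \<subseteq> {..<n}" by auto
    qed
  qed
  have "space M - good \<epsilon> \<eta> \<subseteq> B1 \<union> B2 \<union> B3 \<union> B4 \<union> B5 \<union> B6 \<union> B7"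
    unfolding good_def B1_def B2_def B3_def B4_def B5_def B6_def B7_def by blast
  hence "prob (space M - good \<epsilon> \<eta>) \<le> prob (B1 \<union> B2 \<union> B3 \<union> B4 \<union> B5 \<union> B6 \<union> B7)"
    using meas by (intro finite_measure_mono) auto
  also have "\<dots> \<le> prob B1 + prob B2 + prob B3 + prob B4 + prob B5 + prob B6 + prob B7"
    using meas by (intro order_trans[OF measure_Un_le] add_mono order_refl sets.Un) auto
  also have "\<dots> \<le> bad_bound \<epsilon> \<eta> b n"
    unfolding bad_bound_def
  proof (intro add_mono)
    show "prob B1 \<le> 2 * exp (1 * (21 * real n) + 4 * real n * exp (- 1) - real n * 10\<^sup>2 / 4)"
      unfolding B1_def by (rule prob_net_event) (use n in auto)
    show "prob B2 \<le> 2 * exp (b * (21 * (\<eta> * n)) + 4 * real n * exp (- b) - real n * (\<epsilon> / 2)\<^sup>2 / 4)"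
      unfolding B2_def by (rule prob_net_event) (use n e \<eta> b in auto)
    show "prob B3 \<le> real n * (real n * (2 * exp (- (real n * (real n powr (-1/4))\<^sup>2 / 4))))"
      unfolding B3_def by (rule prob_entry_event) (use n in auto)
    show "prob B4 \<le> real n * (real n * (4 * exp (4 - sqrt n * real n powr (-1/4))))"
      unfolding B4_def by (rule prob_image_event[OF n])
    show "prob B5 \<le> real n * (2 * exp (- ((1 + \<epsilon>) * max_scale n)\<^sup>2 / 2))"
      unfolding B5_def by (rule white.prob_max_abs) (use m e in auto)
    show "prob B6 \<le> real n * exp (- (31/32 * max_scale n)\<^sup>2 / 2) / real n powr (1/8)"
      unfolding B6_def by (rule white.prob_card_exceedances) (use m n in auto)
    have "prob B7 \<le> 2 * exp (- (real (n div 2) * measure std_normal {(1 - \<epsilon>) * max_scale n..}))"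
      unfolding B7_def by (rule white.prob_half_below)
    also have "\<dots> \<le> 2 * exp (- (real (n div 2) * std_normal_density ((1 - \<epsilon>) * max_scale n + 1)))"
    proof -
      have "std_normal_density ((1 - \<epsilon>) * max_scale n + 1) \<le> measure std_normal {(1 - \<epsilon>) * max_scale n..}"
        using e m by (intro std_normal_upper_tail_ge) simp
      thus ?thesis by (simp add: mult_left_mono)
    qed
    finally show "prob B7 \<le> 2 * exp (- (real (n div 2) * std_normal_density ((1 - \<epsilon>) * max_scale n + 1)))" .
  qed
  finally show ?thesis .
qed

lemma bad_bound_tendsto_0:
  assumes e: "0 < \<epsilon>" "\<epsilon> < 1" and neg: "21 * b * \<eta> + 4 * exp (- b) < \<epsilon>\<^sup>2 / 16"
  shows "bad_bound \<epsilon> \<eta> b \<longlonglongrightarrow> 0"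
proof -
  have lin: "(\<lambda>n. 2 * exp (c * real n)) \<longlonglongrightarrow> 0" if "c < 0" for c :: real
    using that by real_asymp
  \<comment> \<open>The norm threshold 10 is large enough: 21 + 4 / e is less than 25 = 10^2 /
    4.\<close>
  have e1: "4 * exp (-1) < (4::real)" by simp
  have t1: "(\<lambda>n. 2 * exp (1 * (21 * real n) + 4 * real n * exp (- 1) - real n * 10\<^sup>2 / 4)) \<longlonglongrightarrow> 0"
  proof -
    have "1 * (21 * real n) + 4 * real n * exp (- 1) - real n * 10\<^sup>2 / 4 = (4 * exp (-1) - 4) * real n" for n
      by (simp add: algebra_simps)
    thus ?thesis using lin[of "4 * exp (-1) - 4"] e1 by simp
  qed
  have t2: "(\<lambda>n. 2 * exp (b * (21 * (\<eta> * real n)) + 4 * real n * exp (- b) - real n * (\<epsilon> / 2)\<^sup>2 / 4)) \<longlonglongrightarrow> 0"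
  proof -
    have "b * (21 * (\<eta> * real n)) + 4 * real n * exp (- b) - real n * (\<epsilon> / 2)\<^sup>2 / 4 = (21 * b * \<eta> + 4 * exp (- b) - \<epsilon>\<^sup>2 / 16) * real n" for n
      by (simp add: algebra_simps power_divide)
    thus ?thesis using lin[of "21 * b * \<eta> + 4 * exp (- b) - \<epsilon>\<^sup>2 / 16"] neg by simp
  qed
  have t3: "(\<lambda>n. real n * (real n * (2 * exp (- (real n * (real n powr (-1/4))\<^sup>2 / 4))))) \<longlonglongrightarrow> 0" by real_asymp
  have t4: "(\<lambda>n. real n * (real n * (4 * exp (4 - sqrt n * real n powr (-1/4))))) \<longlonglongrightarrow> 0" by real_asymp
  have sq: "(c * max_scale n)\<^sup>2 / 2 = c\<^sup>2 * ln n" if "n \<ge> 1" for c n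
    using that by (simp add: max_scale_def power_mult_distrib)
  have t5: "(\<lambda>n. real n * (2 * exp (- ((1 + \<epsilon>) * max_scale n)\<^sup>2 / 2))) \<longlonglongrightarrow> 0"
  proof -
    define d where "d = (1 + \<epsilon>)\<^sup>2"
    have "d > 1" using e by (simp add: d_def power2_eq_square algebra_simps add_pos_pos)
    hence "(\<lambda>n. real n * (2 * exp (- (d * ln (real n))))) \<longlonglongrightarrow> 0" by real_asymp
    moreover have "\<forall>\<^sub>F n in sequentially. real n * (2 * exp (- (d * ln (real n)))) = real n * (2 * exp (- ((1 + \<epsilon>) * max_scale n)\<^sup>2 / 2))"
      by (rule eventually_sequentiallyI[of 1]) (simp add: sq d_def)
    ultimately show ?thesis by (rule Lim_transform_eventually)
  qed
  have t6: "(\<lambda>n. real n * exp (- (31/32 * max_scale n)\<^sup>2 / 2) / real n powr (1/8)) \<longlonglongrightarrow> 0"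
  proof -
    define c where "c = (31/32 :: real)\<^sup>2"
    \<comment> \<open>The condition on the level 31/32: Markov's inequality leaves n^(7/8 -
      (31/32)^2), which has to tend to zero.\<close>
    have "7/8 - c < 0" by (simp add: c_def power2_eq_square)
    hence "(\<lambda>n. real n powr (7/8 - c)) \<longlonglongrightarrow> 0" by real_asymp
    moreover have "\<forall>\<^sub>F n in sequentially. real n powr (7/8 - c) = real n * exp (- (31/32 * max_scale n)\<^sup>2 / 2) / real n powr (1/8)"
    proof (rule eventually_sequentiallyI[of 1])
      fix n :: nat assume n: "1 \<le> n"
      have "- (31/32 * max_scale n)\<^sup>2 / 2 = - c * ln (real n)" using sq[OF n, of "31/32"] by (simp add: c_def)
      hence "exp (- (31/32 * max_scale n)\<^sup>2 / 2) = real n powr (- c)" using n by (simp add: powr_def)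
      moreover have "real n powr (7/8 - c) = real n powr (1 + - c - 1/8)" by simp
      moreover have "\<dots> = real n * real n powr (- c) / real n powr (1/8)"
        unfolding powr_diff powr_add using n by simp
      ultimately show "real n powr (7/8 - c) = real n * exp (- (31/32 * max_scale n)\<^sup>2 / 2) / real n powr (1/8)"
        by (simp only:)
    qed
    ultimately show ?thesis by (rule Lim_transform_eventually)
  qed
  have t7: "(\<lambda>n. 2 * exp (- (real (n div 2) * std_normal_density ((1 - \<epsilon>) * max_scale n + 1)))) \<longlonglongrightarrow> 2 * 0"
    using half_sample_tail_limit[of "1 - \<epsilon>"] e by (intro tendsto_mult tendsto_const) (simp add: max_scale_def)
  have "bad_bound \<epsilon> \<eta> b \<longlonglongrightarrow> 0 + 0 + 0 + 0 + 0 + 0 + 2 * 0"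
    unfolding bad_bound_def[abs_def] by (intro tendsto_add t1 t2 t3 t4 t5 t6 t7)
  thus ?thesis by simp
qed

text \<open>Makes the entropy of the sparse net smaller than its tail exponent. \<open>b\<close>
  comes first, to make 4 * exp (- b) small; then \<open>\<eta>\<close> is taken inversely
  proportional to \<open>b\<close>.\<close>

lemma sparsity_exists:
  assumes "\<epsilon> > 0"
  obtains b \<eta> :: real where "1 \<le> b" "0 < \<eta>" "21 * b * \<eta> + 4 * exp (- b) < \<epsilon>\<^sup>2 / 16"
proof -
  have "((\<lambda>b::real. 4 * exp (- b)) \<longlongrightarrow> 0) at_top" by real_asymp
  hence "\<forall>\<^sub>F b in at_top. 4 * exp (- b) < \<epsilon>\<^sup>2 / 32" using assms by (intro order_tendstoD(2)) auto
  moreover have "\<forall>\<^sub>F b in at_top. (1::real) \<le> b" by (rule eventually_ge_at_top)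
  ultimately have "\<forall>\<^sub>F b in at_top. 4 * exp (- b) < \<epsilon>\<^sup>2 / 32 \<and> 1 \<le> b" by (rule eventually_conj)
  then obtain b where b: "4 * exp (- b) < \<epsilon>\<^sup>2 / 32" "1 \<le> b" using eventually_happens'[OF trivial_limit_at_top_linorder] by blast
  show ?thesis
    by (rule that[of b "\<epsilon>\<^sup>2 / (32 * 21 * b)"]) (use b assms in \<open>auto simp: field_simps\<close>)
qed

theorem corollary1p5:
  fixes M :: "nat \<Rightarrow> 'a measure" and A :: "nat \<Rightarrow> 'a \<Rightarrow> real mat" and x :: real
  assumes "\<And>n. n \<ge> 1 \<Longrightarrow> is_GOE n (M n) (A n)"
    and "x > 0"
  shows "(\<lambda>n. \<P>(\<omega> in M n.
            sqrt (2 * ln (real n)) *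
              (ordered_eigenvalue 1 (laplacian (A n \<omega>)) - ordered_eigenvalue 2 (laplacian (A n \<omega>)))
            > x)) \<longlonglongrightarrow> exp (- x)"
proof -
  have G: "GOE n (M n) (A n)" if "n \<ge> 1" for n using assms(1)[OF that] that by unfold_locales
  define W where "W n = GOE.white_row_sum n (A n)" for n
  have iid: "iid_normal (M n) n (W n)" if "n \<ge> 1" for n
    unfolding W_def by (rule GOE.iid_white_row_sum[OF G[OF that]])
  define U where "U y n = (\<Union>i<n. iid_normal.leads (M n) n (W n) (y / max_scale n) i)" for y n
  define T where "T n = {\<omega> \<in> space (M n). x < max_scale n * GOE.eigenvalue_gap (A n) \<omega>}" for n
  define P where "P n = measure (M n) (T n)" for n
  define q where "q y n = measure (M n) (U y n)" for y n
  have qlim: "q y \<longlonglongrightarrow> exp (- y)" if "y > 0" for y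
    using iid_normal_gap_limit[of M W y] iid that unfolding q_def U_def max_scale_def by blast
  have "P \<longlonglongrightarrow> exp (- x)"
  proof (rule LIMSEQ_I)
    fix r :: real assume r: "r > 0"
    have c1: "((\<lambda>e. exp (- (x - e))) \<longlongrightarrow> exp (- (x - 0))) (at_right 0)"
      and c2: "((\<lambda>e. exp (- (x + e))) \<longlongrightarrow> exp (- (x + 0))) (at_right 0)"
      by (intro tendsto_intros)+
    have "\<forall>\<^sub>F e in at_right 0. exp (- (x - e)) < exp (- x) + r / 2 \<and> exp (- x) - r / 2 < exp (- (x + e)) \<and> e \<in> {0<..<x}"
      using order_tendstoD(2)[OF c1, of "exp (-x) + r / 2"] order_tendstoD(1)[OF c2, of "exp (-x) - r / 2"] r \<open>x > 0\<close>
      by (intro eventually_conj eventually_at_right_real) auto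
    then obtain e where e: "exp (- (x - e)) < exp (- x) + r / 2" "exp (- x) - r / 2 < exp (- (x + e))" "0 < e" "e < x"
      using eventually_happens'[OF trivial_limit_at_right_real] by auto
    \<comment> \<open>\<open>e\<close> is the slack in \<open>x\<close> that continuity of the
      exponential allows. The tolerance \<epsilon> pushes the limiting scaled error below
      \<open>e\<close>; only then are \<open>b\<close> and \<open>\<eta>\<close> chosen to make the
      sparse norm small with high probability, which fixes \<open>K\<close>.\<close>
    obtain \<epsilon> where \<epsilon>: "0 < \<epsilon>" "\<epsilon> < 1/100" "gap_error_limit \<epsilon> < e" using gap_error_limit_small[OF e(3)] .
    obtain b \<eta> :: real where \<eta>: "1 \<le> b" "0 < \<eta>" "21 * b * \<eta> + 4 * exp (- b) < \<epsilon>\<^sup>2 / 16" using sparsity_exists[OF \<epsilon>(1)] .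
    define K where "K = 20 * sqrt (2 / \<eta>)"
    have ev1: "\<forall>\<^sub>F n in sequentially. max_scale n * gap_error \<epsilon> K n < e"
      using order_tendstoD(2)[OF gap_error_tendsto \<epsilon>(3)] \<epsilon> by auto
    have ev2: "\<forall>\<^sub>F n in sequentially. bad_bound \<epsilon> \<eta> b n < r / 2"
      by (rule order_tendstoD(2)[OF bad_bound_tendsto_0[OF _ _ \<eta>(3)]]) (use \<epsilon> r in auto)
    have ev3: "\<forall>\<^sub>F n in sequentially. q (x - e) n < exp (- x) + r / 2"
      using order_tendstoD(2)[OF qlim e(1)] e by auto
    have ev4: "\<forall>\<^sub>F n in sequentially. exp (- x) - r / 2 < q (x + e) n"
      using order_tendstoD(1)[OF qlim e(2)] e by auto
    have ev5: "\<forall>\<^sub>F n in sequentially. real n powr (1/8) \<le> \<eta> * n / 2" using \<eta>(2) by real_asymp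
    have ev6: "\<forall>\<^sub>F n in sequentially. real n powr (1/8) * (real n powr (-1/4) + 4 * (real n powr (-1/4))\<^sup>2 + 2 / n) + (real n powr (1/8))\<^sup>2 * (real n powr (-1/4))\<^sup>2 \<le> 1"
      by real_asymp
    have ev7: "\<forall>\<^sub>F n in sequentially. 12000 \<le> max_scale n"
      using max_scale_at_top by (simp add: filterlim_at_top)
    have ev8: "\<forall>\<^sub>F n in sequentially. real n powr (1/8) * real n powr (-1/4) + (2 * (20 * sqrt (2 / \<eta>) + 20) + ((1 + \<epsilon>) * max_scale n + 20) * \<epsilon>\<^sup>2) / ((1 - \<epsilon>) * max_scale n - 21)\<^sup>2 \<le> 1"
    proof -
      have "0 < 1 - \<epsilon>" using \<epsilon> by simp
      thus ?thesis unfolding K_def[symmetric] max_scale_def using \<epsilon>(1) by real_asymp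
    qed
    have ev9: "\<forall>\<^sub>F n in sequentially. (16::nat) \<le> n" by (rule eventually_ge_at_top)
    have "\<forall>\<^sub>F n in sequentially. norm (P n - exp (- x)) < r"
      using ev1 ev2 ev3 ev4 ev5 ev6 ev7 ev8 ev9
    proof eventually_elim
      case (elim n)
      have n: "n \<ge> 1" "n \<ge> 2" using elim(9) by auto
      interpret GOE n "M n" "A n" by (rule G[OF n(1)])
      have WW: "W n = white_row_sum" by (simp add: W_def)
      have m: "max_scale n > 0" using elim(7) by linarith
      have Tm: "T n \<in> events" unfolding T_def using eigenvalue_gap_measurable[OF n(2)] by measurable
      have Um: "U y n \<in> events" for y
        unfolding U_def WW by (intro sets.finite_UN white.leads_sets) auto
      \<comment> \<open>On the good event the two scaled gaps differ by less than \<open>e\<close>,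
        so \<open>T n\<close> lies there between the events of the whitened row sums at x + e and x
        - e.\<close>
      have near: "(\<omega> \<in> T n \<longrightarrow> \<omega> \<in> U (x - e) n) \<and> (\<omega> \<in> U (x + e) n \<longrightarrow> \<omega> \<in> T n)" if g: "\<omega> \<in> good \<epsilon> \<eta>" for \<omega>
      proof -
        have \<omega>s: "\<omega> \<in> space (M n)" using g sets.sets_into_space[OF good_sets] by blast
        obtain i1 i2 where tt: "top_two \<omega> i1 i2" using top_two_exists[OF n(2)] .
        define D where "D = white_row_sum i1 \<omega> - white_row_sum i2 \<omega>"
        have "\<bar>eigenvalue_gap \<omega> - D\<bar> \<le> gap_error \<epsilon> K n"
          unfolding D_def K_def by (rule good_eigenvalue_gap[OF \<epsilon>(1,2) \<eta>(2) elim(5,6,7,8) g tt])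
        hence "max_scale n * \<bar>eigenvalue_gap \<omega> - D\<bar> \<le> max_scale n * gap_error \<epsilon> K n" using m by (intro mult_left_mono) auto
        also have "\<dots> < e" by (rule elim(1))
        finally have "\<bar>max_scale n * eigenvalue_gap \<omega> - max_scale n * D\<bar> < e"
          using m by (simp add: abs_mult right_diff_distrib[symmetric])
        moreover have "\<omega> \<in> U y n \<longleftrightarrow> y < max_scale n * D" if "y > 0" for y
          unfolding U_def WW D_def using that m Union_leads_iff[OF tt \<omega>s, of "y / max_scale n"]
          by (simp add: divide_less_eq mult.commute)
        ultimately show ?thesis using e \<omega>s by (auto simp: T_def)
      qed
      have bad: "prob (space (M n) - good \<epsilon> \<eta>) < r / 2"
        using prob_not_good[OF \<epsilon>(1) _ \<eta>(2,1) elim(9)] \<epsilon> elim(2) by linarith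
      have "P n \<le> prob (U (x - e) n \<union> (space (M n) - good \<epsilon> \<eta>))"
        unfolding P_def using near Um by (intro finite_measure_mono) (auto simp: T_def)
      also have "\<dots> \<le> q (x - e) n + prob (space (M n) - good \<epsilon> \<eta>)"
        unfolding q_def using Um by (intro measure_Un_le) auto
      finally have up: "P n < exp (- x) + r" using bad elim(3) by linarith
      have "U (x + e) n \<subseteq> space (M n)" using sets.sets_into_space[OF Um] .
      hence "q (x + e) n \<le> prob (T n \<union> (space (M n) - good \<epsilon> \<eta>))"
        unfolding q_def using near Tm by (intro finite_measure_mono) auto
      also have "\<dots> \<le> P n + prob (space (M n) - good \<epsilon> \<eta>)"
        unfolding P_def using Tm by (intro measure_Un_le) auto
      finally have "exp (- x) - r < P n" using bad elim(4) by linarith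
      thus ?case using up by (simp add: abs_less_iff)
    qed
    thus "\<exists>no. \<forall>n\<ge>no. norm (P n - exp (- x)) < r" by (simp add: eventually_sequentially)
  qed
  moreover have "\<forall>\<^sub>F n in sequentially. P n = \<P>(\<omega> in M n.
            sqrt (2 * ln (real n)) *
              (ordered_eigenvalue 1 (laplacian (A n \<omega>)) - ordered_eigenvalue 2 (laplacian (A n \<omega>)))
            > x)"
  proof (rule eventually_sequentiallyI[of 1])
    fix n :: nat assume "1 \<le> n"
    then interpret GOE n "M n" "A n" by (rule G)
    show "P n = \<P>(\<omega> in M n.
            sqrt (2 * ln (real n)) *
              (ordered_eigenvalue 1 (laplacian (A n \<omega>)) - ordered_eigenvalue 2 (laplacian (A n \<omega>)))
            > x)"
      by (simp add: P_def T_def max_scale_def eigenvalue_gap_def)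
  qed
  ultimately show ?thesis by (rule Lim_transform_eventually)
qed

end
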